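(* Let $\beta_2>\beta_1>0$ with $\frac{\beta_2}{\beta_1}=\frac{m}{n}$ for positive integers $m,n$, and let $\kappa\in\mathbb{R}$ with $\kappa>n-1$ and $\frac{m\kappa}{n}>m-1$. Then $$\beta_1^{2/3}\, L_{m,\,m\kappa/n,\,\beta_1}\ \succeq\ \beta_2^{2/3}\, L_{n,\kappa,\beta_2}.$$
   Context: For real $\beta>0$, integer $N\ge1$ and real $\kappa>N-1$, the Laguerre $\beta$-ensemble is the random point configuration $\lambda_1\ge\dots\ge\lambda_N$ in $(0,\infty)$ with joint density $$\frac{1}{Z_{N,\kappa}^{\beta}}\prod_{k=1}^{N}\lambda_k^{\frac{\beta}{2}(\kappa-N+1)-1}e^{-\frac{\beta}{2}\lambda_k}\prod_{j<k}|\lambda_j-\lambda_k|^{\beta}.$$ Let $\lambda_1^{(N,L,\beta)}$ be its largest point (with parameter $\kappa$) and define $$L_{N,\kappa,\beta}:=(\sqrt{\kappa N})^{1/3}(\sqrt\kappa+\sqrt N)^{2/3}\left(\frac{\lambda_1^{(N,L,\beta)}}{(\sqrt\kappa+\sqrt N)^2}-1\right).$$ For real random variables $X,Y$, $X\succeq Y$ means $\mathbb{P}(X>t)\ge\mathbb{P}(Y>t)$ for all $t\in\mathbb{R}$. *)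

theory Defs
  imports "HOL-Probability.Probability"
begin

text \<open>Configurations of N points are functions x :: nat => real on the index set {..<N};
  x 0 >= x 1 >= ... >= x (N-1) > 0, so x 0 is the largest point.\<close>

definition cfg_space :: "nat \<Rightarrow> (nat \<Rightarrow> real) measure" where
  "cfg_space N = PiM {..<N} (\<lambda>_. lborel)"

definition laguerre_region :: "nat \<Rightarrow> (nat \<Rightarrow> real) set" where
  "laguerre_region N = {x \<in> space (cfg_space N).
      (\<forall>k<N. 0 < x k) \<and> (\<forall>j k. j < k \<and> k < N \<longrightarrow> x k \<le> x j)}"

definition laguerre_weight :: "real \<Rightarrow> nat \<Rightarrow> real \<Rightarrow> (nat \<Rightarrow> real) \<Rightarrow> real" where
  "laguerre_weight \<beta> N \<kappa> x =
     (\<Prod>k<N. x k powr (\<beta> / 2 * (\<kappa> - real N + 1) - 1) * exp (- \<beta> / 2 * x k)) *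
     (\<Prod>j<N. \<Prod>k<N. if j < k then \<bar>x j - x k\<bar> powr \<beta> else 1)"

definition laguerre_Z :: "real \<Rightarrow> nat \<Rightarrow> real \<Rightarrow> ennreal" where
  "laguerre_Z \<beta> N \<kappa> =
     (\<integral>\<^sup>+ x. indicator (laguerre_region N) x * ennreal (laguerre_weight \<beta> N \<kappa> x) \<partial>cfg_space N)"

definition laguerre_ensemble :: "real \<Rightarrow> nat \<Rightarrow> real \<Rightarrow> (nat \<Rightarrow> real) measure" where
  "laguerre_ensemble \<beta> N \<kappa> = density (cfg_space N)
     (\<lambda>x. indicator (laguerre_region N) x * ennreal (laguerre_weight \<beta> N \<kappa> x) / laguerre_Z \<beta> N \<kappa>)"

definition laguerre_L :: "nat \<Rightarrow> real \<Rightarrow> (nat \<Rightarrow> real) \<Rightarrow> real" where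
  "laguerre_L N \<kappa> x =
     (sqrt (\<kappa> * real N)) powr (1/3) * (sqrt \<kappa> + sqrt (real N)) powr (2/3) *
     (x 0 / (sqrt \<kappa> + sqrt (real N))^2 - 1)"

definition scaled_L_tail :: "real \<Rightarrow> real \<Rightarrow> nat \<Rightarrow> real \<Rightarrow> real \<Rightarrow> real" where
  "scaled_L_tail c \<beta> N \<kappa> t =
     measure (laguerre_ensemble \<beta> N \<kappa>)
       {x \<in> space (laguerre_ensemble \<beta> N \<kappa>). t < c * laguerre_L N \<kappa> x}"

end

theory Submission
  imports Defs
begin

text \<open>
  Write \<open>s = \<beta> / 2\<close>, fix a threshold \<open>T\<close> and attach independent gamma variables \<open>g j\<close> of shape \<open>s\<close>
  to the points \<open>x j\<close> of the ensemble. The number \<open>X = (\<Sum>j. g j / (T - x j))\<close> is, up to a factor, the corner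
  entry of the resolvent of the bidiagonal model of the ensemble. Perturbing by the rank one matrix with
  weights \<open>g\<close> produces the points of the next (half) level, the roots of \<open>1 = (\<Sum>j. g j / (z - x j))\<close>. They interlace
  with \<open>x\<close>, and all of them lie below \<open>T\<close> if and only if \<open>X < 1\<close>. Two explicit changes of variables (from the weights to the roots,
  and from the roots back to fresh gamma weights) show that the next value of \<open>X\<close> is \<open>v / (T * (1 - X))\<close> with
  an independent gamma variable \<open>v\<close>. Hence the probability that the largest point lies below \<open>T\<close> is the probability
  that a one-dimensional chain never reaches \<open>1\<close>.

  That probability decreases when a shape parameter grows and when further steps are put in front. Since
  \<open>\<beta>1 * m = \<beta>2 * n\<close> and \<open>\<beta>1 * \<kappa>1 = \<beta>2 * \<kappa>\<close>, the shape parameters of the two ensembles,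
  aligned at the end of the chain, are ordered, and the ensemble with the smaller \<open>\<beta>\<close> has the longer chain.
\<close>

section \<open>Lebesgue measure on finite products\<close>

text \<open>The statement fixes the ensemble by its density, so the recursion is proved for
  densities; matrices explain only its form. Adding a column to a \<open>k\<close> by
  \<open>k\<close> factor perturbs its Gram matrix by rank one. The Gram matrix of the transposed
  factor, now \<open>k + 1\<close> by \<open>k\<close>, has one more eigenvalue, namely
  \<open>0\<close>, and adding a column to that factor moves it above \<open>0\<close>. Hence there
  are two half steps per point and an auxiliary point at \<open>0\<close>. With
  \<open>c + 1 = s * (\<kappa> - N + 1)\<close> the gamma shapes are
  \<open>s * (\<kappa> - i)\<close> and \<open>s * (N - i)\<close>, half the degrees of freedom of
  the chi-square variables in the bidiagonal model.

  The largest point alone satisfies no recursion; points and weights together do, and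
  \<open>X\<close> is the scalar statistic whose law closes up. After normalisation the threshold
  enters the chain only through the rate \<open>r * T\<close> of the gamma variables. The edge
  scaling assigns to a given \<open>t\<close> the thresholds \<open>\<theta>\<close> and
  \<open>\<rho> * \<theta>\<close>, and these give both chains the same rate; this leaves only the
  shapes and the length to compare.\<close>

abbreviation lborel_pow :: "nat \<Rightarrow> (nat \<Rightarrow> real) measure" where
  "lborel_pow n \<equiv> PiM {..<n} (\<lambda>_. lborel)"

lemma nn_integral_lborel_pow_0:
  "(\<integral>\<^sup>+x. f x \<partial>lborel_pow 0) = f (\<lambda>_. undefined)"
proof -
  interpret product_sigma_finite "\<lambda>_::nat. lborel :: real measure" ..
  show ?thesis using nn_integral_empty[of f] by simp
qed

lemma nn_integral_lborel_pow_Suc: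
  assumes "f \<in> borel_measurable (lborel_pow (Suc n))"
  shows "(\<integral>\<^sup>+x. f x \<partial>lborel_pow (Suc n)) = (\<integral>\<^sup>+x. \<integral>\<^sup>+u. f (x(n := u)) \<partial>lborel \<partial>lborel_pow n)"
proof -
  interpret product_sigma_finite "\<lambda>_::nat. lborel :: real measure" ..
  show ?thesis using product_nn_integral_insert[of "{..<n}" n f] assms by (simp add: lessThan_Suc)
qed

lemma sigma_finite_lborel_pow: "sigma_finite_measure (lborel_pow n)"
proof -
  interpret product_sigma_finite "\<lambda>_::nat. lborel :: real measure" ..
  show ?thesis by (rule sigma_finite) simp
qed

lemma nn_integral_lborel_pow_swap:
  fixes f :: "real \<Rightarrow> (nat \<Rightarrow> real) \<Rightarrow> ennreal"
  assumes "(\<lambda>(u, x). f u x) \<in> borel_measurable (lborel \<Otimes>\<^sub>M lborel_pow n)"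
  shows "(\<integral>\<^sup>+u. \<integral>\<^sup>+x. f u x \<partial>lborel_pow n \<partial>lborel) = (\<integral>\<^sup>+x. \<integral>\<^sup>+u. f u x \<partial>lborel \<partial>lborel_pow n)"
proof -
  interpret pair_sigma_finite "lborel :: real measure" "lborel_pow n"
    using sigma_finite_lborel_pow by (simp add: pair_sigma_finite_def sigma_finite_lborel)
  show ?thesis using Fubini'[of "\<lambda>u x. f u x"] assms by simp
qed

lemma nn_integral_lborel_pow_swap2:
  fixes f :: "(nat \<Rightarrow> real) \<Rightarrow> (nat \<Rightarrow> real) \<Rightarrow> ennreal"
  assumes "(\<lambda>(y, x). f y x) \<in> borel_measurable (lborel_pow m \<Otimes>\<^sub>M lborel_pow n)"
  shows "(\<integral>\<^sup>+y. \<integral>\<^sup>+x. f y x \<partial>lborel_pow n \<partial>lborel_pow m) = (\<integral>\<^sup>+x. \<integral>\<^sup>+y. f y x \<partial>lborel_pow m \<partial>lborel_pow n)"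
proof -
  interpret pair_sigma_finite "lborel_pow m" "lborel_pow n"
    using sigma_finite_lborel_pow by (simp add: pair_sigma_finite_def)
  show ?thesis using Fubini'[of "\<lambda>u x. f u x"] assms by simp
qed

lemma measurable_lborel_pow_upd [measurable (raw)]:
  assumes f: "f \<in> N \<rightarrow>\<^sub>M lborel_pow n" and g: "g \<in> borel_measurable N"
  shows "(\<lambda>p. (f p)(n := g p)) \<in> N \<rightarrow>\<^sub>M lborel_pow (Suc n)"
proof -
  have 1: "f p \<in> extensional {..<n}" if "p \<in> space N" for p
    using measurable_space[OF f that] by (simp add: space_PiM PiE_def)
  have "(\<lambda>p. \<lambda>i\<in>{..<Suc n}. if i = n then g p else f p i) \<in> N \<rightarrow>\<^sub>M lborel_pow (Suc n)"
    apply (rule measurable_restrict)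
    subgoal for i
      apply (cases "i = n")
      using g measurable_compose[OF f measurable_component_singleton[of i "{..<n}" "\<lambda>_. lborel"]]
      by auto
    done
  moreover have "(\<lambda>i\<in>{..<Suc n}. if i = n then g p else f p i) = (f p)(n := g p)" if "p \<in> space N" for p
    using 1[OF that] by (auto simp: restrict_def extensional_def fun_eq_iff)
  ultimately show ?thesis by (simp cong: measurable_cong)
qed

lemma measurable_lborel_pow_cons [measurable (raw)]:
  assumes f: "f \<in> N \<rightarrow>\<^sub>M lborel_pow n" and g: "g \<in> borel_measurable N"
  shows "(\<lambda>p. case_nat (g p) (f p)) \<in> N \<rightarrow>\<^sub>M lborel_pow (Suc n)"
proof -
  have 1: "f p \<in> extensional {..<n}" if "p \<in> space N" for p
    using measurable_space[OF f that] by (simp add: space_PiM PiE_def)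
  have "(\<lambda>p. \<lambda>i\<in>{..<Suc n}. case_nat (g p) (f p) i) \<in> N \<rightarrow>\<^sub>M lborel_pow (Suc n)"
    apply (rule measurable_restrict)
    subgoal for i
      apply (cases i)
      using g measurable_compose[OF f measurable_component_singleton[of "i - 1" "{..<n}" "\<lambda>_. lborel"]]
      by auto
    done
  moreover have "(\<lambda>i\<in>{..<Suc n}. case_nat (g p) (f p) i) = case_nat (g p) (f p)" if "p \<in> space N" for p
    using 1[OF that] by (auto simp: restrict_def extensional_def fun_eq_iff split: nat.split)
  ultimately show ?thesis by (simp cong: measurable_cong)
qed

lemma case_nat_upd: "(case_nat v y)(Suc n := u) = case_nat v (y(n := u))"
  by (auto simp: fun_eq_iff split: nat.split)

text \<open>Splits off index \<open>0\<close> instead of the last index: in the case \<epsilon> = 0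
  below, that coordinate is the total mass and is integrated separately from the zeros.\<close>

lemma nn_integral_lborel_pow_cons:
  assumes "f \<in> borel_measurable (lborel_pow (Suc n))"
  shows "(\<integral>\<^sup>+x. f x \<partial>lborel_pow (Suc n)) = (\<integral>\<^sup>+v. \<integral>\<^sup>+y. f (case_nat v y) \<partial>lborel_pow n \<partial>lborel)"
  using assms
proof (induction n arbitrary: f)
  case 0
  note [measurable] = 0
  have "(\<lambda>_. undefined)(0 := u) = case_nat u (\<lambda>_. undefined)" for u :: real
    by (auto simp: fun_eq_iff split: nat.split)
  then show ?case
    by (simp add: nn_integral_lborel_pow_Suc[OF 0] nn_integral_lborel_pow_0 del: lessThan_0 fun_upd_apply)
next
  case (Suc n)
  note [measurable] = Suc.prems
  have "(\<integral>\<^sup>+x. f x \<partial>lborel_pow (Suc (Suc n)))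
      = (\<integral>\<^sup>+x. \<integral>\<^sup>+u. f (x(Suc n := u)) \<partial>lborel \<partial>lborel_pow (Suc n))"
    by (rule nn_integral_lborel_pow_Suc) fact
  also have "\<dots> = (\<integral>\<^sup>+v. \<integral>\<^sup>+y. \<integral>\<^sup>+u. f ((case_nat v y)(Suc n := u)) \<partial>lborel \<partial>lborel_pow n \<partial>lborel)"
    by (rule Suc.IH) measurable
  also have "\<dots> = (\<integral>\<^sup>+v. \<integral>\<^sup>+y. f (case_nat v y) \<partial>lborel_pow (Suc n) \<partial>lborel)"
    by (rule nn_integral_cong, subst nn_integral_lborel_pow_Suc) (measurable, simp add: case_nat_upd)
  finally show ?case .
qed

lemma nn_integral_lborel_pow_scale:
  assumes "f \<in> borel_measurable (lborel_pow n)" "\<And>j. j < n \<Longrightarrow> 0 < c j"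
  shows "(\<integral>\<^sup>+g. f g \<partial>lborel_pow n)
    = ennreal (\<Prod>j<n. c j) * (\<integral>\<^sup>+g. f (\<lambda>j\<in>{..<n}. c j * g j) \<partial>lborel_pow n)"
  using assms
proof (induction n arbitrary: f)
  case 0
  then show ?case by (simp add: nn_integral_lborel_pow_0 restrict_def del: lessThan_0 nn_integral_const) simp
next
  case (Suc n)
  note [measurable] = Suc.prems(1)
  have cn: "0 < c n" by (simp add: Suc.prems)
  have eq: "(\<lambda>j\<in>{..<n}. c j * g j)(n := c n * u) = (\<lambda>j\<in>{..<Suc n}. c j * (g(n := u)) j)" for g u
    by (auto simp: fun_eq_iff restrict_def)
  have "(\<integral>\<^sup>+g. f g \<partial>lborel_pow (Suc n)) = (\<integral>\<^sup>+g. \<integral>\<^sup>+u. f (g(n := u)) \<partial>lborel \<partial>lborel_pow n)"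
    by (rule nn_integral_lborel_pow_Suc) fact
  also have "\<dots> = (\<integral>\<^sup>+g. ennreal (c n) * (\<integral>\<^sup>+u. f (g(n := c n * u)) \<partial>lborel) \<partial>lborel_pow n)"
  proof (rule nn_integral_cong)
    fix g assume [measurable]: "g \<in> space (lborel_pow n)"
    show "(\<integral>\<^sup>+u. f (g(n := u)) \<partial>lborel) = ennreal (c n) * (\<integral>\<^sup>+u. f (g(n := c n * u)) \<partial>lborel)"
      using cn by (subst nn_integral_real_affine[where c = "c n" and t = 0]) auto
  qed
  also have "\<dots> = ennreal (c n) * (\<integral>\<^sup>+g. \<integral>\<^sup>+u. f (g(n := c n * u)) \<partial>lborel \<partial>lborel_pow n)"
    by (rule nn_integral_cmult) measurable
  also have "(\<integral>\<^sup>+g. \<integral>\<^sup>+u. f (g(n := c n * u)) \<partial>lborel \<partial>lborel_pow n)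
    = ennreal (\<Prod>j<n. c j) *
      (\<integral>\<^sup>+g. \<integral>\<^sup>+u. f ((\<lambda>j\<in>{..<n}. c j * g j)(n := c n * u)) \<partial>lborel \<partial>lborel_pow n)"
    by (rule Suc.IH) (measurable, use Suc.prems in auto)
  also have "(\<integral>\<^sup>+g. \<integral>\<^sup>+u. f ((\<lambda>j\<in>{..<n}. c j * g j)(n := c n * u)) \<partial>lborel \<partial>lborel_pow n)
    = (\<integral>\<^sup>+g. f (\<lambda>j\<in>{..<Suc n}. c j * g j) \<partial>lborel_pow (Suc n))"
    unfolding eq by (rule nn_integral_lborel_pow_Suc[symmetric]) measurable
  also have "ennreal (c n) * (ennreal (\<Prod>j<n. c j) * (\<integral>\<^sup>+g. f (\<lambda>j\<in>{..<Suc n}. c j * g j) \<partial>lborel_pow (Suc n)))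
    = ennreal (\<Prod>j<Suc n. c j) * (\<integral>\<^sup>+g. f (\<lambda>j\<in>{..<Suc n}. c j * g j) \<partial>lborel_pow (Suc n))"
  proof -
    have "ennreal (\<Prod>j<Suc n. c j) = ennreal (c n) * ennreal (\<Prod>j<n. c j)"
    proof -
      have "0 \<le> c n" "0 \<le> (\<Prod>j<n. c j)"
        using Suc.prems(2) by (auto intro!: prod_nonneg simp: less_imp_le)
      then show ?thesis by (simp add: ennreal_mult mult.commute)
    qed
    then show ?thesis by (simp only: mult.assoc)
  qed
  finally show ?case .
qed

text \<open>The map may blow up at \<open>b\<close>, so the open interval is exhausted by compact
  ones, where ordinary substitution applies, and monotone convergence does the rest. The assumptions
  \<open>lo\<close> and \<open>hi\<close> make the images exhaust the half line.\<close>

lemma nn_integral_substitution_halfline: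
  fixes f :: "real \<Rightarrow> ennreal" and a b :: real
  assumes f: "f \<in> borel_measurable borel" and ab: "a < b"
    and deriv: "\<And>w. a < w \<Longrightarrow> w < b \<Longrightarrow> (U has_real_derivative U' w) (at w)"
    and cont: "continuous_on {a<..<b} U'"
    and nonneg: "\<And>w. a < w \<Longrightarrow> w < b \<Longrightarrow> 0 \<le> U' w"
    and pos: "\<And>w. a < w \<Longrightarrow> w < b \<Longrightarrow> 0 < U w"
    and lo: "\<And>u. 0 < u \<Longrightarrow> \<exists>w. a < w \<and> w < b \<and> U w \<le> u"
    and hi: "\<And>u. 0 < u \<Longrightarrow> \<exists>w. a < w \<and> w < b \<and> u \<le> U w"
  shows "(\<integral>\<^sup>+u. (if 0 < u then f u else 0) \<partial>lborel)
    = (\<integral>\<^sup>+w. (if a < w \<and> w < b then ennreal (U' w) * f (U w) else 0) \<partial>lborel)"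
proof -
  \<comment> \<open>With the summand 3, \<open>d n\<close> is strictly below half the length already
    for \<open>n = 0\<close>, so that no compact interval degenerates.\<close>
  define d where "d n = (b - a) / (real n + 3)" for n
  have d: "0 < d n" "d n < (b - a) / 2" "d (Suc n) \<le> d n" for n
  proof -
    have "(b - a) * 2 < (b - a) * (real n + 3)" using ab by (intro mult_strict_left_mono) auto
    then show "d n < (b - a) / 2" using ab by (simp add: d_def divide_simps)
  qed (use ab in \<open>auto simp: d_def intro!: divide_left_mono\<close>)
  have dlim: "d \<longlonglongrightarrow> 0" unfolding d_def by real_asymp
  have dsmall: "\<exists>n. d n < e" if "0 < e" for e
    using order_tendstoD(2)[OF dlim that] by (auto simp: eventually_sequentially)
  have mono: "U v \<le> U w" if "a < v" "v \<le> w" "w < b" for v w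
    by (rule DERIV_nonneg_imp_nondecreasing[OF that(2)]) (use deriv nonneg that in force)
  have dmono: "d n \<le> d m" if "m \<le> n" for m n
    using lift_Suc_antimono_le[of d m n] d(3) that by auto
  have step: "(\<integral>\<^sup>+u. f u * indicator {U (a + d n)..U (b - d n)} u \<partial>lborel)
    = (\<integral>\<^sup>+w. f (U w) * ennreal (U' w) * indicator {a + d n..b - d n} w \<partial>lborel)" for n
  proof (rule nn_integral_substitution_aux[OF f])
    show "a + d n < b - d n" using d(2)[of n] by auto
    show "continuous_on {a + d n..b - d n} U'"
      by (rule continuous_on_subset[OF cont]) (use d(1)[of n] in auto)
  qed (use d(1)[of n] deriv nonneg in auto)
  \<comment> \<open>Nothing is known about \<open>U\<close> and \<open>U'\<close> outside the open
    interval. Measurability is shown for their truncations, which yield the same integrand because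
    of its indicator.\<close>
  have Um: "(\<lambda>w. f (U w) * ennreal (U' w) * indicator {a + d n..b - d n} w) \<in> borel_measurable lborel" for n
  proof -
    have "continuous_on {a + d n..b - d n} U"
      by (rule DERIV_continuous_on[where D = U'])
        (use deriv d(1)[of n] in \<open>auto intro: has_field_derivative_at_within\<close>)
    then have 1: "(\<lambda>w. indicator {a + d n..b - d n} w *\<^sub>R U w) \<in> borel_measurable borel"
      by (rule borel_measurable_continuous_on_indicator[rotated]) auto
    have "continuous_on {a + d n..b - d n} U'"
      by (rule continuous_on_subset[OF cont]) (use d(1)[of n] in auto)
    then have 2: "(\<lambda>w. indicator {a + d n..b - d n} w *\<^sub>R U' w) \<in> borel_measurable borel"
      by (rule borel_measurable_continuous_on_indicator[rotated]) auto
    note [measurable] = f 1 2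
    have "(\<lambda>w. f (indicator {a + d n..b - d n} w *\<^sub>R U w) * ennreal (indicator {a + d n..b - d n} w *\<^sub>R U' w)
       * indicator {a + d n..b - d n} w) \<in> borel_measurable borel" by measurable
    also have "(\<lambda>w. f (indicator {a + d n..b - d n} w *\<^sub>R U w) * ennreal (indicator {a + d n..b - d n} w *\<^sub>R U' w)
       * indicator {a + d n..b - d n} w) = (\<lambda>w. f (U w) * ennreal (U' w) * indicator {a + d n..b - d n} w)"
      by (auto simp: fun_eq_iff indicator_def)
    finally show ?thesis by simp
  qed
  have "(\<integral>\<^sup>+u. (if 0 < u then f u else 0) \<partial>lborel)
    = (\<integral>\<^sup>+u. (SUP n. f u * indicator {U (a + d n)..U (b - d n)} u) \<partial>lborel)"
  proof (rule nn_integral_cong)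
    fix u :: real
    show "(if 0 < u then f u else 0) = (SUP n. f u * indicator {U (a + d n)..U (b - d n)} u)"
    proof (cases "0 < u")
      case True
      obtain w1 w2 where w: "a < w1" "w1 < b" "U w1 \<le> u" "a < w2" "w2 < b" "u \<le> U w2"
        using lo[OF True] hi[OF True] by auto
      obtain n where "d n < min (w1 - a) (b - w2)" using dsmall[of "min (w1 - a) (b - w2)"] w by auto
      with w d(1,2)[of n] have "U (a + d n) \<le> U w1" "U w2 \<le> U (b - d n)" by (auto intro!: mono)
      with w have "u \<in> {U (a + d n)..U (b - d n)}" by auto
      then have "f u \<le> (SUP n. f u * indicator {U (a + d n)..U (b - d n)} u)"
        by (intro SUP_upper2[of n]) auto
      moreover have "(SUP n. f u * indicator {U (a + d n)..U (b - d n)} u) \<le> f u"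
        by (rule SUP_least) (auto simp: indicator_def)
      ultimately show ?thesis using True by auto
    next
      case False
      have "0 < U (a + d n)" for n using pos[of "a + d n"] d(1,2)[of n] ab by auto
      then have "u < U (a + d n)" for n using False by (meson le_less_trans not_less)
      then have "u \<notin> {U (a + d n)..U (b - d n)}" for n by (auto simp: not_le)
      then show ?thesis using False by simp
    qed
  qed
  also have "\<dots> = (SUP n. \<integral>\<^sup>+u. f u * indicator {U (a + d n)..U (b - d n)} u \<partial>lborel)"
  proof (rule nn_integral_monotone_convergence_SUP)
    show "incseq (\<lambda>n u. f u * indicator {U (a + d n)..U (b - d n)} u)"
    proof (rule incseq_SucI, rule le_funI)
      fix n u
      have "U (a + d (Suc n)) \<le> U (a + d n)" "U (b - d n) \<le> U (b - d (Suc n))"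
        using d[of n] d[of "Suc n"] by (auto intro!: mono)
      then show "f u * indicator {U (a + d n)..U (b - d n)} u
        \<le> f u * indicator {U (a + d (Suc n))..U (b - d (Suc n))} u"
        by (auto simp: indicator_def)
    qed
  qed (use f in measurable)
  also have "\<dots> = (SUP n. \<integral>\<^sup>+w. f (U w) * ennreal (U' w) * indicator {a + d n..b - d n} w \<partial>lborel)"
    by (simp only: step)
  also have "\<dots> = (\<integral>\<^sup>+w. (SUP n. f (U w) * ennreal (U' w) * indicator {a + d n..b - d n} w) \<partial>lborel)"
  proof (rule nn_integral_monotone_convergence_SUP[symmetric])
    show "incseq (\<lambda>n w. f (U w) * ennreal (U' w) * indicator {a + d n..b - d n} w)"
    proof (rule incseq_SucI, rule le_funI)
      fix n w
      show "f (U w) * ennreal (U' w) * indicator {a + d n..b - d n} w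
        \<le> f (U w) * ennreal (U' w) * indicator {a + d (Suc n)..b - d (Suc n)} w"
        using d[of n] by (auto simp: indicator_def)
    qed
  qed (rule Um)
  also have "\<dots> = (\<integral>\<^sup>+w. (if a < w \<and> w < b then ennreal (U' w) * f (U w) else 0) \<partial>lborel)"
  proof (rule nn_integral_cong)
    fix w :: real
    show "(SUP n. f (U w) * ennreal (U' w) * indicator {a + d n..b - d n} w)
       = (if a < w \<and> w < b then ennreal (U' w) * f (U w) else 0)"
    proof (cases "a < w \<and> w < b")
      case True
      obtain n where "d n < min (w - a) (b - w)" using dsmall[of "min (w - a) (b - w)"] True by auto
      then have "w \<in> {a + d n..b - d n}" by auto
      then have "f (U w) * ennreal (U' w) \<le> (SUP n. f (U w) * ennreal (U' w) * indicator {a + d n..b - d n} w)"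
        by (intro SUP_upper2[of n]) auto
      moreover have "(SUP n. f (U w) * ennreal (U' w) * indicator {a + d n..b - d n} w) \<le> f (U w) * ennreal (U' w)"
        by (rule SUP_least) (auto simp: indicator_def)
      ultimately show ?thesis using True by (auto simp: mult.commute)
    next
      case False
      then have "w \<notin> {a + d n..b - d n}" for n using d(1)[of n] by auto
      then show ?thesis using False by auto
    qed
  qed
  finally show ?thesis .
qed

section \<open>Residues of a rational function with interlacing zeros and poles\<close>

definition strict_dec :: "nat \<Rightarrow> (nat \<Rightarrow> real) \<Rightarrow> bool" where
  "strict_dec n x \<longleftrightarrow> (\<forall>i. Suc i < n \<longrightarrow> x (Suc i) < x i)"

lemma strict_decD: "strict_dec n x \<Longrightarrow> j < i \<Longrightarrow> i < n \<Longrightarrow> x i < x j"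
proof (induction i)
  case (Suc i)
  then have "x (Suc i) < x i" by (simp add: strict_dec_def)
  with Suc show ?case by (cases "j = i") auto
qed simp

lemma strict_dec_leD: "strict_dec n x \<Longrightarrow> j \<le> i \<Longrightarrow> i < n \<Longrightarrow> x i \<le> x j"
  using strict_decD[of n x j i] by (cases "j = i") auto

lemma strict_dec_mono: "strict_dec n x \<Longrightarrow> m \<le> n \<Longrightarrow> strict_dec m x"
  by (simp add: strict_dec_def)

definition vandermonde :: "nat \<Rightarrow> (nat \<Rightarrow> real) \<Rightarrow> real" where
  "vandermonde n x = (\<Prod>i<n. \<Prod>j<i. x j - x i)"

lemma vandermonde_0 [simp]: "vandermonde 0 x = 1"
  by (simp add: vandermonde_def)

lemma vandermonde_Suc: "vandermonde (Suc n) x = vandermonde n x * (\<Prod>j<n. x j - x n)"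
  by (simp add: vandermonde_def)

lemma vandermonde_pos: "strict_dec n x \<Longrightarrow> 0 < vandermonde n x"
  unfolding vandermonde_def by (intro prod_pos) (auto dest: strict_decD)

lemma vandermonde_Suc_shift:
  "vandermonde (Suc n) x = (\<Prod>i<n. x 0 - x (Suc i)) * vandermonde n (\<lambda>i. x (Suc i))"
  unfolding vandermonde_def
  by (subst prod.lessThan_Suc_shift) (simp add: prod.lessThan_Suc_shift prod.distrib del: prod.lessThan_Suc)

text \<open>The poles are \<open>x 0, \<dots>, x k\<close> and \<open>y 1, \<dots>, y k\<close> are the zeros between them; \<open>y 0\<close> plays a
  separate role. For \<open>\<epsilon> = 1\<close> it is one more zero, above \<open>x 0\<close>. For \<open>\<epsilon> = 0\<close> it is the total mass of
  the residues. Treating both cases at once gives the two changes of variables with one proof.\<close>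

definition resid :: "real \<Rightarrow> nat \<Rightarrow> (nat \<Rightarrow> real) \<Rightarrow> (nat \<Rightarrow> real) \<Rightarrow> nat \<Rightarrow> real" where
  "resid \<epsilon> k x y j =
     (y 0 - \<epsilon> * x j) * (\<Prod>i<k. y (Suc i) - x j) / (\<Prod>i\<in>{..k}-{j}. x i - x j)"

text \<open>For \<epsilon> = 0 the first condition says that the total mass is positive.\<close>

definition interlaced :: "real \<Rightarrow> nat \<Rightarrow> (nat \<Rightarrow> real) \<Rightarrow> (nat \<Rightarrow> real) \<Rightarrow> bool" where
  "interlaced \<epsilon> k x y \<longleftrightarrow> \<epsilon> * x 0 < y 0 \<and> (\<forall>i<k. x (Suc i) < y (Suc i) \<and> y (Suc i) < x i)"

text \<open>The Jacobian determinant of the map from \<open>y\<close> to the residues, of Cauchy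
  type. For \<epsilon> = 1 the first product completes the Vandermonde product of all of
  \<open>y\<close>; for \<epsilon> = 0 it is \<open>y 0 ^ k\<close>.\<close>

definition resid_jac :: "real \<Rightarrow> nat \<Rightarrow> (nat \<Rightarrow> real) \<Rightarrow> (nat \<Rightarrow> real) \<Rightarrow> real" where
  "resid_jac \<epsilon> k x y =
     (\<Prod>i<k. y 0 - \<epsilon> * y (Suc i)) * vandermonde k (\<lambda>i. y (Suc i)) / vandermonde (Suc k) x"

lemma resid_0: "resid \<epsilon> 0 x y 0 = y 0 - \<epsilon> * x 0"
  by (simp add: resid_def)

text \<open>A new pole and a new zero multiply the rational function by
  \<open>(y (Suc k) - t) / (x (Suc k) - t)\<close>, and each old residue by the value of this factor
  at its own pole. This drives the inductions on \<open>k\<close> below.\<close>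

lemma resid_Suc_le:
  assumes "j \<le> k"
  shows "resid \<epsilon> (Suc k) x y j
    = (x j - y (Suc k)) / (x j - x (Suc k)) * resid \<epsilon> k x y j"
proof -
  have "{..Suc k} - {j} = insert (Suc k) ({..k} - {j})" using assms by auto
  then have "(\<Prod>i\<in>{..Suc k}-{j}. x i - x j) = (x (Suc k) - x j) * (\<Prod>i\<in>{..k}-{j}. x i - x j)"
    by simp
  moreover have "(x j - y (Suc k)) / (x j - x (Suc k)) = (y (Suc k) - x j) / (x (Suc k) - x j)"
    by (metis minus_diff_eq minus_divide_divide)
  ultimately show ?thesis unfolding resid_def by simp
qed

text \<open>Partial fractions on the left, factored form on the right; \<epsilon> is the value at
  infinity. The induction step uses the hypothesis both at \<open>t\<close> and at the new
  pole.\<close>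

lemma resid_partial_fractions:
  assumes "strict_dec (Suc k) x" "\<And>j. j \<le> k \<Longrightarrow> t \<noteq> x j"
  shows "\<epsilon> + (\<Sum>j\<le>k. resid \<epsilon> k x y j / (x j - t))
    = (y 0 - \<epsilon> * t) * (\<Prod>i<k. y (Suc i) - t) / (\<Prod>j\<le>k. x j - t)"
  using assms
proof (induction k arbitrary: t)
  case 0
  then show ?case by (simp add: resid_0 field_simps)
next
  case (Suc k)
  define w where "w = y (Suc k)"
  define z where "z = x (Suc k)"
  define P where "P u = (y 0 - \<epsilon> * u) * (\<Prod>i<k. y (Suc i) - u) / (\<Prod>j\<le>k. x j - u)" for u
  have sd: "strict_dec (Suc k) x" using Suc.prems(1) strict_dec_mono[of _ x "Suc k"] by simp
  have zx: "z < x j" if "j \<le> k" for j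
    using strict_decD[OF Suc.prems(1), of j "Suc k"] that by (simp add: z_def)
  have IHt: "(\<Sum>j\<le>k. resid \<epsilon> k x y j / (x j - t)) = P t - \<epsilon>"
    using Suc.IH[OF sd, of t] Suc.prems(2) by (simp add: P_def)
  have IHz: "(\<Sum>j\<le>k. resid \<epsilon> k x y j / (x j - z)) = P z - \<epsilon>"
    using Suc.IH[OF sd, of z] zx by (fastforce simp: P_def)
  have last: "resid \<epsilon> (Suc k) x y (Suc k) = (w - z) * P z"
  proof -
    have "{..Suc k} - {Suc k} = {..k}" by auto
    then show ?thesis by (simp add: resid_def P_def w_def z_def)
  qed
  have tz: "t \<noteq> z" using Suc.prems(2)[of "Suc k"] by (simp add: z_def)
  \<comment> \<open>Splitting into partial fractions in the variable \<open>x j\<close> separates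
    the poles \<open>t\<close> and \<open>z\<close>, so that the sum over \<open>j\<close> falls
    into the two instances of the hypothesis.\<close>
  have tm: "resid \<epsilon> (Suc k) x y j / (x j - t)
     = (w - t) / (z - t) * (resid \<epsilon> k x y j / (x j - t)) - (w - z) / (z - t) * (resid \<epsilon> k x y j / (x j - z))"
    if "j \<le> k" for j
  proof -
    have "x j - t \<noteq> 0" "x j - z \<noteq> 0" "z - t \<noteq> 0" using Suc.prems(2)[of j] zx[OF that] that tz by auto
    then have "(x j - w) / (x j - z) * R / (x j - t)
      = (w - t) / (z - t) * (R / (x j - t)) - (w - z) / (z - t) * (R / (x j - z))" for R
      by (simp add: divide_simps) (simp add: algebra_simps)
    moreover have "resid \<epsilon> (Suc k) x y j = (x j - w) / (x j - z) * resid \<epsilon> k x y j"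
      using resid_Suc_le[OF that] by (simp add: w_def z_def)
    ultimately show ?thesis by simp
  qed
  have "(\<Sum>j\<le>k. resid \<epsilon> (Suc k) x y j / (x j - t))
     = (w - t) / (z - t) * (P t - \<epsilon>) - (w - z) / (z - t) * (P z - \<epsilon>)"
    unfolding IHt[symmetric] IHz[symmetric] sum_distrib_left sum_subtractf[symmetric]
    by (rule sum.cong) (simp_all add: tm)
  then have "\<epsilon> + (\<Sum>j\<le>Suc k. resid \<epsilon> (Suc k) x y j / (x j - t))
     = \<epsilon> + ((w - t) / (z - t) * (P t - \<epsilon>) - (w - z) / (z - t) * (P z - \<epsilon>)) + (w - z) * P z / (z - t)"
    by (simp add: last z_def[symmetric])
  also have "\<dots> = (w - t) / (z - t) * P t"
    using tz by (simp add: divide_simps) (simp add: algebra_simps)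
  also have "\<dots> = (y 0 - \<epsilon> * t) * (\<Prod>i<Suc k. y (Suc i) - t) / (\<Prod>j\<le>Suc k. x j - t)"
    by (simp add: P_def w_def z_def mult_ac)
  finally show ?case .
qed

text \<open>At the new pole the residue is that of the new factor, a gap between zero and pole,
  times the old function evaluated there.\<close>

lemma resid_Suc_last:
  assumes "strict_dec (Suc (Suc k)) x"
  shows "resid \<epsilon> (Suc k) x y (Suc k)
    = (y (Suc k) - x (Suc k)) * (\<epsilon> + (\<Sum>j\<le>k. resid \<epsilon> k x y j / (x j - x (Suc k))))"
proof -
  have sd: "strict_dec (Suc k) x" using strict_dec_mono[OF assms] by simp
  have "{..Suc k} - {Suc k} = {..k}" by auto
  then have "resid \<epsilon> (Suc k) x y (Suc k) = (y (Suc k) - x (Suc k)) *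
      ((y 0 - \<epsilon> * x (Suc k)) * (\<Prod>i<k. y (Suc i) - x (Suc k)) / (\<Prod>j\<le>k. x j - x (Suc k)))"
    by (simp add: resid_def)
  also have "(y 0 - \<epsilon> * x (Suc k)) * (\<Prod>i<k. y (Suc i) - x (Suc k)) / (\<Prod>j\<le>k. x j - x (Suc k))
      = \<epsilon> + (\<Sum>j\<le>k. resid \<epsilon> k x y j / (x j - x (Suc k)))"
    by (rule resid_partial_fractions[OF sd, symmetric]) (metis strict_decD[OF assms] less_Suc_eq_le lessI order_less_irrefl)
  finally show ?thesis .
qed

text \<open>The trace identity, which compares the coefficients of \<open>1 / t\<close> at infinity.
  It is what makes the exponential factors of the densities match.\<close>

lemma sum_resid:
  assumes "strict_dec (Suc k) x"
  shows "(\<Sum>j\<le>k. resid \<epsilon> k x y j) = y 0 - \<epsilon> * x 0 + \<epsilon> * (\<Sum>i<k. y (Suc i) - x (Suc i))"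
  using assms
proof (induction k)
  case 0
  then show ?case by (simp add: resid_0)
next
  case (Suc k)
  define w where "w = y (Suc k)"
  define z where "z = x (Suc k)"
  have sd: "strict_dec (Suc k) x" using Suc.prems(1) strict_dec_mono[of _ x "Suc k"] by simp
  have "resid \<epsilon> (Suc k) x y j = resid \<epsilon> k x y j - (w - z) * (resid \<epsilon> k x y j / (x j - z))"
    if "j \<le> k" for j
  proof -
    have "x j - z \<noteq> 0" using strict_decD[OF Suc.prems(1), of j "Suc k"] that by (simp add: z_def)
    then show ?thesis unfolding resid_Suc_le[OF that]
      by (simp add: w_def z_def divide_simps) (simp add: algebra_simps)
  qed
  then have "(\<Sum>j\<le>k. resid \<epsilon> (Suc k) x y j)
     = (\<Sum>j\<le>k. resid \<epsilon> k x y j) - (w - z) * (\<Sum>j\<le>k. resid \<epsilon> k x y j / (x j - z))"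
    by (simp add: sum_subtractf sum_distrib_left)
  then show ?case
    using resid_Suc_last[OF Suc.prems, of \<epsilon> y] Suc.IH[OF sd]
    by (simp add: w_def z_def algebra_simps)
qed

lemma interlaced_Suc:
  "interlaced \<epsilon> (Suc k) x y \<longleftrightarrow> interlaced \<epsilon> k x y \<and> x (Suc k) < y (Suc k) \<and> y (Suc k) < x k"
  by (auto simp: interlaced_def less_Suc_eq)

text \<open>In the induction the old residues get positive factors, and the last one is a positive
  gap times a positive sum, because the new pole lies below all the others.\<close>

lemma resid_pos:
  assumes "strict_dec (Suc k) x" "interlaced \<epsilon> k x y" "0 \<le> \<epsilon>" "j \<le> k"
  shows "0 < resid \<epsilon> k x y j"
  using assms
proof (induction k arbitrary: j)
  case 0
  then show ?case by (simp add: resid_0 interlaced_def)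
next
  case (Suc k)
  have sd: "strict_dec (Suc k) x" using Suc.prems(1) strict_dec_mono[of _ x "Suc k"] by simp
  have il: "interlaced \<epsilon> k x y" "x (Suc k) < y (Suc k)" "y (Suc k) < x k"
    using Suc.prems(2) by (auto simp: interlaced_Suc)
  have x: "x k \<le> x j" if "j \<le> k" for j
    using strict_dec_leD[OF sd, of j k] that by simp
  note IH = Suc.IH[OF sd il(1) Suc.prems(3)]
  show ?case
  proof (cases "j \<le> k")
    case True
    then show ?thesis using IH[OF True] x[OF True] il by (simp add: resid_Suc_le)
  next
    case False
    then have j: "j = Suc k" using Suc.prems(4) by simp
    have "0 < (\<Sum>j\<le>k. resid \<epsilon> k x y j / (x j - x (Suc k)))"
      using IH x il by (intro sum_pos) (force intro!: divide_pos_pos)+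
    then show ?thesis unfolding j resid_Suc_last[OF Suc.prems(1)] using il Suc.prems(3) by simp
  qed
qed

text \<open>Each pair of poles occurs twice in the denominators, which accounts for the square. The
  remaining product of distances is symmetric in zeros and poles, so the two sides of a half step
  can share it.\<close>

lemma prod_resid:
  assumes "strict_dec (Suc k) x" "interlaced \<epsilon> k x y" "0 \<le> \<epsilon>"
  shows "(\<Prod>j\<le>k. resid \<epsilon> k x y j) * vandermonde (Suc k) x ^ 2
    = (\<Prod>j\<le>k. y 0 - \<epsilon> * x j) * (\<Prod>j\<le>k. \<Prod>i<k. \<bar>y (Suc i) - x j\<bar>)"
  using assms
proof (induction k)
  case 0
  then show ?case by (simp add: resid_0 vandermonde_Suc)
next
  case (Suc k)
  define w where "w = y (Suc k)"
  define z where "z = x (Suc k)"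
  have sd: "strict_dec (Suc k) x" using Suc.prems(1) strict_dec_mono[of _ x "Suc k"] by simp
  have il: "interlaced \<epsilon> k x y" "z < w" "w < x k"
    using Suc.prems(2) by (auto simp: interlaced_Suc w_def z_def)
  have x: "x k \<le> x j" if "j \<le> k" for j
    using strict_dec_leD[OF sd, of j k] that by simp
  have yz: "z < y (Suc i)" if "i < k" for i
  proof -
    have "x (Suc k) < x (Suc i)" using strict_decD[OF Suc.prems(1), of "Suc i" "Suc k"] that by simp
    also have "x (Suc i) < y (Suc i)" using il that by (simp add: interlaced_def)
    finally show ?thesis by (simp add: z_def)
  qed
  define A where "A = (\<Prod>j\<le>k. x j - z)"
  have A: "A \<noteq> 0" unfolding A_def using x il by (fastforce simp: prod_zero_iff)
  define R where "R = (\<Prod>j\<le>k. resid \<epsilon> k x y j)"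
  define W where "W = (\<Prod>j\<le>k. \<bar>w - x j\<bar>)"
  define Y where "Y = (\<Prod>i<k. \<bar>y (Suc i) - z\<bar>)"
  define C where "C = (\<Prod>j\<le>k. \<Prod>i<k. \<bar>y (Suc i) - x j\<bar>)"
  have 1: "(\<Prod>j\<le>k. resid \<epsilon> (Suc k) x y j) = W / A * R"
  proof -
    have "resid \<epsilon> (Suc k) x y j = \<bar>w - x j\<bar> / (x j - z) * resid \<epsilon> k x y j" if "j \<le> k" for j
      using resid_Suc_le[OF that, of \<epsilon> x y] x[OF that] il by (simp add: w_def z_def)
    then show ?thesis by (simp add: prod.distrib prod_dividef A_def R_def W_def)
  qed
  have 2: "resid \<epsilon> (Suc k) x y (Suc k) = (y 0 - \<epsilon> * z) * (Y * (w - z)) / A"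
  proof -
    have "{..Suc k} - {Suc k} = {..k}" by auto
    moreover have "(\<Prod>i<k. y (Suc i) - z) = Y"
      unfolding Y_def by (rule prod.cong) (use yz in \<open>fastforce simp: abs_if\<close>)+
    ultimately show ?thesis by (simp add: resid_def A_def w_def z_def)
  qed
  have 3: "vandermonde (Suc (Suc k)) x = vandermonde (Suc k) x * A"
    by (simp add: vandermonde_Suc[of "Suc k"] A_def z_def lessThan_Suc_atMost)
  have 4: "(\<Prod>j\<le>Suc k. \<Prod>i<Suc k. \<bar>y (Suc i) - x j\<bar>) = C * W * (Y * (w - z))"
    using il(2) by (simp add: C_def W_def Y_def prod.distrib w_def z_def)
  have IH: "R * vandermonde (Suc k) x ^ 2 = (\<Prod>j\<le>k. y 0 - \<epsilon> * x j) * C"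
    using Suc.IH[OF sd il(1) Suc.prems(3)] by (simp add: R_def C_def)
  have "(\<Prod>j\<le>Suc k. resid \<epsilon> (Suc k) x y j) * vandermonde (Suc (Suc k)) x ^ 2
    = W * (R * vandermonde (Suc k) x ^ 2) * ((y 0 - \<epsilon> * z) * (Y * (w - z)))"
    using A by (simp add: 1 2 3 power2_eq_square)
  then show ?case unfolding IH 4 by (simp add: z_def)
qed

text \<open>The three factors are the Jacobians of the three moves in the induction: rescaling the
  old weights, the old change of variables, and the derivative of the last weight with respect to
  the last zero.\<close>

lemma resid_jac_Suc:
  assumes "strict_dec (Suc (Suc k)) x" "interlaced \<epsilon> (Suc k) x y"
  shows "resid_jac \<epsilon> (Suc k) x y
    = (\<Prod>j\<le>k. (x j - y (Suc k)) / (x j - x (Suc k))) * resid_jac \<epsilon> k x y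
      * (\<epsilon> + (\<Sum>j\<le>k. resid \<epsilon> k x y j / (x j - y (Suc k))))"
proof -
  have sd: "strict_dec (Suc k) x" using assms(1) strict_dec_mono[of _ x "Suc k"] by simp
  have il: "interlaced \<epsilon> k x y" "y (Suc k) < x k"
    using assms(2) by (auto simp: interlaced_Suc)
  have x: "y (Suc k) < x j" if "j \<le> k" for j
    using strict_dec_leD[OF sd, of j k] that il by simp
  have nz: "(\<Prod>j\<le>k. x j - y (Suc k)) \<noteq> 0" using x by (fastforce simp: prod_zero_iff)
  define B where "B = (\<Prod>j\<le>k. x j - x (Suc k))"
  define Q where "Q = (\<Prod>i<k. y (Suc i) - y (Suc k))"
  have "vandermonde (Suc (Suc k)) x = vandermonde (Suc k) x * B"
    by (simp add: vandermonde_Suc[of "Suc k"] B_def lessThan_Suc_atMost)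
  then have 1: "resid_jac \<epsilon> (Suc k) x y = (\<Prod>i<k. y 0 - \<epsilon> * y (Suc i)) * (y 0 - \<epsilon> * y (Suc k)) *
      (vandermonde k (\<lambda>i. y (Suc i)) * Q) / (vandermonde (Suc k) x * B)"
    by (simp add: resid_jac_def Q_def vandermonde_Suc[of k "\<lambda>i. y (Suc i)"])
  have 2: "\<epsilon> + (\<Sum>j\<le>k. resid \<epsilon> k x y j / (x j - y (Suc k)))
      = (y 0 - \<epsilon> * y (Suc k)) * Q / (\<Prod>j\<le>k. x j - y (Suc k))"
    unfolding Q_def by (rule resid_partial_fractions[OF sd]) (use x in force)
  show ?thesis
    unfolding 1 2 using nz by (simp add: resid_jac_def prod_dividef B_def[symmetric] mult_ac)
qed

section \<open>The change of variables from residues to zeros\<close>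

lemma measurable_resid:
  "(\<lambda>y. \<lambda>j\<in>{..<Suc k}. resid \<epsilon> k x y j) \<in> lborel_pow (Suc k) \<rightarrow>\<^sub>M lborel_pow (Suc k)"
  unfolding resid_def by measurable

lemma measurable_resid_jac:
  "resid_jac \<epsilon> k x \<in> borel_measurable (lborel_pow (Suc k))"
  unfolding resid_jac_def vandermonde_def by measurable

lemma measurable_interlaced: "Measurable.pred (lborel_pow (Suc k)) (interlaced \<epsilon> k x)"
  unfolding interlaced_def by measurable

lemma measurable_resid_integrand:
  assumes [measurable]: "F \<in> borel_measurable (lborel_pow (Suc k))"
  shows "(\<lambda>y. if interlaced \<epsilon> k x y then ennreal (resid_jac \<epsilon> k x y) *
       F (\<lambda>j\<in>{..<Suc k}. resid \<epsilon> k x y j) else 0) \<in> borel_measurable (lborel_pow (Suc k))"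
proof -
  note [measurable] = measurable_resid measurable_resid_jac measurable_interlaced
  show ?thesis by measurable
qed

lemma resid_upd: "j \<le> k \<Longrightarrow> resid \<epsilon> k x (y(Suc k := w)) j = resid \<epsilon> k x y j"
  by (simp add: resid_def)

lemma interlaced_upd: "interlaced \<epsilon> k x (y(Suc k := w)) = interlaced \<epsilon> k x y"
  by (auto simp: interlaced_def)

lemma resid_jac_upd: "resid_jac \<epsilon> k x (y(Suc k := w)) = resid_jac \<epsilon> k x y"
  by (simp add: resid_jac_def vandermonde_def)

lemma resid_jac_nonneg:
  assumes "strict_dec (Suc k) x" "interlaced \<epsilon> k x y" "0 \<le> \<epsilon>"
  shows "0 \<le> resid_jac \<epsilon> k x y"
proof -
  have le: "y (Suc i) \<le> x 0" if "i < k" for i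
    using assms(2) strict_dec_leD[OF assms(1), of 0 i] that by (force simp: interlaced_def)
  have "0 \<le> y 0 - \<epsilon> * y (Suc i)" if "i < k" for i
    using mult_left_mono[OF le[OF that] assms(3)] assms(2) by (simp add: interlaced_def)
  moreover have "strict_dec k (\<lambda>i. y (Suc i))"
    using assms(2) unfolding strict_dec_def interlaced_def by (meson Suc_lessD less_trans)
  ultimately show ?thesis unfolding resid_jac_def
    using vandermonde_pos[OF assms(1)] by (auto intro!: divide_nonneg_pos mult_nonneg_nonneg prod_nonneg dest: vandermonde_pos)
qed

text \<open>The argument of \<open>F\<close> is the solution \<open>u\<close> of \<open>\<epsilon> +
  (\<Sum>j\<le>k. g j / (x j - w)) + u / (x (Suc k) - w) = 0\<close>, that is, the weight at the new
  pole that puts a zero at \<open>w\<close>. As \<open>w\<close> crosses the gap between the last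
  two poles, it increases from 0 to infinity.\<close>

lemma sum_poles_bij:
  fixes x g :: "nat \<Rightarrow> real"
  assumes sd: "strict_dec (Suc (Suc k)) x" and e: "0 \<le> \<epsilon>" and g: "\<And>j. j \<le> k \<Longrightarrow> 0 < g j"
    and F: "F \<in> borel_measurable borel"
  shows "(\<integral>\<^sup>+u. (if 0 < u then F u else 0) \<partial>lborel) =
    (\<integral>\<^sup>+w. (if x (Suc k) < w \<and> w < x k then
       ennreal (\<epsilon> + (\<Sum>j\<le>k. g j * (x j - x (Suc k)) / (x j - w)^2)) *
       F ((w - x (Suc k)) * (\<epsilon> + (\<Sum>j\<le>k. g j / (x j - w)))) else 0) \<partial>lborel)"
proof -
  define z where "z = x (Suc k)"
  define U where "U w = (w - z) * (\<epsilon> + (\<Sum>j\<le>k. g j / (x j - w)))" for w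
  have zx: "z < x k" using sd by (simp add: strict_dec_def z_def)
  have sd': "strict_dec (Suc k) x" using strict_dec_mono[OF sd] by simp
  have x: "x k \<le> x j" if "j \<le> k" for j
    using strict_dec_leD[OF sd', of j k] that by simp
  have deriv: "(U has_real_derivative (\<epsilon> + (\<Sum>j\<le>k. g j * (x j - z) / (x j - w)^2))) (at w)"
    if "z < w" "w < x k" for w
  proof -
    have nz: "x j - w \<noteq> 0" if "j \<le> k" for j using x[OF that] \<open>w < x k\<close> by auto
    have "(U has_real_derivative ((\<epsilon> + (\<Sum>j\<le>k. g j / (x j - w))) + (w - z) * (\<Sum>j\<le>k. g j / (x j - w)^2))) (at w)"
      unfolding U_def using nz
      by (auto intro!: derivative_eq_intros sum.cong simp: power2_eq_square)
    moreover have "(\<Sum>j\<le>k. g j / (x j - w)) + (w - z) * (\<Sum>j\<le>k. g j / (x j - w)^2)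
       = (\<Sum>j\<le>k. g j * (x j - z) / (x j - w)^2)"
      unfolding sum_distrib_left sum.distrib[symmetric]
    proof (rule sum.cong[OF refl])
      fix j assume "j \<in> {..k}"
      then have "x j - w \<noteq> 0" using nz by simp
      then show "g j / (x j - w) + (w - z) * (g j / (x j - w)^2) = g j * (x j - z) / (x j - w)^2"
        by (simp add: divide_simps power2_eq_square) (simp add: algebra_simps)
    qed
    ultimately show ?thesis by (simp add: add.assoc)
  qed
  have low: "\<epsilon> + g k / (x k - w) \<le> \<epsilon> + (\<Sum>j\<le>k. g j / (x j - w))" if "w < x k" for w
  proof -
    have "(\<Sum>j\<in>{k}. g j / (x j - w)) \<le> (\<Sum>j\<le>k. g j / (x j - w))"
      by (rule sum_mono2) (use x g that in \<open>force intro!: divide_nonneg_nonneg simp: less_imp_le\<close>)+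
    then show ?thesis by simp
  qed
  have "(\<integral>\<^sup>+u. (if 0 < u then F u else 0) \<partial>lborel) = (\<integral>\<^sup>+w. (if z < w \<and> w < x k then
       ennreal (\<epsilon> + (\<Sum>j\<le>k. g j * (x j - z) / (x j - w)^2)) * F (U w) else 0) \<partial>lborel)"
  proof (rule nn_integral_substitution_halfline[OF F zx deriv])
    show "continuous_on {z<..<x k} (\<lambda>w. \<epsilon> + (\<Sum>j\<le>k. g j * (x j - z) / (x j - w)^2))"
      by (intro continuous_intros) (use x in force)
    show "0 \<le> \<epsilon> + (\<Sum>j\<le>k. g j * (x j - z) / (x j - w)^2)" if "z < w" "w < x k" for w
      by (intro add_nonneg_nonneg sum_nonneg divide_nonneg_nonneg mult_nonneg_nonneg)
        (use e g x that in \<open>force simp: less_imp_le\<close>)+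
    show pos: "0 < U w" if "z < w" "w < x k" for w
    proof -
      have "0 < g k / (x k - w)" using g[of k] that by simp
      then show ?thesis using low[OF that(2)] e that by (simp add: U_def)
    qed
    fix u :: real assume u: "0 < u"
    have "isCont U z" unfolding U_def by (intro continuous_intros) (use x zx in force)
    then have "(U \<longlongrightarrow> 0) (at_right z)"
      by (auto simp: isCont_def U_def intro: filterlim_mono[OF _ order.refl at_le])
    then have "eventually (\<lambda>w. U w < u \<and> w < x k \<and> z < w) (at_right z)"
      using u zx by (intro eventually_conj order_tendstoD eventually_at_right_less)
        (auto intro: eventually_at_right_real[THEN eventually_mono])
    then show "\<exists>w>z. w < x k \<and> U w \<le> u"
      by (auto dest!: eventually_happens simp: trivial_limit_at_right_real intro: less_imp_le)
    \<comment> \<open>At \<open>w = x k - d\<close> the first bound keeps \<open>w - z\<close> at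
      least half the gap, and the second makes the pole term \<open>g k / d\<close> at least
      \<open>2 * u / (x k - z)\<close>.\<close>
    define d where "d = min ((x k - z) / 2) ((x k - z) / 2 * g k / u)"
    have d: "0 < d" "d \<le> (x k - z) / 2" using zx u g[of k] unfolding d_def by (simp, blast intro: min.cobounded1)
    have "u * d \<le> (x k - z) / 2 * g k" using u by (auto simp: d_def min_def field_simps)
    then have "u \<le> (x k - z) / 2 * (g k / d)" using d(1) by (simp add: field_simps)
    also have "\<dots> \<le> (x k - d - z) * (\<epsilon> + (\<Sum>j\<le>k. g j / (x j - (x k - d))))"
      using low[of "x k - d"] d e g[of k] by (intro mult_mono) auto
    finally have "u \<le> U (x k - d)" by (simp add: U_def)
    moreover have "z < x k - d" using d zx by (auto simp: field_simps)
    ultimately show "\<exists>w>z. w < x k \<and> u \<le> U w" using d(1) by (intro exI[of _ "x k - d"]) auto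
  qed
  then show ?thesis unfolding U_def z_def .
qed

text \<open>The change of variables is made one coordinate at a time. With the other weights fixed,
  the last weight is traded for the last zero \<open>w\<close>. With \<open>w\<close> fixed, the
  other weights are rescaled to the residues of the function without its last pole and zero, and the
  induction hypothesis applies to these.\<close>

lemma nn_integral_resid:
  assumes "strict_dec (Suc k) x" "0 \<le> \<epsilon>" "F \<in> borel_measurable (lborel_pow (Suc k))"
  shows "(\<integral>\<^sup>+g. (if \<forall>j\<le>k. 0 < g j then F g else 0) \<partial>lborel_pow (Suc k)) =
    (\<integral>\<^sup>+y. (if interlaced \<epsilon> k x y then ennreal (resid_jac \<epsilon> k x y) *
       F (\<lambda>j\<in>{..<Suc k}. resid \<epsilon> k x y j) else 0) \<partial>lborel_pow (Suc k))"
  using assms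
proof (induction k arbitrary: F)
  case 0
  note [measurable] = 0(3)
  have 1: "(\<lambda>j\<in>{..<Suc 0}. resid \<epsilon> 0 x ((\<lambda>_. undefined)(0 := u)) j) = (\<lambda>_. undefined)(0 := u - \<epsilon> * x 0)" for u
    by (auto simp: fun_eq_iff resid_0)
  have 2: "ennreal (resid_jac \<epsilon> 0 x y) * a = a" for y a by (simp add: resid_jac_def vandermonde_Suc)
  have "(\<integral>\<^sup>+g. (if \<forall>j\<le>0. 0 < g j then F g else 0) \<partial>lborel_pow (Suc 0))
     = (\<integral>\<^sup>+u. (if 0 < u then F ((\<lambda>_. undefined)(0 := u)) else 0) \<partial>lborel)"
    by (subst nn_integral_lborel_pow_Suc) (measurable, simp add: nn_integral_lborel_pow_0 del: lessThan_0)
  also have "\<dots> = (\<integral>\<^sup>+u. (if 0 < u - \<epsilon> * x 0 then F ((\<lambda>_. undefined)(0 := u - \<epsilon> * x 0)) else 0) \<partial>lborel)"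
  proof -
    have "- \<epsilon> * x 0 + 1 * u = u - \<epsilon> * x 0" for u by simp
    then show ?thesis
      by (subst nn_integral_real_affine[where c = 1 and t = "- \<epsilon> * x 0"]) (measurable, simp only:, simp)
  qed
  also have "\<dots> = (\<integral>\<^sup>+y. (if interlaced \<epsilon> 0 x y then ennreal (resid_jac \<epsilon> 0 x y) *
       F (\<lambda>j\<in>{..<Suc 0}. resid \<epsilon> 0 x y j) else 0) \<partial>lborel_pow (Suc 0))"
    by (subst nn_integral_lborel_pow_Suc[OF measurable_resid_integrand[OF 0(3)]])
      (simp only: nn_integral_lborel_pow_0 1 2, simp add: interlaced_def algebra_simps)
  finally show ?case .
next
  case (Suc k)
  note [measurable] = Suc.prems(3)
  define z where "z = x (Suc k)"
  define U where "U g w = (w - z) * (\<epsilon> + (\<Sum>j\<le>k. g j / (x j - w)))" for g w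
  define U' where "U' g w = \<epsilon> + (\<Sum>j\<le>k. g j * (x j - z) / (x j - w)^2)" for g w
  \<comment> \<open>The factor from \<open>resid_Suc_le\<close> between the residues with and
    without the last pole \<open>z\<close> and zero \<open>w\<close>.\<close>
  define c where "c w j = (x j - w) / (x j - z)" for w j
  define sc where "sc w g = (\<lambda>j\<in>{..<Suc k}. c w j * g j)" for w and g :: "nat \<Rightarrow> real"
  define I where "I w \<longleftrightarrow> z < w \<and> w < x k" for w
  define pos where "pos g \<longleftrightarrow> (\<forall>j\<le>k. 0 < g j)" for g :: "nat \<Rightarrow> real"
  define H where "H w g = ennreal (U' g w) * F (g(Suc k := U g w))" for w g
  define R where "R y = (\<lambda>j\<in>{..<Suc k}. resid \<epsilon> k x y j)" for y
  have mH: "(\<lambda>(w, g). if pos g \<and> I w then H w g else 0) \<in> borel_measurable (lborel \<Otimes>\<^sub>M lborel_pow (Suc k))"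
    unfolding pos_def I_def H_def U_def U'_def by measurable
  have mHw: "(\<lambda>g. if pos g then H w g else 0) \<in> borel_measurable (lborel_pow (Suc k))" for w
    unfolding pos_def H_def U_def U'_def by measurable
  have mHsc: "(\<lambda>g. H w (sc w g)) \<in> borel_measurable (lborel_pow (Suc k))" for w
  proof -
    have [measurable]: "sc w \<in> lborel_pow (Suc k) \<rightarrow>\<^sub>M lborel_pow (Suc k)"
      unfolding sc_def by measurable
    have [measurable]: "H w \<in> borel_measurable (lborel_pow (Suc k))"
      unfolding H_def U_def U'_def by measurable
    show ?thesis by measurable
  qed
  have mG: "(\<lambda>(w, y). if interlaced \<epsilon> (Suc k) x (y(Suc k := w)) then ennreal (resid_jac \<epsilon> (Suc k) x (y(Suc k := w))) *
       F (\<lambda>j\<in>{..<Suc (Suc k)}. resid \<epsilon> (Suc k) x (y(Suc k := w)) j) else 0)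
     \<in> borel_measurable (lborel \<Otimes>\<^sub>M lborel_pow (Suc k))"
    unfolding case_prod_unfold
    by (rule measurable_compose[OF _ measurable_resid_integrand[OF Suc.prems(3), of \<epsilon> x]]) measurable
  have sd: "strict_dec (Suc k) x" using Suc.prems(1) strict_dec_mono[of _ x "Suc k"] by simp
  have x: "x k \<le> x j" if "j \<le> k" for j
    using strict_dec_leD[OF sd, of j k] that by simp
  have cpos: "0 < c w j" if "I w" "j \<le> k" for w j
    using x[OF that(2)] that(1) by (auto simp: c_def I_def)
  have possc: "pos (sc w g) = pos g" if "I w" for w g
  proof -
    have "0 < sc w g j \<longleftrightarrow> 0 < g j" if "j \<le> k" for j
      using cpos[OF \<open>I w\<close> that] that by (simp add: sc_def zero_less_mult_iff)
    then show ?thesis by (simp add: pos_def)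
  qed
  have inner: "(\<integral>\<^sup>+u. (if \<forall>j\<le>Suc k. 0 < (g(Suc k := u)) j then F (g(Suc k := u)) else 0) \<partial>lborel)
    = (\<integral>\<^sup>+w. (if pos g \<and> I w then H w g else 0) \<partial>lborel)" if [measurable]: "g \<in> space (lborel_pow (Suc k))" for g
  proof -
    have "(\<forall>j\<le>Suc k. Q j) \<longleftrightarrow> (\<forall>j\<le>k. Q j) \<and> Q (Suc k)" for Q by (auto simp: le_Suc_eq)
    then have eq: "(\<forall>j\<le>Suc k. 0 < (g(Suc k := u)) j) \<longleftrightarrow> pos g \<and> 0 < u" for u
      by (simp add: pos_def)
    show ?thesis unfolding eq
    proof (cases "pos g")
      case True
      have "(\<integral>\<^sup>+u. (if 0 < u then F (g(Suc k := u)) else 0) \<partial>lborel)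
        = (\<integral>\<^sup>+w. (if I w then H w g else 0) \<partial>lborel)"
        unfolding I_def H_def U_def U'_def z_def
        by (rule sum_poles_bij[OF Suc.prems(1,2)]) (use True in \<open>auto simp: pos_def\<close>)
      then show "(\<integral>\<^sup>+u. (if pos g \<and> 0 < u then F (g(Suc k := u)) else 0) \<partial>lborel)
        = (\<integral>\<^sup>+w. (if pos g \<and> I w then H w g else 0) \<partial>lborel)" using True by simp
    qed simp
  qed
  \<comment> \<open>The composition of the three moves gives all residues for \<open>Suc k\<close>,
    and their Jacobians multiply to \<open>resid_jac \<epsilon> (Suc k)\<close>.\<close>
  have comb: "(if I w then ennreal (\<Prod>j<Suc k. c w j) * (if interlaced \<epsilon> k x y then ennreal (resid_jac \<epsilon> k x y) * H w (sc w (R y)) else 0) else 0)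
    = (if interlaced \<epsilon> (Suc k) x (y(Suc k := w)) then ennreal (resid_jac \<epsilon> (Suc k) x (y(Suc k := w))) *
       F (\<lambda>j\<in>{..<Suc (Suc k)}. resid \<epsilon> (Suc k) x (y(Suc k := w)) j) else 0)" for w y
  proof (cases "I w \<and> interlaced \<epsilon> k x y")
    case True
    define y' where "y' = y(Suc k := w)"
    have y': "y' (Suc k) = w" by (simp add: y'_def)
    have ry: "resid \<epsilon> k x y' j = resid \<epsilon> k x y j" if "j \<le> k" for j
      using resid_upd[OF that] by (simp add: y'_def)
    have il: "interlaced \<epsilon> (Suc k) x y'" using True
      by (simp add: interlaced_Suc y'_def interlaced_upd I_def z_def)
    have xw: "x j - w \<noteq> 0" "x j - z \<noteq> 0" if "j \<le> k" for j
      using x[OF that] True by (auto simp: I_def)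
    have scR: "sc w (R y) j = c w j * resid \<epsilon> k x y j" if "j \<le> k" for j
      using that by (simp add: sc_def R_def)
    have U': "U' (sc w (R y)) w = \<epsilon> + (\<Sum>j\<le>k. resid \<epsilon> k x y' j / (x j - w))"
      unfolding U'_def using xw by (auto simp: scR ry c_def power2_eq_square intro!: sum.cong)
    have U: "U (sc w (R y)) w = (w - z) * (\<epsilon> + (\<Sum>j\<le>k. resid \<epsilon> k x y' j / (x j - z)))"
      unfolding U_def using xw by (auto simp: scR ry c_def intro!: sum.cong)
    have 1: "(\<lambda>j\<in>{..<Suc (Suc k)}. resid \<epsilon> (Suc k) x y' j) = (sc w (R y))(Suc k := U (sc w (R y)) w)"
    proof
      fix j
      consider "j \<le> k" | "j = Suc k" | "j > Suc k" by linarith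
      then show "(\<lambda>j\<in>{..<Suc (Suc k)}. resid \<epsilon> (Suc k) x y' j) j = ((sc w (R y))(Suc k := U (sc w (R y)) w)) j"
      proof cases
        case 1
        then show ?thesis using scR[OF 1] resid_Suc_le[OF 1, of \<epsilon> x y'] ry[OF 1] y' by (simp add: c_def z_def)
      next
        case 2
        then show ?thesis using resid_Suc_last[OF Suc.prems(1), of \<epsilon> y'] y' U by (simp add: z_def)
      next
        case 3
        then show ?thesis by (simp add: sc_def)
      qed
    qed
    have 2: "resid_jac \<epsilon> (Suc k) x y' = (\<Prod>j<Suc k. c w j) * resid_jac \<epsilon> k x y * U' (sc w (R y)) w"
      using resid_jac_Suc[OF Suc.prems(1) il] unfolding U' y'
      by (simp add: c_def z_def lessThan_Suc_atMost y'_def resid_jac_upd)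
    have 3: "0 \<le> (\<Prod>j<Suc k. c w j)" using cpos True by (intro prod_nonneg) (auto simp: less_imp_le)
    have 4: "0 \<le> resid_jac \<epsilon> k x y" using resid_jac_nonneg[OF sd] True Suc.prems(2) by blast
    have "ennreal (resid_jac \<epsilon> (Suc k) x y')
      = ennreal (\<Prod>j<Suc k. c w j) * (ennreal (resid_jac \<epsilon> k x y) * ennreal (U' (sc w (R y)) w))"
      unfolding 2 by (simp only: ennreal_mult' 3 4 mult.assoc)
    then show ?thesis
      using True il unfolding y'_def[symmetric] H_def 1
      by (simp only: if_True simp_thms mult.assoc)
  next
    case False
    then have "\<not> interlaced \<epsilon> (Suc k) x (y(Suc k := w))"
      by (auto simp: interlaced_Suc interlaced_upd I_def z_def)
    then show ?thesis using False by auto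
  qed
  have "(\<integral>\<^sup>+g. (if \<forall>j\<le>Suc k. 0 < g j then F g else 0) \<partial>lborel_pow (Suc (Suc k)))
    = (\<integral>\<^sup>+g. \<integral>\<^sup>+w. (if pos g \<and> I w then H w g else 0) \<partial>lborel \<partial>lborel_pow (Suc k))"
    by (subst nn_integral_lborel_pow_Suc, measurable) (rule nn_integral_cong, rule inner)
  also have "\<dots> = (\<integral>\<^sup>+w. \<integral>\<^sup>+g. (if pos g \<and> I w then H w g else 0) \<partial>lborel_pow (Suc k) \<partial>lborel)"
    by (rule nn_integral_lborel_pow_swap[symmetric]) (rule mH)
  also have "\<dots> = (\<integral>\<^sup>+w. (if I w then ennreal (\<Prod>j<Suc k. c w j) *
      (\<integral>\<^sup>+y. (if interlaced \<epsilon> k x y then ennreal (resid_jac \<epsilon> k x y) * H w (sc w (R y)) else 0) \<partial>lborel_pow (Suc k)) else 0) \<partial>lborel)"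
  proof (rule nn_integral_cong)
    fix w :: real
    show "(\<integral>\<^sup>+g. (if pos g \<and> I w then H w g else 0) \<partial>lborel_pow (Suc k)) =
      (if I w then ennreal (\<Prod>j<Suc k. c w j) *
      (\<integral>\<^sup>+y. (if interlaced \<epsilon> k x y then ennreal (resid_jac \<epsilon> k x y) * H w (sc w (R y)) else 0) \<partial>lborel_pow (Suc k)) else 0)"
    proof (cases "I w")
      case True
      have "(\<integral>\<^sup>+g. (if pos g then H w g else 0) \<partial>lborel_pow (Suc k))
        = ennreal (\<Prod>j<Suc k. c w j) * (\<integral>\<^sup>+g. (if pos (sc w g) then H w (sc w g) else 0) \<partial>lborel_pow (Suc k))"
        unfolding sc_def by (rule nn_integral_lborel_pow_scale) (rule mHw, use cpos[OF True] in auto)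
      also have "(\<integral>\<^sup>+g. (if pos (sc w g) then H w (sc w g) else 0) \<partial>lborel_pow (Suc k))
        = (\<integral>\<^sup>+g. (if \<forall>j\<le>k. 0 < g j then H w (sc w g) else 0) \<partial>lborel_pow (Suc k))"
        by (simp only: possc[OF True]) (simp only: pos_def)
      also have "\<dots> = (\<integral>\<^sup>+y. (if interlaced \<epsilon> k x y then ennreal (resid_jac \<epsilon> k x y) * H w (sc w (R y)) else 0) \<partial>lborel_pow (Suc k))"
        unfolding R_def by (rule Suc.IH[OF sd Suc.prems(2) mHsc])
      finally show ?thesis using True by simp
    qed simp
  qed
  also have "\<dots> = (\<integral>\<^sup>+w. \<integral>\<^sup>+y. (if I w then ennreal (\<Prod>j<Suc k. c w j) * (if interlaced \<epsilon> k x y then ennreal (resid_jac \<epsilon> k x y) * H w (sc w (R y)) else 0) else 0) \<partial>lborel_pow (Suc k) \<partial>lborel)"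
    using measurable_resid_integrand[OF mHsc, of \<epsilon> x, folded R_def]
    by (intro nn_integral_cong) (auto intro!: nn_integral_cmult[symmetric])
  also have "\<dots> = (\<integral>\<^sup>+w. \<integral>\<^sup>+y. (if interlaced \<epsilon> (Suc k) x (y(Suc k := w)) then ennreal (resid_jac \<epsilon> (Suc k) x (y(Suc k := w))) *
       F (\<lambda>j\<in>{..<Suc (Suc k)}. resid \<epsilon> (Suc k) x (y(Suc k := w)) j) else 0) \<partial>lborel_pow (Suc k) \<partial>lborel)"
    unfolding comb ..
  also have "\<dots> = (\<integral>\<^sup>+y. \<integral>\<^sup>+w. (if interlaced \<epsilon> (Suc k) x (y(Suc k := w)) then ennreal (resid_jac \<epsilon> (Suc k) x (y(Suc k := w))) *
       F (\<lambda>j\<in>{..<Suc (Suc k)}. resid \<epsilon> (Suc k) x (y(Suc k := w)) j) else 0) \<partial>lborel \<partial>lborel_pow (Suc k))"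
    by (rule nn_integral_lborel_pow_swap) (rule mG)
  also have "\<dots> = (\<integral>\<^sup>+y. (if interlaced \<epsilon> (Suc k) x y then ennreal (resid_jac \<epsilon> (Suc k) x y) *
       F (\<lambda>j\<in>{..<Suc (Suc k)}. resid \<epsilon> (Suc k) x y j) else 0) \<partial>lborel_pow (Suc (Suc k)))"
    by (rule nn_integral_lborel_pow_Suc[symmetric]) (rule measurable_resid_integrand[OF Suc.prems(3)])
  finally show ?case .
qed

section \<open>The two cases: as many zeros as poles, and one zero fewer\<close>

definition interlaced_above :: "nat \<Rightarrow> (nat \<Rightarrow> real) \<Rightarrow> (nat \<Rightarrow> real) \<Rightarrow> bool" where
  "interlaced_above n x y \<longleftrightarrow> (\<forall>i<n. x i < y i) \<and> (\<forall>i. Suc i < n \<longrightarrow> y (Suc i) < x i)"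

definition interlaced_below :: "nat \<Rightarrow> (nat \<Rightarrow> real) \<Rightarrow> (nat \<Rightarrow> real) \<Rightarrow> bool" where
  "interlaced_below k x y \<longleftrightarrow> (\<forall>i<k. x (Suc i) < y i \<and> y i < x i)"

lemma interlaced_1_iff: "interlaced 1 k x y \<longleftrightarrow> interlaced_above (Suc k) x y"
proof -
  have "(\<forall>i<Suc k. x i < y i) \<longleftrightarrow> x 0 < y 0 \<and> (\<forall>i<k. x (Suc i) < y (Suc i))"
    by (auto simp: less_Suc_eq_0_disj)
  then show ?thesis by (auto simp: interlaced_def interlaced_above_def)
qed

lemma interlaced_0_iff: "interlaced 0 k x (case_nat v y) \<longleftrightarrow> 0 < v \<and> interlaced_below k x y"
  by (auto simp: interlaced_def interlaced_below_def)

text \<open>\<open>resid\<close> has one pole more than its index, hence \<open>n - 1\<close>. The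
  case \<open>n = 0\<close> does occur: the chain starts from the empty configuration.\<close>

abbreviation resid_above :: "nat \<Rightarrow> (nat \<Rightarrow> real) \<Rightarrow> (nat \<Rightarrow> real) \<Rightarrow> nat \<Rightarrow> real" where
  "resid_above n \<equiv> resid 1 (n - 1)"

abbreviation resid_below :: "nat \<Rightarrow> (nat \<Rightarrow> real) \<Rightarrow> real \<Rightarrow> (nat \<Rightarrow> real) \<Rightarrow> nat \<Rightarrow> real" where
  "resid_below k x v y \<equiv> resid 0 k x (case_nat v y)"

lemma prod_diff_flip: "(\<Prod>i<k. y i - T) = (-1) ^ k * (\<Prod>i<k. T - y i)" for T :: real
proof -
  have "(\<Prod>i<k. y i - T) = (\<Prod>i<k. (-1) * (T - y i))" by simp
  then show ?thesis by (simp only: prod.distrib prod_constant card_lessThan)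
qed

context
  fixes x y :: "nat \<Rightarrow> real" and n :: nat
  assumes sd: "strict_dec n x" and ab: "interlaced_above n x y"
begin

lemma resid_above_pos: "j < n \<Longrightarrow> 0 < resid_above n x y j"
  using resid_pos[of "n - 1" x 1 y j] sd ab by (cases n) (auto simp: interlaced_1_iff)

lemma sum_resid_above: "(\<Sum>j<n. resid_above n x y j) = (\<Sum>j<n. y j) - (\<Sum>j<n. x j)"
proof (cases n)
  case (Suc k)
  have "(\<Sum>j<Suc k. resid 1 k x y j) = (\<Sum>j<Suc k. y j) - (\<Sum>j<Suc k. x j)"
    using sum_resid[of k x 1 y] sd Suc
    by (simp add: lessThan_Suc_atMost[symmetric] sum_subtractf sum.lessThan_Suc_shift del: sum.lessThan_Suc)
  then show ?thesis using Suc by simp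
qed simp

lemma prod_resid_above:
  "(\<Prod>j<n. resid_above n x y j) * vandermonde n x ^ 2 = (\<Prod>j<n. \<Prod>i<n. \<bar>y i - x j\<bar>)"
proof (cases n)
  case (Suc k)
  have 0: "y 0 - x j = \<bar>y 0 - x j\<bar>" if "j < Suc k" for j
    using strict_dec_leD[OF sd, of 0 j] ab that by (simp add: interlaced_above_def Suc) (smt (verit) zero_less_Suc)
  have "(\<Prod>j<Suc k. resid 1 k x y j) * vandermonde (Suc k) x ^ 2
    = (\<Prod>j<Suc k. y 0 - x j) * (\<Prod>j<Suc k. \<Prod>i<k. \<bar>y (Suc i) - x j\<bar>)"
    using prod_resid[of k x 1 y] sd ab Suc by (simp add: lessThan_Suc_atMost interlaced_1_iff)
  also have "\<dots> = (\<Prod>j<Suc k. \<Prod>i<Suc k. \<bar>y i - x j\<bar>)"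
    unfolding prod.distrib[symmetric]
  proof (rule prod.cong[OF refl])
    fix j assume "j \<in> {..<Suc k}"
    then have "y 0 - x j = \<bar>y 0 - x j\<bar>" using 0 by simp
    then show "(y 0 - x j) * (\<Prod>i<k. \<bar>y (Suc i) - x j\<bar>) = (\<Prod>i<Suc k. \<bar>y i - x j\<bar>)"
      unfolding prod.lessThan_Suc_shift o_def by (simp only:)
  qed
  finally show ?thesis using Suc by simp
qed simp

text \<open>The left side is \<open>1 - X\<close>. On the right every factor except
  \<open>T - y 0\<close> is positive by interlacing, so for a nonempty configuration
  \<open>X < 1\<close> says precisely that \<open>y 0\<close> lies below \<open>T\<close> as
  well.\<close>

lemma resid_above_partial_fractions:
  assumes "\<And>j. j < n \<Longrightarrow> x j < T"
  shows "1 - (\<Sum>j<n. resid_above n x y j / (T - x j)) = (\<Prod>j<n. T - y j) / (\<Prod>j<n. T - x j)"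
proof (cases n)
  case (Suc k)
  have "1 + (\<Sum>j<Suc k. resid 1 k x y j / (x j - T))
      = (y 0 - T) * (\<Prod>i<k. y (Suc i) - T) / (\<Prod>j<Suc k. x j - T)"
  proof -
    have "T \<noteq> x j" if "j \<le> k" for j using assms[of j] Suc that by simp
    then show ?thesis using resid_partial_fractions[of k x T 1 y] sd Suc
      by (simp add: lessThan_Suc_atMost)
  qed
  also have "(y 0 - T) * (\<Prod>i<k. y (Suc i) - T) = (\<Prod>i<Suc k. y i - T)"
    by (simp only: prod.lessThan_Suc_shift o_def)
  also have "\<dots> / (\<Prod>j<Suc k. x j - T) = (\<Prod>j<Suc k. T - y j) / (\<Prod>j<Suc k. T - x j)"
    by (simp only: prod_diff_flip) simp
  also have "(\<Sum>j<Suc k. resid 1 k x y j / (x j - T)) = - (\<Sum>j<Suc k. resid 1 k x y j / (T - x j))"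
    unfolding sum_negf[symmetric] by (rule sum.cong) (simp_all add: minus_divide_right)
  finally show ?thesis using Suc by simp
qed simp

end

lemma resid_above_last:
  "resid_above (Suc k) x y k = (\<Prod>i<Suc k. y i - x k) / (\<Prod>i<k. x i - x k)"
proof -
  have "{..k} - {k} = {..<k}" by auto
  then show ?thesis by (simp add: resid_def prod.lessThan_Suc_shift del: prod.lessThan_Suc)
qed

context
  fixes x y :: "nat \<Rightarrow> real" and k :: nat and v :: real
  assumes sd: "strict_dec (Suc k) x" and v: "0 < v" and be: "interlaced_below k x y"
begin

lemma resid_below_pos: "j \<le> k \<Longrightarrow> 0 < resid_below k x v y j"
  using resid_pos[OF sd, of 0 "case_nat v y" j] v be by (simp add: interlaced_0_iff)

lemma sum_resid_below: "(\<Sum>j\<le>k. resid_below k x v y j) = v"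
  using sum_resid[OF sd, of 0 "case_nat v y"] by simp

lemma prod_resid_below:
  "(\<Prod>j\<le>k. resid_below k x v y j) * vandermonde (Suc k) x ^ 2
    = v ^ Suc k * (\<Prod>j\<le>k. \<Prod>i<k. \<bar>y i - x j\<bar>)"
  using prod_resid[OF sd, of 0 "case_nat v y"] v be by (simp add: interlaced_0_iff)

text \<open>When the zeros here are the poles of the previous level and the poles here its zeros,
  the quotient of products is the reciprocal of \<open>1 - X\<close> there, up to the factor
  \<open>T\<close> contributed by the point at \<open>0\<close>. This yields the next value
  \<open>v / (T * (1 - X))\<close>.\<close>

lemma resid_below_partial_fractions:
  assumes "\<And>j. j \<le> k \<Longrightarrow> x j < T"
  shows "(\<Sum>j\<le>k. resid_below k x v y j / (T - x j)) = v * (\<Prod>i<k. T - y i) / (\<Prod>j\<le>k. T - x j)"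
proof -
  have "(\<Sum>j\<le>k. resid_below k x v y j / (x j - T)) = v * (\<Prod>i<k. y i - T) / (\<Prod>j\<le>k. x j - T)"
    using resid_partial_fractions[OF sd, of T 0 "case_nat v y"] assms by force
  also have "\<dots> = - (v * (\<Prod>i<k. T - y i) / (\<Prod>j\<le>k. T - x j))"
    unfolding lessThan_Suc_atMost[symmetric] by (simp only: prod_diff_flip) simp
  also have "(\<Sum>j\<le>k. resid_below k x v y j / (x j - T)) = - (\<Sum>j\<le>k. resid_below k x v y j / (T - x j))"
    unfolding sum_negf[symmetric] by (rule sum.cong) (simp_all add: minus_divide_right)
  finally show ?thesis by simp
qed

end

lemma resid_below_last:
  "resid_below k x v y k = v * (\<Prod>i<k. y i - x k) / (\<Prod>i<k. x i - x k)"
proof -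
  have "{..k} - {k} = {..<k}" by auto
  then show ?thesis by (simp add: resid_def)
qed

lemma nn_integral_resid_above:
  assumes "strict_dec n x" "F \<in> borel_measurable (lborel_pow n)"
  shows "(\<integral>\<^sup>+g. (if \<forall>j<n. 0 < g j then F g else 0) \<partial>lborel_pow n) =
    (\<integral>\<^sup>+y. (if interlaced_above n x y then ennreal (vandermonde n y / vandermonde n x) *
       F (\<lambda>j\<in>{..<n}. resid_above n x y j) else 0) \<partial>lborel_pow n)"
proof (cases n)
  case 0
  show ?thesis unfolding 0 nn_integral_lborel_pow_0 by (simp add: interlaced_above_def restrict_def)
next
  case (Suc k)
  have jac: "resid_jac 1 k x y = vandermonde (Suc k) y / vandermonde (Suc k) x" for y
    by (simp add: resid_jac_def vandermonde_Suc_shift)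
  have "(\<integral>\<^sup>+g. (if \<forall>j\<le>k. 0 < g j then F g else 0) \<partial>lborel_pow (Suc k)) =
    (\<integral>\<^sup>+y. (if interlaced 1 k x y then ennreal (resid_jac 1 k x y) *
       F (\<lambda>j\<in>{..<Suc k}. resid 1 k x y j) else 0) \<partial>lborel_pow (Suc k))"
    by (rule nn_integral_resid) (use assms Suc in auto)
  then show ?thesis unfolding interlaced_1_iff jac less_Suc_eq_le[symmetric] Suc diff_Suc_1 .
qed

lemma nn_integral_resid_below:
  assumes "strict_dec (Suc k) x" "F \<in> borel_measurable (lborel_pow (Suc k))"
  shows "(\<integral>\<^sup>+g. (if \<forall>j\<le>k. 0 < g j then F g else 0) \<partial>lborel_pow (Suc k)) =
    (\<integral>\<^sup>+v. \<integral>\<^sup>+y. (if 0 < v \<and> interlaced_below k x y then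
       ennreal (v ^ k * vandermonde k y / vandermonde (Suc k) x) *
       F (\<lambda>j\<in>{..<Suc k}. resid_below k x v y j) else 0) \<partial>lborel_pow k \<partial>lborel)"
proof -
  have jac: "resid_jac 0 k x (case_nat v y) = v ^ k * vandermonde k y / vandermonde (Suc k) x" for v y
    by (simp add: resid_jac_def)
  show ?thesis
    using trans[OF nn_integral_resid[OF assms(1) order.refl assms(2)]
      nn_integral_lborel_pow_cons[OF measurable_resid_integrand[OF assms(2), of 0 x]]]
    unfolding interlaced_0_iff jac .
qed

section \<open>The recursion for the corner resolvent\<close>

definition gamma_weight :: "real \<Rightarrow> real \<Rightarrow> real \<Rightarrow> real" where
  "gamma_weight r a v = v powr (a - 1) * exp (- r * v)"

definition chamber :: "real \<Rightarrow> nat \<Rightarrow> (nat \<Rightarrow> real) \<Rightarrow> bool" where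
  "chamber T k x \<longleftrightarrow> strict_dec k x \<and> (\<forall>i<k. 0 < x i \<and> x i < T)"

definition point_weight :: "real \<Rightarrow> real \<Rightarrow> real \<Rightarrow> nat \<Rightarrow> (nat \<Rightarrow> real) \<Rightarrow> real" where
  "point_weight s r c k x =
     (\<Prod>i<k. x i) powr c * exp (- r * (\<Sum>i<k. x i)) * vandermonde k x powr (2 * s)"

text \<open>An unnormalised transition of the chain. The value 0 for \<open>X \<ge> 1\<close> kills
  the chain once it has reached 1.\<close>

definition gamma_kernel :: "real \<Rightarrow> real \<Rightarrow> real \<Rightarrow> (real \<Rightarrow> ennreal) \<Rightarrow> real \<Rightarrow> ennreal" where
  "gamma_kernel r T a \<phi> X = (if X < 1 then
     (\<integral>\<^sup>+v. (if 0 < v then ennreal (gamma_weight r a v) * \<phi> (v / (T * (1 - X))) else 0) \<partial>lborel) else 0)"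

text \<open>The unnormalised expectation of \<phi> at the corner resolvent, restricted to
  configurations below \<open>T\<close>.\<close>

definition resolvent_int :: "real \<Rightarrow> real \<Rightarrow> real \<Rightarrow> real \<Rightarrow> nat \<Rightarrow> (real \<Rightarrow> ennreal) \<Rightarrow> ennreal" where
  "resolvent_int s r c T k \<phi> = (\<integral>\<^sup>+x. (if chamber T k x then ennreal (point_weight s r c k x) *
     (\<integral>\<^sup>+g. (if \<forall>j<k. 0 < g j then ennreal (\<Prod>j<k. gamma_weight r s (g j)) *
        \<phi> (\<Sum>j<k. g j / (T - x j)) else 0) \<partial>lborel_pow k) else 0) \<partial>lborel_pow k)"

text \<open>The variant for the intermediate level, which has an additional point at \<open>0\<close> (with index \<open>k\<close>)
  carrying a weight of shape \<open>c + 1\<close>.\<close>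

definition resolvent_int0 :: "real \<Rightarrow> real \<Rightarrow> real \<Rightarrow> real \<Rightarrow> nat \<Rightarrow> (real \<Rightarrow> ennreal) \<Rightarrow> ennreal" where
  "resolvent_int0 s r c T k \<phi> = (\<integral>\<^sup>+y. (if chamber T k y then ennreal (point_weight s r (c + s) k y) *
     (\<integral>\<^sup>+g. (if \<forall>j\<le>k. 0 < g j then
        ennreal ((\<Prod>j<k. gamma_weight r s (g j)) * gamma_weight r (c + 1) (g k)) *
        \<phi> (\<Sum>j\<le>k. g j / (T - (y(k := 0)) j)) else 0) \<partial>lborel_pow (Suc k)) else 0) \<partial>lborel_pow k)"

lemma prod_gamma_weight:
  fixes n :: nat
  assumes "\<And>j. j < n \<Longrightarrow> 0 < g j"
  shows "(\<Prod>j<n. gamma_weight r a (g j)) = (\<Prod>j<n. g j) powr (a - 1) * exp (- r * (\<Sum>j<n. g j))"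
proof -
  have "exp (- r * (\<Sum>j<n. g j)) = (\<Prod>j<n. exp (- r * g j))"
    unfolding sum_distrib_left by (rule exp_sum[OF finite_lessThan])
  moreover have "(\<Prod>j<n. g j) powr (a - 1) = (\<Prod>j<n. g j powr (a - 1))"
    by (rule prod_powr_distrib)
  ultimately show ?thesis unfolding gamma_weight_def by (simp only: prod.distrib)
qed

lemma strict_dec_upd0: "chamber T k y \<Longrightarrow> strict_dec (Suc k) (y(k := 0))"
  by (auto simp: strict_dec_def chamber_def less_Suc_eq)

lemma vandermonde_upd0: "vandermonde (Suc k) (y(k := 0)) = vandermonde k y * (\<Prod>i<k. y i)"
proof -
  have "vandermonde k (y(k := 0)) = vandermonde k y" by (simp add: vandermonde_def)
  then show ?thesis by (simp add: vandermonde_Suc)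
qed

lemma measurable_gamma_weight [measurable]: "gamma_weight r a \<in> borel_measurable borel"
  unfolding gamma_weight_def by measurable

lemma measurable_gamma_kernel [measurable]:
  assumes [measurable]: "\<phi> \<in> borel_measurable borel"
  shows "gamma_kernel r T a \<phi> \<in> borel_measurable borel"
  unfolding gamma_kernel_def by measurable

lemma measurable_interlaced_below:
  "Measurable.pred (lborel_pow (Suc k) \<Otimes>\<^sub>M lborel_pow k) (\<lambda>p. interlaced_below k (fst p) (snd p))"
  unfolding interlaced_below_def by measurable

lemma measurable_interlaced_below_compose [measurable (raw)]:
  assumes "f \<in> N \<rightarrow>\<^sub>M lborel_pow (Suc k)" "g \<in> N \<rightarrow>\<^sub>M lborel_pow k"
  shows "Measurable.pred N (\<lambda>p. interlaced_below k (f p) (g p))"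
  using measurable_compose[OF measurable_Pair[OF assms] measurable_interlaced_below] by simp

lemma prod_T_pos_imp:
  assumes "0 < (\<Prod>i<Suc k. T - y i)" "\<And>i. i < k \<Longrightarrow> y (Suc i) < T"
  shows "y 0 < (T::real)"
proof -
  have "0 < (\<Prod>i<k. T - y (Suc i))" using assms(2) by (intro prod_pos) auto
  then show ?thesis using assms(1) unfolding prod.lessThan_Suc_shift o_def
    by (simp add: zero_less_mult_iff)
qed

text \<open>The joint domain of two adjacent levels, seen from \<open>y\<close> on the left and from
  \<open>x\<close> on the right. The condition on the product is \<open>X < 1\<close> at level
  \<open>x\<close>; it supplies \<open>y 0 < T\<close>, the one bound that interlacing does not
  give. The point at \<open>0\<close> supplies positivity of the last \<open>x\<close>.\<close>

lemma chamber_below_iff: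
  assumes "0 < T"
  shows "chamber T k y \<and> interlaced_below k (y(k := 0)) x \<longleftrightarrow>
    chamber T k x \<and> interlaced_above k x y \<and> 0 < (\<Prod>i<k. T - y i)"
proof safe
  assume y: "chamber T k y" and b: "interlaced_below k (y(k := 0)) x"
  have b1: "y (Suc i) < x i" if "Suc i < k" for i
    using b that unfolding interlaced_below_def by (metis Suc_lessD fun_upd_other nat_neq_iff)
  have b2: "x i < y i" if "i < k" for i
    using b that unfolding interlaced_below_def by (metis fun_upd_other nat_neq_iff)
  have b3: "0 < x i" if "i < k" for i
  proof (cases "Suc i = k")
    case True
    then show ?thesis using b that unfolding interlaced_below_def by (metis fun_upd_same)
  next
    case False
    then have "0 < y (Suc i)" "y (Suc i) < x i" using b1 y that by (auto simp: chamber_def)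
    then show ?thesis by simp
  qed
  show "chamber T k x"
    unfolding chamber_def strict_dec_def
  proof (intro conjI allI impI)
    fix i assume i: "Suc i < k"
    show "x (Suc i) < x i" using b1[of i] b2[of "Suc i"] i by simp
  next
    fix i assume i: "i < k"
    show "0 < x i" "x i < T" using b3[OF i] b2[OF i] y i by (force simp: chamber_def)+
  qed
  show "interlaced_above k x y" using b1 b2 by (simp add: interlaced_above_def)
  show "0 < (\<Prod>i<k. T - y i)" using y by (intro prod_pos) (auto simp: chamber_def)
next
  assume x: "chamber T k x" and a: "interlaced_above k x y" and p: "0 < (\<Prod>i<k. T - y i)"
  have T: "y (Suc i) < T" if "Suc i < k" for i
    using x a that unfolding chamber_def interlaced_above_def by (meson Suc_lessD less_trans)
  have T0: "y 0 < T" if "0 < k"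
    using that p T prod_T_pos_imp[of T y "k - 1"] by (cases k) auto
  show "chamber T k y"
    unfolding chamber_def strict_dec_def
  proof (intro conjI allI impI)
    fix i assume i: "Suc i < k"
    show "y (Suc i) < y i" using a i unfolding interlaced_above_def by (meson Suc_lessD less_trans)
  next
    fix i assume i: "i < k"
    show "0 < y i" using x a i unfolding chamber_def interlaced_above_def by (meson less_trans)
    show "y i < T" using T T0 i by (cases i) auto
  qed
  show "interlaced_below k (y(k := 0)) x"
    unfolding interlaced_below_def
  proof (intro allI impI conjI)
    fix i assume i: "i < k"
    show "(y(k := 0)) (Suc i) < x i"
      using i x a by (cases "Suc i = k") (auto simp: chamber_def interlaced_above_def)
    show "x i < (y(k := 0)) i" using i a by (auto simp: interlaced_above_def)
  qed
qed

text \<open>The same correspondence for the other half step. Here the pole at \<open>0\<close> lies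
  below \<open>z k\<close> and makes it positive.\<close>

lemma chamber_above_iff:
  assumes "0 < T"
  shows "chamber T (Suc k) z \<and> interlaced_below k z y \<longleftrightarrow>
    chamber T k y \<and> interlaced_above (Suc k) (y(k := 0)) z \<and> 0 < (\<Prod>i<Suc k. T - z i)"
proof safe
  assume z: "chamber T (Suc k) z" and b: "interlaced_below k z y"
  have b1: "z (Suc i) < y i" "y i < z i" if "i < k" for i
    using b that by (auto simp: interlaced_below_def)
  have z0: "0 < z i" "z i < T" if "i < Suc k" for i
    using z that by (auto simp: chamber_def)
  show "chamber T k y"
    unfolding chamber_def strict_dec_def
  proof (intro conjI allI impI)
    fix i assume i: "Suc i < k"
    show "y (Suc i) < y i" using b1[of i] b1[of "Suc i"] i by simp
  next
    fix i assume i: "i < k"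
    show "0 < y i" "y i < T" using b1[of i] z0[of i] z0[of "Suc i"] i by auto
  qed
  show "interlaced_above (Suc k) (y(k := 0)) z"
    using b1 z0 by (auto simp: interlaced_above_def less_Suc_eq)
  show "0 < (\<Prod>i<Suc k. T - z i)" using z0 by (intro prod_pos) auto
next
  assume y: "chamber T k y" and a: "interlaced_above (Suc k) (y(k := 0)) z" and p: "0 < (\<Prod>i<Suc k. T - z i)"
  have a1: "z (Suc i) < y i" "y i < z i" if "i < k" for i
    using a that unfolding interlaced_above_def by (auto split: if_splits) (metis less_SucI nat_neq_iff)+
  have a2: "0 < z k" using a by (auto simp: interlaced_above_def)
  have y0: "0 < y i" "y i < T" if "i < k" for i using y that by (auto simp: chamber_def)
  have T: "z (Suc i) < T" if "i < k" for i using a1[OF that] y0[OF that] by simp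
  have T0: "z 0 < T" by (rule prod_T_pos_imp[OF p T])
  show "chamber T (Suc k) z"
    unfolding chamber_def strict_dec_def
  proof (intro conjI allI impI)
    fix i assume i: "Suc i < Suc k"
    show "z (Suc i) < z i" using a1[of i] i by simp
  next
    fix i assume i: "i < Suc k"
    show "0 < z i" using a1[of i] y0[of i] a2 i by (cases "i = k") auto
    show "z i < T" using T T0 i by (cases i) auto
  qed
  show "interlaced_below k z y" using a1 by (simp add: interlaced_below_def)
qed

text \<open>Both changes of variables of a half step lead to these two densities in the remaining
  variables, with \<open>C\<close> the product of all mutual distances.\<close>

lemma half_step0_density:
  fixes C X Y V W v :: real
  assumes "0 < C" "0 < X" "0 < Y" "0 < V" "0 < W" "0 < v"
  shows "Y powr (c + s) * E * V powr (2 * s) * (v ^ k * W / (V * Y) *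
      ((v ^ k * C / (V^2 * Y)) powr (s - 1) * (v * X / Y) powr c))
    = X powr c * E * W powr (2 * s) * (V / W * ((C / W^2) powr (s - 1) * v powr (c + real k * s)))"
proof -
  \<comment> \<open>All quantities are positive. In terms of their logarithms both sides become
    exponentials, and the identity is one between polynomial exponents.\<close>
  define C' X' Y' V' W' v' where "C' = ln C" "X' = ln X" "Y' = ln Y" "V' = ln V" "W' = ln W" "v' = ln v"
  have "C = exp C'" "X = exp X'" "Y = exp Y'" "V = exp V'" "W = exp W'" "v = exp v'"
    using assms by (simp_all add: C'_X'_Y'_V'_W'_v'_def)
  then show ?thesis
    by (simp add: powr_def exp_add[symmetric] exp_diff[symmetric] exp_of_nat_mult[symmetric] power2_eq_square
         algebra_simps)
qed

lemma half_step_density: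
  fixes C Z Y V W v :: real
  assumes "0 < C" "0 < Z" "0 < Y" "0 < V" "0 < W" "0 < v"
  shows "Z powr c * E * W powr (2 * s) * (v ^ k * V / W * (v ^ Suc k * C / W^2) powr (s - 1))
    = Y powr (c + s) * E * V powr (2 * s) *
      (W / (V * Y) * ((C / (V^2 * Y)) powr (s - 1) * (Z / Y) powr c * v powr (real (Suc k) * s - 1)))"
proof -
  define C' Z' Y' V' W' v' where "C' = ln C" "Z' = ln Z" "Y' = ln Y" "V' = ln V" "W' = ln W" "v' = ln v"
  have "C = exp C'" "Z = exp Z'" "Y = exp Y'" "V = exp V'" "W = exp W'" "v = exp v'"
    using assms by (simp_all add: C'_Z'_Y'_V'_W'_v'_def)
  then show ?thesis
    by (simp add: powr_def exp_add[symmetric] exp_diff[symmetric] exp_of_nat_mult[symmetric] power2_eq_square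
         algebra_simps)
qed


section \<open>The two half steps as one joint density integrated in two orders\<close>

lemma nn_integral_triple_swap:
  fixes f :: "(nat \<Rightarrow> real) \<Rightarrow> (nat \<Rightarrow> real) \<Rightarrow> real \<Rightarrow> ennreal"
  assumes [measurable]: "(\<lambda>((y, x), v). f y x v) \<in> borel_measurable ((lborel_pow m \<Otimes>\<^sub>M lborel_pow n) \<Otimes>\<^sub>M lborel)"
  shows "(\<integral>\<^sup>+y. \<integral>\<^sup>+v. \<integral>\<^sup>+x. f y x v \<partial>lborel_pow n \<partial>lborel \<partial>lborel_pow m)
    = (\<integral>\<^sup>+x. \<integral>\<^sup>+y. \<integral>\<^sup>+v. f y x v \<partial>lborel \<partial>lborel_pow m \<partial>lborel_pow n)"
proof -
  have "(\<integral>\<^sup>+y. \<integral>\<^sup>+v. \<integral>\<^sup>+x. f y x v \<partial>lborel_pow n \<partial>lborel \<partial>lborel_pow m)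
    = (\<integral>\<^sup>+y. \<integral>\<^sup>+x. \<integral>\<^sup>+v. f y x v \<partial>lborel \<partial>lborel_pow n \<partial>lborel_pow m)"
  proof (intro nn_integral_cong nn_integral_lborel_pow_swap)
    fix y assume [measurable]: "y \<in> space (lborel_pow m)"
    have "(\<lambda>(v, x). ((y, x), v)) \<in> lborel \<Otimes>\<^sub>M lborel_pow n \<rightarrow>\<^sub>M (lborel_pow m \<Otimes>\<^sub>M lborel_pow n) \<Otimes>\<^sub>M lborel"
      by measurable
    from measurable_compose[OF this assms]
    show "(\<lambda>(v, x). f y x v) \<in> borel_measurable (lborel \<Otimes>\<^sub>M lborel_pow n)"
      by (simp add: case_prod_unfold)
  qed
  also have "\<dots> = (\<integral>\<^sup>+x. \<integral>\<^sup>+y. \<integral>\<^sup>+v. f y x v \<partial>lborel \<partial>lborel_pow m \<partial>lborel_pow n)"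
  proof (rule nn_integral_lborel_pow_swap2)
    have "(\<lambda>p. \<integral>\<^sup>+v. (\<lambda>((y, x), v). f y x v) (p, v) \<partial>lborel) \<in> borel_measurable (lborel_pow m \<Otimes>\<^sub>M lborel_pow n)"
      by (rule sigma_finite_measure.borel_measurable_nn_integral_fst[OF sigma_finite_lborel assms])
    then show "(\<lambda>(y, x). \<integral>\<^sup>+v. f y x v \<partial>lborel) \<in> borel_measurable (lborel_pow m \<Otimes>\<^sub>M lborel_pow n)"
      by (simp add: case_prod_unfold)
  qed
  finally show ?thesis .
qed

lemma nn_integral_if_cmult:
  assumes "f \<in> borel_measurable M" "Measurable.pred M P"
  shows "a * (\<integral>\<^sup>+g. (if P g then f g else 0) \<partial>M) = (\<integral>\<^sup>+g. (if P g then a * f g else 0) \<partial>M)"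
  using assms by (subst nn_integral_cmult[symmetric]) (auto intro!: nn_integral_cong)

lemma gamma_kernel_1_minus:
  assumes "0 < Q"
  shows "gamma_kernel r T a \<phi> (1 - Q) =
    (\<integral>\<^sup>+v. (if 0 < v then ennreal (gamma_weight r a v) * \<phi> (v / (T * Q)) else 0) \<partial>lborel)"
proof -
  have "1 - (1 - Q) = Q" by simp
  then show ?thesis using assms unfolding gamma_kernel_def by (simp only: if_True) simp
qed

text \<open>Both sides integrate the joint density \<open>H\<close> of two levels and
  \<open>v\<close>. Given \<open>y\<close>, the weights at \<open>y\<close> and \<open>0\<close> are
  traded for their sum \<open>v\<close> and the zeros \<open>x\<close>. Given \<open>x\<close>, the
  weights at \<open>x\<close> are traded for \<open>y\<close>, and \<open>v\<close> is the variable
  of the kernel. As a sum of \<open>k\<close> weights of shape \<open>s\<close> and one of shape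
  \<open>c + 1\<close>, \<open>v\<close> has shape \<open>c + 1 + real k * s\<close>.\<close>

lemma half_step0:
  assumes T: "0 < T" and [measurable]: "\<phi> \<in> borel_measurable borel"
  shows "resolvent_int0 s r c T k \<phi> = resolvent_int s r c T k (gamma_kernel r T (c + 1 + real k * s) \<phi>)"
proof -
  define D where "D y x v = (\<Prod>i<k. x i) powr c * exp (- r * (\<Sum>i<k. y i)) * vandermonde k x powr (2 * s) *
    (vandermonde k y / vandermonde k x * (((\<Prod>j<k. \<Prod>i<k. \<bar>y i - x j\<bar>) / vandermonde k x ^ 2) powr (s - 1) *
       v powr (c + real k * s))) * exp (- r * v)" for x y :: "nat \<Rightarrow> real" and v
  define H where "H y x v = (if chamber T k y \<and> interlaced_below k (y(k := 0)) x \<and> 0 < v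
     then ennreal (D y x v) * \<phi> (v * (\<Prod>i<k. T - x i) / (T * (\<Prod>i<k. T - y i))) else 0)" for x y v
  have Hm: "(\<lambda>((y, x), v). H y x v) \<in> borel_measurable ((lborel_pow k \<Otimes>\<^sub>M lborel_pow k) \<Otimes>\<^sub>M lborel)"
    unfolding case_prod_unfold H_def D_def chamber_def strict_dec_def vandermonde_def by measurable
  have comm: "(\<Prod>j<k. \<Prod>i<k. \<bar>x i - y j\<bar>) = (\<Prod>j<k. \<Prod>i<k. \<bar>y i - x j\<bar>)" for x y :: "nat \<Rightarrow> real"
  proof -
    have "(\<Prod>j<k. \<Prod>i<k. \<bar>x i - y j\<bar>) = (\<Prod>i<k. \<Prod>j<k. \<bar>x i - y j\<bar>)" by (rule prod.swap)
    also have "\<dots> = (\<Prod>i<k. \<Prod>j<k. \<bar>y j - x i\<bar>)" by (intro prod.cong refl abs_minus_commute)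
    finally show ?thesis .
  qed
  have pos: "0 < (\<Prod>i<k. x i)" "0 < (\<Prod>i<k. T - x i)" "0 < vandermonde k x" if "chamber T k x" for x
    using that by (auto simp: chamber_def intro!: prod_pos vandermonde_pos)
  \<comment> \<open>Strict interlacing keeps zeros and poles apart; positivity is required by the
    density identity, which takes logarithms.\<close>
  have cpos: "0 < (\<Prod>j<k. \<Prod>i<k. \<bar>y i - x j\<bar>)"
    if "chamber T k x" "interlaced_above k x y" for x y
  proof (intro prod_pos)
    fix i j assume ij: "j \<in> {..<k}" "i \<in> {..<k}"
    have sd: "strict_dec k x" using that by (simp add: chamber_def)
    have "y i \<noteq> x j"
    proof (cases "i \<le> j")
      case True
      then show ?thesis using strict_dec_leD[OF sd True] that(2) ij unfolding interlaced_above_def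
        by (metis lessThan_iff not_less)
    next
      case False
      then obtain l where l: "i = Suc l" "j \<le> l" by (metis Suc_leI Suc_le_D Suc_le_mono not_less_eq_eq)
      then show ?thesis using strict_dec_leD[OF sd l(2)] that(2) ij unfolding interlaced_above_def
        by (metis Suc_lessD lessThan_iff not_less)
    qed
    then show "0 < \<bar>y i - x j\<bar>" by simp
  qed
  have claim0: "(if chamber T k y then ennreal (point_weight s r (c + s) k y) *
     (\<integral>\<^sup>+g. (if \<forall>j\<le>k. 0 < g j then
        ennreal ((\<Prod>j<k. gamma_weight r s (g j)) * gamma_weight r (c + 1) (g k)) *
        \<phi> (\<Sum>j\<le>k. g j / (T - (y(k := 0)) j)) else 0) \<partial>lborel_pow (Suc k)) else 0)
     = (\<integral>\<^sup>+v. \<integral>\<^sup>+x. H y x v \<partial>lborel_pow k \<partial>lborel)" for y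
  proof (cases "chamber T k y")
    case True
    define y' where "y' = y(k := 0)"
    have y': "y' k = 0" "\<And>j. j < k \<Longrightarrow> y' j = y j" by (auto simp: y'_def)
    have sd: "strict_dec (Suc k) y'" using strict_dec_upd0[OF True] by (simp add: y'_def)
    define F where "F g = ennreal (point_weight s r (c + s) k y) *
      (ennreal ((\<Prod>j<k. gamma_weight r s (g j)) * gamma_weight r (c + 1) (g k)) *
        \<phi> (\<Sum>j\<le>k. g j / (T - y' j)))" for g
    have Fm: "F \<in> borel_measurable (lborel_pow (Suc k))" unfolding F_def by measurable
    have eq: "ennreal (v ^ k * vandermonde k x / vandermonde (Suc k) y') * F (\<lambda>j\<in>{..<Suc k}. resid_below k y' v x j)
        = ennreal (D y x v) * \<phi> (v * (\<Prod>i<k. T - x i) / (T * (\<Prod>i<k. T - y i)))"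
      if v: "0 < v" and be: "interlaced_below k y' x" for v x
    proof -
      define h where "h j = resid_below k y' v x j" for j
      have ch: "chamber T k x" "interlaced_above k x y"
        using chamber_below_iff[OF T, of k y x] True be by (auto simp: y'_def)
      define C where "C = (\<Prod>j<k. \<Prod>i<k. \<bar>y i - x j\<bar>)"
      define X where "X = (\<Prod>i<k. x i)"
      define Y where "Y = (\<Prod>i<k. y i)"
      define V where "V = vandermonde k y"
      define W where "W = vandermonde k x"
      have P: "0 < C" "0 < X" "0 < Y" "0 < V" "0 < W"
        using cpos[OF ch] pos[OF ch(1)] pos[OF True] by (auto simp: C_def X_def Y_def V_def W_def)
      have V': "vandermonde (Suc k) y' = V * Y" by (simp add: y'_def vandermonde_upd0 V_def Y_def)
      have hk: "h k = v * X / Y"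
        unfolding h_def resid_below_last X_def Y_def by (simp add: y')
      have hpos: "0 < h j" if "j \<le> k" for j
        unfolding h_def by (rule resid_below_pos[OF sd v be that])
      have "(\<Prod>j\<le>k. h j) * (V * Y)^2 = v ^ Suc k * ((\<Prod>j<k. \<Prod>i<k. \<bar>x i - y' j\<bar>) * (\<Prod>i<k. \<bar>x i\<bar>))"
        using prod_resid_below[OF sd v be] by (simp add: h_def V' lessThan_Suc_atMost[symmetric] y')
      also have "(\<Prod>j<k. \<Prod>i<k. \<bar>x i - y' j\<bar>) = C"
        unfolding C_def using comm[of x y] by (simp add: y')
      also have "(\<Prod>i<k. \<bar>x i\<bar>) = X"
        unfolding X_def using ch(1) by (intro prod.cong) (auto simp: chamber_def)
      finally have "((\<Prod>j<k. h j) * (v * X / Y)) * (V * Y)^2 = v ^ Suc k * (C * X)"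
        by (simp add: lessThan_Suc_atMost[symmetric] hk)
      then have hprod: "(\<Prod>j<k. h j) = v ^ k * C / (V^2 * Y)"
        using P v by (simp add: field_simps power2_eq_square)
      have hsum: "(\<Sum>j<k. h j) + h k = v"
        using sum_resid_below[OF sd v be] by (simp add: h_def lessThan_Suc_atMost[symmetric])
      have hres: "(\<Sum>j\<le>k. h j / (T - y' j)) = v * (\<Prod>i<k. T - x i) / (T * (\<Prod>i<k. T - y i))"
      proof -
        have "y' j < T" if "j \<le> k" for j using True that T by (cases "j = k") (auto simp: y' chamber_def)
        from resid_below_partial_fractions[OF sd v be this]
        show ?thesis by (simp add: h_def lessThan_Suc_atMost[symmetric] y' mult.commute)
      qed
      have "F (\<lambda>j\<in>{..<Suc k}. h j) = F h"
        unfolding F_def by (simp cong: sum.cong_simp prod.cong_simp)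
      also have "\<dots> = ennreal (Y powr (c + s) * exp (- r * (\<Sum>i<k. y i)) * V powr (2 * s)) *
        (ennreal ((v ^ k * C / (V^2 * Y)) powr (s - 1) * (v * X / Y) powr c * exp (- r * v)) *
           \<phi> (v * (\<Prod>i<k. T - x i) / (T * (\<Prod>i<k. T - y i))))"
      proof -
        have "(\<Prod>j<k. gamma_weight r s (h j)) * gamma_weight r (c + 1) (h k)
          = (\<Prod>j<k. h j) powr (s - 1) * h k powr c * (exp (- r * (\<Sum>j<k. h j)) * exp (- r * h k))"
          using prod_gamma_weight[of k h r s] hpos by (simp add: gamma_weight_def)
        also have "exp (- r * (\<Sum>j<k. h j)) * exp (- r * h k) = exp (- r * v)"
          unfolding exp_add[symmetric] hsum[symmetric] by (simp add: algebra_simps)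
        finally show ?thesis
          unfolding F_def hres by (simp add: hprod hk point_weight_def Y_def V_def)
      qed
      finally have "ennreal (v ^ k * vandermonde k x / vandermonde (Suc k) y') * F (\<lambda>j\<in>{..<Suc k}. h j)
        = ennreal (Y powr (c + s) * exp (- r * (\<Sum>i<k. y i)) * V powr (2 * s) * (v ^ k * W / (V * Y) *
           ((v ^ k * C / (V^2 * Y)) powr (s - 1) * (v * X / Y) powr c)) * exp (- r * v)) *
           \<phi> (v * (\<Prod>i<k. T - x i) / (T * (\<Prod>i<k. T - y i)))"
        using P v by (simp add: V' W_def[symmetric] ennreal_mult[symmetric] mult.assoc[symmetric]) (simp add: mult_ac)
      also have "\<dots> = ennreal (D y x v) * \<phi> (v * (\<Prod>i<k. T - x i) / (T * (\<Prod>i<k. T - y i)))"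
        unfolding half_step0_density[OF P v] by (simp only: D_def C_def X_def V_def W_def)
      finally show ?thesis by (simp only: h_def)
    qed
    have "(if chamber T k y then ennreal (point_weight s r (c + s) k y) *
     (\<integral>\<^sup>+g. (if \<forall>j\<le>k. 0 < g j then
        ennreal ((\<Prod>j<k. gamma_weight r s (g j)) * gamma_weight r (c + 1) (g k)) *
        \<phi> (\<Sum>j\<le>k. g j / (T - (y(k := 0)) j)) else 0) \<partial>lborel_pow (Suc k)) else 0)
      = (\<integral>\<^sup>+g. (if \<forall>j\<le>k. 0 < g j then F g else 0) \<partial>lborel_pow (Suc k))"
      unfolding F_def y'_def[symmetric] using True
      by (simp only: if_True, intro nn_integral_if_cmult) measurable
    also have "\<dots> = (\<integral>\<^sup>+v. \<integral>\<^sup>+x. (if 0 < v \<and> interlaced_below k y' x then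
       ennreal (v ^ k * vandermonde k x / vandermonde (Suc k) y') *
       F (\<lambda>j\<in>{..<Suc k}. resid_below k y' v x j) else 0) \<partial>lborel_pow k \<partial>lborel)"
      by (rule nn_integral_resid_below[OF sd Fm])
    also have "\<dots> = (\<integral>\<^sup>+v. \<integral>\<^sup>+x. H y x v \<partial>lborel_pow k \<partial>lborel)"
      unfolding H_def y'_def[symmetric] using True eq
      by (intro nn_integral_cong) auto
    finally show ?thesis .
  qed (simp add: H_def)
  have claim: "(if chamber T k x then ennreal (point_weight s r c k x) *
     (\<integral>\<^sup>+g. (if \<forall>j<k. 0 < g j then ennreal (\<Prod>j<k. gamma_weight r s (g j)) *
        gamma_kernel r T (c + 1 + real k * s) \<phi> (\<Sum>j<k. g j / (T - x j)) else 0) \<partial>lborel_pow k) else 0)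
     = (\<integral>\<^sup>+y. \<integral>\<^sup>+v. H y x v \<partial>lborel \<partial>lborel_pow k)" for x
  proof (cases "chamber T k x")
    case True
    have sd: "strict_dec k x" using True by (simp add: chamber_def)
    define F where "F g = ennreal (point_weight s r c k x) *
      (ennreal (\<Prod>j<k. gamma_weight r s (g j)) *
        gamma_kernel r T (c + 1 + real k * s) \<phi> (\<Sum>j<k. g j / (T - x j)))" for g
    have Fm: "F \<in> borel_measurable (lborel_pow k)" unfolding F_def by measurable
    have eq: "ennreal (vandermonde k y / vandermonde k x) * F (\<lambda>j\<in>{..<k}. resid_above k x y j)
        = (\<integral>\<^sup>+v. H y x v \<partial>lborel)"
      if ab: "interlaced_above k x y" for y
    proof -
      define h where "h j = resid_above k x y j" for j
      define C where "C = (\<Prod>j<k. \<Prod>i<k. \<bar>y i - x j\<bar>)"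
      define W where "W = vandermonde k x"
      define Q where "Q = (\<Prod>i<k. T - y i) / (\<Prod>i<k. T - x i)"
      have P: "0 < C" "0 < W" using cpos[OF True ab] pos[OF True] by (auto simp: C_def W_def)
      have hpos: "0 < h j" if "j < k" for j
        unfolding h_def by (rule resid_above_pos[OF sd ab that])
      have hprod: "(\<Prod>j<k. h j) = C / W^2"
        using prod_resid_above[OF sd ab] P by (simp add: h_def C_def W_def field_simps)
      have hsum: "(\<Sum>j<k. h j) = (\<Sum>j<k. y j) - (\<Sum>j<k. x j)"
        using sum_resid_above[OF sd ab] by (simp add: h_def)
      have hres: "(\<Sum>j<k. h j / (T - x j)) = 1 - Q"
        using resid_above_partial_fractions[OF sd ab, of T] True by (simp add: h_def chamber_def Q_def)
      have Fh: "F (\<lambda>j\<in>{..<k}. h j) = F h"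
        unfolding F_def by (simp cong: sum.cong_simp prod.cong_simp)
      have Qpos: "0 < Q \<longleftrightarrow> 0 < (\<Prod>i<k. T - y i)"
        using pos(2)[OF True] by (simp add: Q_def zero_less_divide_iff)
      have iff: "chamber T k y \<and> interlaced_below k (y(k := 0)) x \<longleftrightarrow> 0 < Q"
        using chamber_below_iff[OF T, of k y x] True ab Qpos by blast
      show ?thesis
      \<comment> \<open>If \<open>Q\<close> is not positive, the new largest point is not below
        \<open>T\<close>; then the kernel on one side and \<open>H\<close> on the other both
        vanish.\<close>
      proof (cases "0 < Q")
        case False
        then have "F h = 0" unfolding F_def hres by (simp add: gamma_kernel_def)
        moreover have "H y x v = 0" for v using iff False unfolding H_def by auto
        ultimately show ?thesis unfolding h_def[symmetric] Fh by simp
      next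
        case Q: True
        have V: "0 < vandermonde k y" using iff Q by (auto intro: pos)
        \<comment> \<open>The part of \<open>D\<close> that is free of \<open>v\<close>. The
          exponentials of points and weights merge into one in \<open>y\<close>, since the weights
          sum to the difference of the traces.\<close>
        define A where "A = vandermonde k y / W * (point_weight s r c k x * (\<Prod>j<k. gamma_weight r s (h j)))"
        have A: "A = (\<Prod>i<k. x i) powr c * exp (- r * (\<Sum>i<k. y i)) * W powr (2 * s) *
          (vandermonde k y / W * (C / W^2) powr (s - 1))"
        proof -
          have "exp (- r * (\<Sum>i<k. y i)) = exp (- r * (\<Sum>i<k. x i)) * exp (- r * (\<Sum>j<k. h j))"
            unfolding exp_add[symmetric] hsum by (simp add: algebra_simps)
          then show ?thesis
            using prod_gamma_weight[of k h r s] hpos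
            by (simp add: A_def point_weight_def hprod W_def mult_ac)
        qed
        have "0 \<le> A" unfolding A using V P by simp
        have nonneg: "0 \<le> point_weight s r c k x" "0 \<le> (\<Prod>j<k. gamma_weight r s (h j))"
          using pos[OF True] by (auto simp: point_weight_def gamma_weight_def intro!: prod_nonneg)
        have "ennreal (vandermonde k y / vandermonde k x) * F (\<lambda>j\<in>{..<k}. resid_above k x y j)
          = ennreal A * gamma_kernel r T (c + 1 + real k * s) \<phi> (1 - Q)"
        proof -
          have "0 \<le> vandermonde k y / vandermonde k x" using V pos(3)[OF True] by simp
          then have "ennreal A = ennreal (vandermonde k y / vandermonde k x) *
            (ennreal (point_weight s r c k x) * ennreal (\<Prod>j<k. gamma_weight r s (h j)))"
            unfolding A_def W_def by (simp only: ennreal_mult nonneg mult_nonneg_nonneg)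
          then show ?thesis unfolding h_def[symmetric] Fh unfolding F_def hres by (simp only: mult.assoc)
        qed
        also have "\<dots> = ennreal A * (\<integral>\<^sup>+v. (if 0 < v then
            ennreal (gamma_weight r (c + 1 + real k * s) v) * \<phi> (v / (T * Q)) else 0) \<partial>lborel)"
          by (simp only: gamma_kernel_1_minus[OF Q])
        also have "\<dots> = (\<integral>\<^sup>+v. (if 0 < v then ennreal A *
            (ennreal (gamma_weight r (c + 1 + real k * s) v) * \<phi> (v / (T * Q))) else 0) \<partial>lborel)"
          by (rule nn_integral_if_cmult) measurable
        also have "\<dots> = (\<integral>\<^sup>+v. H y x v \<partial>lborel)"
        proof (rule nn_integral_cong)
          fix v :: real
          have "A * gamma_weight r (c + 1 + real k * s) v = D y x v"
            unfolding A D_def gamma_weight_def C_def[symmetric] W_def[symmetric] by (simp add: mult_ac)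
          then have "ennreal A * (ennreal (gamma_weight r (c + 1 + real k * s) v) * \<phi> z) = ennreal (D y x v) * \<phi> z" for z
            using \<open>0 \<le> A\<close> by (simp add: mult.assoc[symmetric] ennreal_mult'[symmetric])
          moreover have "v / (T * Q) = v * (\<Prod>i<k. T - x i) / (T * (\<Prod>i<k. T - y i))" by (simp add: Q_def)
          ultimately show "(if 0 < v then ennreal A *
            (ennreal (gamma_weight r (c + 1 + real k * s) v) * \<phi> (v / (T * Q))) else 0) = H y x v"
            using Q iff by (simp add: H_def)
        qed
        finally show ?thesis .
      qed
    qed
    have "(if chamber T k x then ennreal (point_weight s r c k x) *
     (\<integral>\<^sup>+g. (if \<forall>j<k. 0 < g j then ennreal (\<Prod>j<k. gamma_weight r s (g j)) *
        gamma_kernel r T (c + 1 + real k * s) \<phi> (\<Sum>j<k. g j / (T - x j)) else 0) \<partial>lborel_pow k) else 0)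
      = (\<integral>\<^sup>+g. (if \<forall>j<k. 0 < g j then F g else 0) \<partial>lborel_pow k)"
      unfolding F_def using True
      by (simp only: if_True, intro nn_integral_if_cmult) measurable
    also have "\<dots> = (\<integral>\<^sup>+y. (if interlaced_above k x y then ennreal (vandermonde k y / vandermonde k x) *
       F (\<lambda>j\<in>{..<k}. resid_above k x y j) else 0) \<partial>lborel_pow k)"
      by (rule nn_integral_resid_above[OF sd Fm])
    also have "\<dots> = (\<integral>\<^sup>+y. \<integral>\<^sup>+v. H y x v \<partial>lborel \<partial>lborel_pow k)"
    proof (rule nn_integral_cong)
      fix y
      show "(if interlaced_above k x y then ennreal (vandermonde k y / vandermonde k x) *
         F (\<lambda>j\<in>{..<k}. resid_above k x y j) else 0) = (\<integral>\<^sup>+v. H y x v \<partial>lborel)"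
      proof (cases "interlaced_above k x y")
        case False
        then have "\<not> (chamber T k y \<and> interlaced_below k (y(k := 0)) x)"
          using chamber_below_iff[OF T, of k y x] by blast
        then have "H y x v = 0" for v by (auto simp: H_def)
        then show ?thesis using False by simp
      qed (use eq in simp)
    qed
    finally show ?thesis .
  next
    case False
    then have "\<not> (chamber T k y \<and> interlaced_below k (y(k := 0)) x)" for y
      using chamber_below_iff[OF T, of k y x] by blast
    then have "H y x v = 0" for y v by (auto simp: H_def)
    then show ?thesis using False by simp
  qed
  show ?thesis
    unfolding resolvent_int0_def resolvent_int_def claim0 claim
    by (rule nn_integral_triple_swap[OF Hm])
qed

text \<open>The argument of \<open>half_step0\<close> with the point at \<open>0\<close> now among
  the poles of the lower level. Here \<open>v\<close> is the sum of \<open>Suc k\<close> weights of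
  shape \<open>s\<close>, hence its shape.\<close>

lemma half_step:
  assumes T: "0 < T" and [measurable]: "\<phi> \<in> borel_measurable borel"
  shows "resolvent_int s r c T (Suc k) \<phi> = resolvent_int0 s r c T k (gamma_kernel r T (real (Suc k) * s) \<phi>)"
proof -
  define D where "D z y v = (\<Prod>i<k. y i) powr (c + s) * exp (- r * (\<Sum>i<Suc k. z i)) * vandermonde k y powr (2 * s) *
    (vandermonde (Suc k) z / (vandermonde k y * (\<Prod>i<k. y i)) *
      (((\<Prod>j<Suc k. \<Prod>i<k. \<bar>y i - z j\<bar>) / (vandermonde k y ^ 2 * (\<Prod>i<k. y i))) powr (s - 1) *
       ((\<Prod>i<Suc k. z i) / (\<Prod>i<k. y i)) powr c * v powr (real (Suc k) * s - 1))) * exp (- r * v)"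
    for z y :: "nat \<Rightarrow> real" and v
  define H where "H z y v = (if chamber T (Suc k) z \<and> interlaced_below k z y \<and> 0 < v
     then ennreal (D z y v) * \<phi> (v * (\<Prod>i<k. T - y i) / (\<Prod>i<Suc k. T - z i)) else 0)" for z y v
  have Hm: "(\<lambda>((z, y), v). H z y v) \<in> borel_measurable ((lborel_pow (Suc k) \<Otimes>\<^sub>M lborel_pow k) \<Otimes>\<^sub>M lborel)"
    unfolding case_prod_unfold H_def D_def chamber_def strict_dec_def vandermonde_def by measurable
  have pos: "0 < (\<Prod>i<n. x i)" "0 < (\<Prod>i<n. T - x i)" "0 < vandermonde n x" if "chamber T n x" for x n
    using that by (auto simp: chamber_def intro!: prod_pos vandermonde_pos)
  have cpos: "0 < (\<Prod>j<Suc k. \<Prod>i<k. \<bar>y i - z j\<bar>)"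
    if "chamber T (Suc k) z" "interlaced_below k z y" for z y
  proof (intro prod_pos)
    fix i j assume ij: "j \<in> {..<Suc k}" "i \<in> {..<k}"
    have sd: "strict_dec (Suc k) z" using that by (simp add: chamber_def)
    have "y i \<noteq> z j"
    proof (cases "j \<le> i")
      case True
      then show ?thesis using strict_dec_leD[OF sd True] that(2) ij unfolding interlaced_below_def
        by (metis lessThan_iff less_SucI not_less)
    next
      case False
      then have "Suc i \<le> j" by simp
      from strict_dec_leD[OF sd this] show ?thesis using that(2) ij unfolding interlaced_below_def
        by (metis lessThan_iff not_less)
    qed
    then show "0 < \<bar>y i - z j\<bar>" by simp
  qed
  have claim: "(if chamber T (Suc k) z then ennreal (point_weight s r c (Suc k) z) *
     (\<integral>\<^sup>+g. (if \<forall>j<Suc k. 0 < g j then ennreal (\<Prod>j<Suc k. gamma_weight r s (g j)) *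
        \<phi> (\<Sum>j<Suc k. g j / (T - z j)) else 0) \<partial>lborel_pow (Suc k)) else 0)
     = (\<integral>\<^sup>+v. \<integral>\<^sup>+y. H z y v \<partial>lborel_pow k \<partial>lborel)" for z
  proof (cases "chamber T (Suc k) z")
    case True
    have sd: "strict_dec (Suc k) z" using True by (simp add: chamber_def)
    define F where "F g = ennreal (point_weight s r c (Suc k) z) *
      (ennreal (\<Prod>j<Suc k. gamma_weight r s (g j)) * \<phi> (\<Sum>j<Suc k. g j / (T - z j)))" for g
    have Fm: "F \<in> borel_measurable (lborel_pow (Suc k))" unfolding F_def by measurable
    have eq: "ennreal (v ^ k * vandermonde k y / vandermonde (Suc k) z) * F (\<lambda>j\<in>{..<Suc k}. resid_below k z v y j)
        = ennreal (D z y v) * \<phi> (v * (\<Prod>i<k. T - y i) / (\<Prod>i<Suc k. T - z i))"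
      if v: "0 < v" and be: "interlaced_below k z y" for v y
    proof -
      define h where "h j = resid_below k z v y j" for j
      have ch: "chamber T k y" using chamber_above_iff[OF T, of k z y] True be by simp
      define C where "C = (\<Prod>j<Suc k. \<Prod>i<k. \<bar>y i - z j\<bar>)"
      define Z where "Z = (\<Prod>i<Suc k. z i)"
      define Y where "Y = (\<Prod>i<k. y i)"
      define V where "V = vandermonde k y"
      define W where "W = vandermonde (Suc k) z"
      have P: "0 < C" "0 < Z" "0 < Y" "0 < V" "0 < W"
        unfolding C_def Z_def Y_def V_def W_def
        by (rule cpos[OF True be] pos(1)[OF True] pos(1)[OF ch] pos(3)[OF True] pos(3)[OF ch])+
      have hpos: "0 < h j" if "j < Suc k" for j
        unfolding h_def by (rule resid_below_pos[OF sd v be]) (use that in simp)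
      have "(\<Prod>j<Suc k. h j) * W^2 = v ^ Suc k * C"
        using prod_resid_below[OF sd v be] by (simp only: h_def W_def C_def lessThan_Suc_atMost)
      then have hprod: "(\<Prod>j<Suc k. h j) = v ^ Suc k * C / W^2"
        using P v by (simp add: field_simps)
      have hsum: "(\<Sum>j<Suc k. h j) = v"
        using sum_resid_below[OF sd v be] by (simp only: h_def lessThan_Suc_atMost)
      have hres: "(\<Sum>j<Suc k. h j / (T - z j)) = v * (\<Prod>i<k. T - y i) / (\<Prod>i<Suc k. T - z i)"
      proof -
        have "z j < T" if "j \<le> k" for j using True that by (simp add: chamber_def)
        from resid_below_partial_fractions[OF sd v be this]
        show ?thesis by (simp only: h_def lessThan_Suc_atMost)
      qed
      have "F (\<lambda>j\<in>{..<Suc k}. h j) = F h"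
        unfolding F_def by (simp cong: sum.cong_simp prod.cong_simp)
      also have "\<dots> = ennreal (Z powr c * exp (- r * (\<Sum>i<Suc k. z i)) * W powr (2 * s)) *
        (ennreal ((v ^ Suc k * C / W^2) powr (s - 1) * exp (- r * v)) *
           \<phi> (v * (\<Prod>i<k. T - y i) / (\<Prod>i<Suc k. T - z i)))"
      proof -
        have "(\<Prod>j<Suc k. gamma_weight r s (h j)) = (v ^ Suc k * C / W^2) powr (s - 1) * exp (- r * v)"
          using prod_gamma_weight[of "Suc k" h r s] hpos unfolding hprod hsum by blast
        then show ?thesis unfolding F_def hres by (simp only: point_weight_def Z_def W_def)
      qed
      finally have "ennreal (v ^ k * V / W) * F (\<lambda>j\<in>{..<Suc k}. h j)
        = ennreal (Z powr c * exp (- r * (\<Sum>i<Suc k. z i)) * W powr (2 * s) * (v ^ k * V / W *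
           (v ^ Suc k * C / W^2) powr (s - 1)) * exp (- r * v)) *
           \<phi> (v * (\<Prod>i<k. T - y i) / (\<Prod>i<Suc k. T - z i))"
        using P v by (simp add: ennreal_mult[symmetric] mult.assoc[symmetric] del: sum.lessThan_Suc prod.lessThan_Suc)
          (simp add: mult_ac)
      also have "\<dots> = ennreal (D z y v) * \<phi> (v * (\<Prod>i<k. T - y i) / (\<Prod>i<Suc k. T - z i))"
        unfolding half_step_density[OF P(1,2,3,4,5) v] by (simp only: D_def C_def Z_def Y_def V_def W_def)
      finally show ?thesis by (simp only: h_def V_def W_def)
    qed
    have "(if chamber T (Suc k) z then ennreal (point_weight s r c (Suc k) z) *
     (\<integral>\<^sup>+g. (if \<forall>j<Suc k. 0 < g j then ennreal (\<Prod>j<Suc k. gamma_weight r s (g j)) *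
        \<phi> (\<Sum>j<Suc k. g j / (T - z j)) else 0) \<partial>lborel_pow (Suc k)) else 0)
      = (\<integral>\<^sup>+g. (if \<forall>j\<le>k. 0 < g j then F g else 0) \<partial>lborel_pow (Suc k))"
      unfolding F_def less_Suc_eq_le[symmetric] using True
      by (simp only: if_True, intro nn_integral_if_cmult) measurable
    also have "\<dots> = (\<integral>\<^sup>+v. \<integral>\<^sup>+y. (if 0 < v \<and> interlaced_below k z y then
       ennreal (v ^ k * vandermonde k y / vandermonde (Suc k) z) *
       F (\<lambda>j\<in>{..<Suc k}. resid_below k z v y j) else 0) \<partial>lborel_pow k \<partial>lborel)"
      by (rule nn_integral_resid_below[OF sd Fm])
    also have "\<dots> = (\<integral>\<^sup>+v. \<integral>\<^sup>+y. H z y v \<partial>lborel_pow k \<partial>lborel)"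
    proof (intro nn_integral_cong)
      fix v y
      show "(if 0 < v \<and> interlaced_below k z y then
         ennreal (v ^ k * vandermonde k y / vandermonde (Suc k) z) *
         F (\<lambda>j\<in>{..<Suc k}. resid_below k z v y j) else 0) = H z y v"
        using eq[of v y] True unfolding H_def by (simp only: simp_thms if_True if_False split: if_split) blast
    qed
    finally show ?thesis .
  qed (simp add: H_def)
  have claim0: "(if chamber T k y then ennreal (point_weight s r (c + s) k y) *
     (\<integral>\<^sup>+g. (if \<forall>j\<le>k. 0 < g j then
        ennreal ((\<Prod>j<k. gamma_weight r s (g j)) * gamma_weight r (c + 1) (g k)) *
        gamma_kernel r T (real (Suc k) * s) \<phi> (\<Sum>j\<le>k. g j / (T - (y(k := 0)) j)) else 0) \<partial>lborel_pow (Suc k)) else 0)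
     = (\<integral>\<^sup>+z. \<integral>\<^sup>+v. H z y v \<partial>lborel \<partial>lborel_pow (Suc k))" for y
  proof (cases "chamber T k y")
    case True
    define y' where "y' = y(k := 0)"
    have y': "y' k = 0" "\<And>j. j < k \<Longrightarrow> y' j = y j" by (auto simp: y'_def)
    have sd: "strict_dec (Suc k) y'" using strict_dec_upd0[OF True] by (simp add: y'_def)
    define F where "F g = ennreal (point_weight s r (c + s) k y) *
      (ennreal ((\<Prod>j<k. gamma_weight r s (g j)) * gamma_weight r (c + 1) (g k)) *
        gamma_kernel r T (real (Suc k) * s) \<phi> (\<Sum>j<Suc k. g j / (T - y' j)))" for g
    have Fm: "F \<in> borel_measurable (lborel_pow (Suc k))" unfolding F_def by measurable
    have eq: "ennreal (vandermonde (Suc k) z / vandermonde (Suc k) y') * F (\<lambda>j\<in>{..<Suc k}. resid_above (Suc k) y' z j)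
        = (\<integral>\<^sup>+v. H z y v \<partial>lborel)"
      if ab: "interlaced_above (Suc k) y' z" for z
    proof -
      define h where "h j = resid_above (Suc k) y' z j" for j
      \<comment> \<open>The factor \<open>T\<close> in the denominator is \<open>T - y' k\<close>,
        the contribution of the point at \<open>0\<close>.\<close>
      define Q where "Q = (\<Prod>i<Suc k. T - z i) / (T * (\<Prod>i<k. T - y i))"
      define Z where "Z = (\<Prod>i<Suc k. z i)"
      define Y where "Y = (\<Prod>i<k. y i)"
      define V where "V = vandermonde k y"
      define W where "W = vandermonde (Suc k) z"
      define C where "C = (\<Prod>j<Suc k. \<Prod>i<k. \<bar>y i - z j\<bar>)"
      have P: "0 < Y" "0 < V" using pos[OF True] by (auto simp: Y_def V_def)
      have V': "vandermonde (Suc k) y' = V * Y" by (simp add: y'_def vandermonde_upd0 V_def Y_def)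
      have hpos: "0 < h j" if "j < Suc k" for j
        unfolding h_def by (rule resid_above_pos[OF sd ab that])
      have hsum: "(\<Sum>j<k. h j) + h k = (\<Sum>j<Suc k. z j) - (\<Sum>j<k. y j)"
        using sum_resid_above[OF sd ab] by (simp add: h_def y')
      have prodT: "(\<Prod>i<Suc k. T - y' i) = T * (\<Prod>i<k. T - y i)" by (simp add: y')
      have hres: "(\<Sum>j<Suc k. h j / (T - y' j)) = 1 - Q"
      proof -
        have "y' j < T" if "j < Suc k" for j using True that T by (cases "j = k") (auto simp: y' chamber_def)
        from resid_above_partial_fractions[OF sd ab this, unfolded prodT]
        show ?thesis unfolding h_def Q_def by linarith
      qed
      have Fh: "F (\<lambda>j\<in>{..<Suc k}. h j) = F h"
        unfolding F_def by (simp cong: sum.cong_simp prod.cong_simp)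
      have Qpos: "0 < Q \<longleftrightarrow> 0 < (\<Prod>i<Suc k. T - z i)"
      proof -
        have "0 < T * (\<Prod>i<k. T - y i)" using pos(2)[OF True] T by simp
        then show ?thesis unfolding Q_def by (simp only: pos_less_divide_eq mult_zero_left)
      qed
      have iff: "chamber T (Suc k) z \<and> interlaced_below k z y \<longleftrightarrow> 0 < Q"
        using chamber_above_iff[OF T, of k z y] True ab Qpos unfolding y'_def by blast
      show ?thesis
      proof (cases "0 < Q")
        case False
        then have "F h = 0" unfolding F_def hres by (simp add: gamma_kernel_def)
        moreover have "H z y v = 0" for v using iff False unfolding H_def by auto
        ultimately show ?thesis unfolding h_def[symmetric] Fh by simp
      next
        case Q: True
        have ch: "chamber T (Suc k) z" "interlaced_below k z y" using iff Q by auto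
        have P': "0 < Z" "0 < W" "0 < C"
          unfolding Z_def W_def C_def by (rule pos(1)[OF ch(1)] pos(3)[OF ch(1)] cpos[OF ch])+
        have hk: "h k = Z / Y"
          unfolding h_def resid_above_last Z_def Y_def by (simp add: y')
        have hprod: "(\<Prod>j<k. h j) = C / (V^2 * Y)"
        proof -
          have "(\<Prod>j<k. h j) * h k * (V * Y)^2 = (\<Prod>j<k. \<Prod>i<Suc k. \<bar>z i - y' j\<bar>) * (\<Prod>i<Suc k. \<bar>z i - y' k\<bar>)"
            using prod_resid_above[OF sd ab] unfolding h_def V' by (simp only: prod.lessThan_Suc[of _ k])
          also have "(\<Prod>i<Suc k. \<bar>z i - y' k\<bar>) = Z"
            unfolding Z_def using ch(1) by (intro prod.cong) (auto simp: chamber_def y')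
          also have "(\<Prod>j<k. \<Prod>i<Suc k. \<bar>z i - y' j\<bar>) = (\<Prod>j<k. \<Prod>i<Suc k. \<bar>y j - z i\<bar>)"
            by (intro prod.cong refl) (simp add: y' abs_minus_commute)
          also have "\<dots> = C" unfolding C_def by (rule prod.swap)
          finally show ?thesis using P P' by (simp add: hk field_simps power2_eq_square)
        qed
        define A where "A = W / (V * Y) * (point_weight s r (c + s) k y *
          ((\<Prod>j<k. gamma_weight r s (h j)) * gamma_weight r (c + 1) (h k)))"
        have A: "A = Y powr (c + s) * exp (- r * (\<Sum>i<Suc k. z i)) * V powr (2 * s) *
          (W / (V * Y) * ((C / (V^2 * Y)) powr (s - 1) * (Z / Y) powr c))"
        proof -
          have e: "exp (- r * (\<Sum>i<Suc k. z i)) = exp (- r * (\<Sum>i<k. y i)) * (exp (- r * (\<Sum>j<k. h j)) * exp (- r * h k))"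
          proof -
            have "(\<Sum>i<Suc k. z i) = (\<Sum>i<k. y i) + ((\<Sum>j<k. h j) + h k)" using hsum by linarith
            then show ?thesis by (simp only: exp_add[symmetric] distrib_left)
          qed
          show ?thesis unfolding e
            using prod_gamma_weight[of k h r s] hpos
            by (simp add: A_def point_weight_def gamma_weight_def hk hprod V_def Y_def mult_ac)
        qed
        have "0 \<le> A" unfolding A using P P' by simp
        have nonneg: "0 \<le> point_weight s r (c + s) k y"
          "0 \<le> (\<Prod>j<k. gamma_weight r s (h j)) * gamma_weight r (c + 1) (h k)"
          using pos[OF True] by (auto simp: point_weight_def gamma_weight_def intro!: prod_nonneg mult_nonneg_nonneg)
        have "ennreal (vandermonde (Suc k) z / vandermonde (Suc k) y') * F (\<lambda>j\<in>{..<Suc k}. resid_above (Suc k) y' z j)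
          = ennreal A * gamma_kernel r T (real (Suc k) * s) \<phi> (1 - Q)"
        proof -
          have "0 \<le> W / (V * Y)" using P P' by simp
          then have "ennreal A = ennreal (W / (V * Y)) * (ennreal (point_weight s r (c + s) k y) *
            ennreal ((\<Prod>j<k. gamma_weight r s (h j)) * gamma_weight r (c + 1) (h k)))"
            unfolding A_def using nonneg by (metis ennreal_mult mult_nonneg_nonneg)
          then show ?thesis unfolding h_def[symmetric] Fh V' W_def[symmetric] unfolding F_def hres
            by (simp only: mult.assoc)
        qed
        also have "\<dots> = ennreal A * (\<integral>\<^sup>+v. (if 0 < v then
            ennreal (gamma_weight r (real (Suc k) * s) v) * \<phi> (v / (T * Q)) else 0) \<partial>lborel)"
          by (simp only: gamma_kernel_1_minus[OF Q])
        also have "\<dots> = (\<integral>\<^sup>+v. (if 0 < v then ennreal A *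
            (ennreal (gamma_weight r (real (Suc k) * s) v) * \<phi> (v / (T * Q))) else 0) \<partial>lborel)"
          by (rule nn_integral_if_cmult) measurable
        also have "\<dots> = (\<integral>\<^sup>+v. H z y v \<partial>lborel)"
        proof (rule nn_integral_cong)
          fix v :: real
          have "A * gamma_weight r (real (Suc k) * s) v = D z y v"
            unfolding A D_def gamma_weight_def C_def[symmetric] W_def[symmetric] V_def[symmetric] Y_def[symmetric] Z_def[symmetric]
            by (simp only: mult_ac)
          then have "ennreal A * (ennreal (gamma_weight r (real (Suc k) * s) v) * \<phi> u) = ennreal (D z y v) * \<phi> u" for u
            using \<open>0 \<le> A\<close> by (simp only: mult.assoc[symmetric] ennreal_mult'[symmetric])
          moreover have "v / (T * Q) = v * (\<Prod>i<k. T - y i) / (\<Prod>i<Suc k. T - z i)"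
            using T pos(2)[OF True] unfolding Q_def by (simp add: field_simps del: prod.lessThan_Suc)
          ultimately show "(if 0 < v then ennreal A *
            (ennreal (gamma_weight r (real (Suc k) * s) v) * \<phi> (v / (T * Q))) else 0) = H z y v"
            using Q iff by (simp add: H_def)
        qed
        finally show ?thesis .
      qed
    qed
    have "(if chamber T k y then ennreal (point_weight s r (c + s) k y) *
     (\<integral>\<^sup>+g. (if \<forall>j\<le>k. 0 < g j then
        ennreal ((\<Prod>j<k. gamma_weight r s (g j)) * gamma_weight r (c + 1) (g k)) *
        gamma_kernel r T (real (Suc k) * s) \<phi> (\<Sum>j\<le>k. g j / (T - (y(k := 0)) j)) else 0) \<partial>lborel_pow (Suc k)) else 0)
      = (\<integral>\<^sup>+g. (if \<forall>j<Suc k. 0 < g j then F g else 0) \<partial>lborel_pow (Suc k))"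
      unfolding F_def less_Suc_eq_le[symmetric] lessThan_Suc_atMost[symmetric] y'_def[symmetric] using True
      by (simp only: if_True, intro nn_integral_if_cmult) measurable
    also have "\<dots> = (\<integral>\<^sup>+z. (if interlaced_above (Suc k) y' z then ennreal (vandermonde (Suc k) z / vandermonde (Suc k) y') *
       F (\<lambda>j\<in>{..<Suc k}. resid_above (Suc k) y' z j) else 0) \<partial>lborel_pow (Suc k))"
      by (rule nn_integral_resid_above[OF sd Fm])
    also have "\<dots> = (\<integral>\<^sup>+z. \<integral>\<^sup>+v. H z y v \<partial>lborel \<partial>lborel_pow (Suc k))"
    proof (rule nn_integral_cong)
      fix z
      show "(if interlaced_above (Suc k) y' z then ennreal (vandermonde (Suc k) z / vandermonde (Suc k) y') *
         F (\<lambda>j\<in>{..<Suc k}. resid_above (Suc k) y' z j) else 0) = (\<integral>\<^sup>+v. H z y v \<partial>lborel)"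
      proof (cases "interlaced_above (Suc k) y' z")
        case True
        then show ?thesis using eq by (simp only: if_True)
      next
        case False
        then have "\<not> (chamber T (Suc k) z \<and> interlaced_below k z y)"
          using chamber_above_iff[OF T, of k z y] unfolding y'_def by blast
        then have "H z y v = 0" for v unfolding H_def by auto
        then show ?thesis using False by simp
      qed
    qed
    finally show ?thesis .
  next
    case False
    then have "\<not> (chamber T (Suc k) z \<and> interlaced_below k z y)" for z
      using chamber_above_iff[OF T, of k z y] by blast
    then have "H z y v = 0" for z v unfolding H_def by auto
    then show ?thesis using False by simp
  qed
  show ?thesis
    unfolding resolvent_int0_def resolvent_int_def claim0 claim
    by (rule nn_integral_triple_swap[OF Hm])
qed

section \<open>The chain of gamma variables\<close>

definition gamma_mass :: "real \<Rightarrow> real \<Rightarrow> ennreal" where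
  "gamma_mass r a = (\<integral>\<^sup>+v. (if 0 < v then ennreal (gamma_weight r a v) else 0) \<partial>lborel)"

text \<open>The normalised transition, with the threshold absorbed into the rate: a gamma variable
  of rate \<open>r\<close> divided by \<open>T\<close> has rate \<open>r * T\<close>.\<close>

definition gamma_step :: "real \<Rightarrow> real \<Rightarrow> (real \<Rightarrow> ennreal) \<Rightarrow> real \<Rightarrow> ennreal" where
  "gamma_step r a \<psi> X = (if X < 1 then
     (\<integral>\<^sup>+v. (if 0 < v then ennreal (gamma_weight r a v) * \<psi> (v / (1 - X)) else 0) \<partial>lborel) / gamma_mass r a else 0)"

lemma gamma_weight_nonneg [simp]: "0 \<le> gamma_weight r a v"
  by (simp add: gamma_weight_def)

lemma nn_integral_gamma_weight_scale:
  assumes "0 < T" and [measurable]: "f \<in> borel_measurable borel"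
  shows "(\<integral>\<^sup>+v. (if 0 < v then ennreal (gamma_weight r a v) * f v else 0) \<partial>lborel)
    = ennreal (T powr a) * (\<integral>\<^sup>+v. (if 0 < v then ennreal (gamma_weight (r * T) a v) * f (T * v) else 0) \<partial>lborel)"
proof -
  have eq: "ennreal T * (if 0 < T * v then ennreal (gamma_weight r a (T * v)) * f (T * v) else 0)
    = ennreal (T powr a) * (if 0 < v then ennreal (gamma_weight (r * T) a v) * f (T * v) else 0)" for v
  proof (cases "0 < v")
    case True
    have "T * gamma_weight r a (T * v) = T powr a * gamma_weight (r * T) a v"
      using assms(1) True by (simp add: gamma_weight_def powr_mult powr_diff mult_ac)
    then have "ennreal T * ennreal (gamma_weight r a (T * v)) = ennreal (T powr a) * ennreal (gamma_weight (r * T) a v)"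
      using assms(1) by (simp add: ennreal_mult[symmetric])
    then show ?thesis using True assms(1) by (simp add: mult.assoc[symmetric])
  next
    case False
    then show ?thesis using assms(1) by (simp add: zero_less_mult_iff)
  qed
  have "(\<integral>\<^sup>+v. (if 0 < v then ennreal (gamma_weight r a v) * f v else 0) \<partial>lborel)
    = ennreal \<bar>T\<bar> * (\<integral>\<^sup>+v. (if 0 < 0 + T * v then ennreal (gamma_weight r a (0 + T * v)) * f (0 + T * v) else 0) \<partial>lborel)"
    by (rule nn_integral_real_affine) (measurable, use assms in simp)
  also have "\<dots> = (\<integral>\<^sup>+v. ennreal T * (if 0 < T * v then ennreal (gamma_weight r a (T * v)) * f (T * v) else 0) \<partial>lborel)"
    using assms(1) by (subst nn_integral_cmult) (simp_all cong: if_cong)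
  also have "\<dots> = ennreal (T powr a) * (\<integral>\<^sup>+v. (if 0 < v then ennreal (gamma_weight (r * T) a v) * f (T * v) else 0) \<partial>lborel)"
    unfolding eq by (rule nn_integral_cmult) measurable
  finally show ?thesis .
qed

lemma gamma_mass_scale:
  assumes "0 < T"
  shows "gamma_mass r a = ennreal (T powr a) * gamma_mass (r * T) a"
  using nn_integral_gamma_weight_scale[OF assms, of "\<lambda>_. 1" r a] by (simp only: gamma_mass_def mult_1_right borel_measurable_const)

lemma gamma_mass_1:
  assumes "0 < a"
  shows "gamma_mass 1 a = ennreal (Gamma a)"
proof -
  have "(\<integral>\<^sup>+v. ennreal (v powr (a - 1) / exp v) * indicator {0..} v \<partial>lborel) = ennreal (Gamma a)"
    by (rule nn_integral_has_integral_lebesgue') (use Gamma_integral_real[OF assms] in auto)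
  also have "(\<integral>\<^sup>+v. ennreal (v powr (a - 1) / exp v) * indicator {0..} v \<partial>lborel) = gamma_mass 1 a"
    unfolding gamma_mass_def
    by (rule nn_integral_cong) (auto simp: gamma_weight_def indicator_def exp_minus field_simps)
  finally show ?thesis .
qed

lemma gamma_mass_pos_finite:
  assumes "0 < a" "0 < r"
  shows "gamma_mass r a \<noteq> 0" "gamma_mass r a \<noteq> \<infinity>"
proof -
  have "gamma_mass r a = ennreal ((1 / r) powr a) * ennreal (Gamma a)"
    using gamma_mass_scale[of "1 / r" r a] assms by (simp add: gamma_mass_1)
  moreover have "0 < (1 / r) powr a * Gamma a" using assms by (simp add: Gamma_real_pos)
  ultimately have "gamma_mass r a = ennreal ((1 / r) powr a * Gamma a)" "0 < (1 / r) powr a * Gamma a"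
    using assms Gamma_real_pos[of a] by (simp_all add: ennreal_mult)
  then show "gamma_mass r a \<noteq> 0" "gamma_mass r a \<noteq> \<infinity>" by (simp_all only: ennreal_eq_0_iff not_le infinity_ennreal_def ennreal_neq_top simp_thms)
qed

lemma gamma_kernel_eq_step:
  assumes "0 < T" "0 < r" "0 < a" and [measurable]: "\<phi> \<in> borel_measurable borel"
  shows "gamma_kernel r T a \<phi> X = gamma_mass r a * gamma_step (r * T) a \<phi> X"
proof (cases "X < 1")
  case True
  have m: "gamma_mass (r * T) a \<noteq> 0" "gamma_mass (r * T) a \<noteq> \<infinity>"
    using gamma_mass_pos_finite[of a "r * T"] assms by auto
  have "T * v / (T * (1 - X)) = v / (1 - X)" for v using assms(1) by simp
  then have "gamma_kernel r T a \<phi> X = ennreal (T powr a) *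
    (\<integral>\<^sup>+v. (if 0 < v then ennreal (gamma_weight (r * T) a v) * \<phi> (v / (1 - X)) else 0) \<partial>lborel)" (is "_ = _ * ?I")
    unfolding gamma_kernel_def using True
    by (simp only: if_True, subst nn_integral_gamma_weight_scale[OF assms(1)]) (measurable, simp only:)
  also have "?I = gamma_mass (r * T) a * (?I / gamma_mass (r * T) a)"
    using m by (simp only: ennreal_times_divide mult.commute[of "gamma_mass (r * T) a"] ennreal_mult_divide_eq infinity_ennreal_def simp_thms)
  finally show ?thesis
    using True gamma_mass_scale[OF assms(1), of r a] by (simp add: gamma_step_def mult.assoc)
qed (simp add: gamma_kernel_def gamma_step_def)

lemma measurable_gamma_step [measurable]:
  assumes [measurable]: "\<psi> \<in> borel_measurable borel"
  shows "gamma_step r a \<psi> \<in> borel_measurable borel"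
  unfolding gamma_step_def by measurable

lemma gamma_kernel_cmult:
  assumes [measurable]: "\<phi> \<in> borel_measurable borel"
  shows "gamma_kernel r T a (\<lambda>X. C * \<phi> X) X = C * gamma_kernel r T a \<phi> X"
proof -
  have "(if 0 < v then ennreal (gamma_weight r a v) * (C * \<phi> (v / (T * (1 - X)))) else 0)
    = C * (if 0 < v then ennreal (gamma_weight r a v) * \<phi> (v / (T * (1 - X))) else 0)" for v
    by (simp add: mult.left_commute)
  moreover have "(\<integral>\<^sup>+v. C * (if 0 < v then ennreal (gamma_weight r a v) * \<phi> (v / (T * (1 - X))) else 0) \<partial>lborel)
    = C * (\<integral>\<^sup>+v. (if 0 < v then ennreal (gamma_weight r a v) * \<phi> (v / (T * (1 - X))) else 0) \<partial>lborel)"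
    by (rule nn_integral_cmult) measurable
  ultimately show ?thesis unfolding gamma_kernel_def by simp
qed

lemma measurable_foldr_gamma_step [measurable]:
  "\<psi> \<in> borel_measurable borel \<Longrightarrow> foldr (gamma_step r) as \<psi> \<in> borel_measurable borel"
  by (induction as) auto

text \<open>The product of masses is the same for every \<open>T\<close>, so it can become part of
  the normalising constant; \<open>T\<close> survives only in the rate.\<close>

lemma foldr_gamma_kernel:
  assumes "0 < T" "0 < r" "\<forall>a\<in>set as. 0 < a" and [measurable]: "\<phi> \<in> borel_measurable borel"
  shows "foldr (gamma_kernel r T) as \<phi> X
    = prod_list (map (gamma_mass r) as) * foldr (gamma_step (r * T)) as \<phi> X"
  using assms(3)
proof (induction as arbitrary: X)
  case (Cons a as)
  then have "foldr (gamma_kernel r T) as \<phi>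
    = (\<lambda>X. prod_list (map (gamma_mass r) as) * foldr (gamma_step (r * T)) as \<phi> X)" by auto
  then have "foldr (gamma_kernel r T) (a # as) \<phi> X = prod_list (map (gamma_mass r) as) *
    gamma_kernel r T a (foldr (gamma_step (r * T)) as \<phi>) X"
    by (simp add: gamma_kernel_cmult)
  then show ?case using Cons.prems
    by (simp add: gamma_kernel_eq_step[OF assms(1,2)] mult_ac)
qed simp

lemma gamma_step_mono:
  assumes "\<And>X. \<psi> X \<le> \<psi>' X"
  shows "gamma_step r a \<psi> X \<le> gamma_step r a \<psi>' X"
  using assms by (auto simp: gamma_step_def intro!: divide_right_mono_ennreal nn_integral_mono mult_left_mono)

lemma gamma_step_le:
  assumes "0 < a" "0 < r" "\<And>X. \<psi> X \<le> C"
  shows "gamma_step r a \<psi> X \<le> C"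
proof (cases "X < 1")
  case True
  have m: "gamma_mass r a \<noteq> 0" "gamma_mass r a \<noteq> \<infinity>" using gamma_mass_pos_finite assms by auto
  have "(\<integral>\<^sup>+v. (if 0 < v then ennreal (gamma_weight r a v) * \<psi> (v / (1 - X)) else 0) \<partial>lborel)
    \<le> (\<integral>\<^sup>+v. (if 0 < v then ennreal (gamma_weight r a v) else 0) * C \<partial>lborel)"
    using assms(3) by (intro nn_integral_mono) (auto intro: mult_left_mono)
  also have "\<dots> = gamma_mass r a * C"
    unfolding gamma_mass_def by (rule nn_integral_multc) measurable
  finally have "gamma_step r a \<psi> X \<le> gamma_mass r a * C / gamma_mass r a"
    using True by (simp add: gamma_step_def divide_right_mono_ennreal)
  also have "\<dots> = C" using m by (metis ennreal_mult_divide_eq infinity_ennreal_def mult.commute)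
  finally show ?thesis .
qed (simp add: gamma_step_def)

text \<open>For the same \<open>v\<close>, a larger state leads to a larger next state.\<close>

lemma antimono_gamma_step:
  assumes "antimono \<psi>"
  shows "antimono (gamma_step r a \<psi>)"
proof (rule antimonoI)
  fix X Y :: real assume XY: "X \<le> Y"
  show "gamma_step r a \<psi> Y \<le> gamma_step r a \<psi> X"
  proof (cases "Y < 1")
    case True
    have "\<psi> (v / (1 - Y)) \<le> \<psi> (v / (1 - X))" if "0 < v" for v
      using True XY that by (intro antimonoD[OF assms] divide_left_mono) auto
    then show ?thesis using True XY unfolding gamma_step_def
      by (auto intro!: divide_right_mono_ennreal nn_integral_mono mult_left_mono)
  qed (simp add: gamma_step_def)
qed

text \<open>This is \<open>(b - a) * (d - c) \<ge> 0\<close>, expanded so that no truncated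
  subtraction occurs.\<close>

lemma ennreal_rearrangement:
  fixes a b c d :: ennreal
  assumes "a \<le> b" "c \<le> d"
  shows "a * d + b * c \<le> a * c + b * d"
proof -
  obtain e f where "b = a + e" "d = c + f" using assms by (metis le_iff_add)
  then show ?thesis by (simp add: algebra_simps)
qed

text \<open>The quotient of two gamma densities is monotone, so they cross exactly once; comparing a
  decreasing function with its value at the crossing point gives the stochastic order.\<close>

lemma gamma_step_antimono_shape:
  assumes a: "0 < a" "a \<le> a'" and r: "0 < r" and \<psi>: "antimono \<psi>" "\<And>X. \<psi> X \<le> 1"
    and [measurable]: "\<psi> \<in> borel_measurable borel"
  shows "gamma_step r a' \<psi> X \<le> gamma_step r a \<psi> X"
proof (cases "X < 1 \<and> a < a'")
  case True
  define A where "A = enn2real (gamma_mass r a)"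
  define A' where "A' = enn2real (gamma_mass r a')"
  have m: "gamma_mass r a \<noteq> 0" "gamma_mass r a \<noteq> \<infinity>" "gamma_mass r a' \<noteq> 0" "gamma_mass r a' \<noteq> \<infinity>"
    using gamma_mass_pos_finite assms by auto
  have A: "0 < A" "0 < A'" "gamma_mass r a = ennreal A" "gamma_mass r a' = ennreal A'"
    using m by (auto simp: A_def A'_def enn2real_positive_iff less_top zero_less_iff_neq_zero)
  define w where "w v = ennreal (gamma_weight r a v / A)" for v
  define w' where "w' v = ennreal (gamma_weight r a' v / A')" for v
  \<comment> \<open>The crossing point: the quotient of the normalised densities is
    \<open>v powr (a' - a)\<close> divided by \<open>A' / A\<close>, which equals 1 at
    \<open>u\<close>.\<close>
  define u where "u = (A' / A) powr (1 / (a' - a))"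
  have ratio: "gamma_weight r a' v / A' = (v powr (a' - a) / (A' / A)) * (gamma_weight r a v / A)" if "0 < v" for v
    using A that by (simp add: gamma_weight_def powr_diff field_simps)
  have upow: "u powr (a' - a) = A' / A" using A True by (simp add: u_def powr_powr)
  have u0: "0 < u" using A by (simp add: u_def)
  have hi: "w v \<le> w' v" if "0 < v" "u \<le> v" for v
  proof -
    have "A' / A \<le> v powr (a' - a)" unfolding upow[symmetric] using True u0 that by (intro powr_mono2) auto
    then have "1 \<le> v powr (a' - a) / (A' / A)" using A by (simp add: field_simps)
    then have "1 * (gamma_weight r a v / A) \<le> (v powr (a' - a) / (A' / A)) * (gamma_weight r a v / A)"
      using A by (intro mult_right_mono) auto
    then show ?thesis unfolding w_def w'_def ratio[OF that(1)] by (intro ennreal_leI) simp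
  qed
  have lo: "w' v \<le> w v" if "0 < v" "v \<le> u" for v
  proof -
    have "v powr (a' - a) \<le> A' / A" unfolding upow[symmetric] using True u0 that by (intro powr_mono2) auto
    then have "v powr (a' - a) / (A' / A) \<le> 1" using A by (simp add: field_simps)
    then have "(v powr (a' - a) / (A' / A)) * (gamma_weight r a v / A) \<le> 1 * (gamma_weight r a v / A)"
      using A by (intro mult_right_mono) auto
    then show ?thesis unfolding w_def w'_def ratio[OF that(1)] by (intro ennreal_leI) simp
  qed
  define f where "f v = \<psi> (v / (1 - X))" for v
  have fm [measurable]: "f \<in> borel_measurable borel" unfolding f_def by measurable
  have f: "f v \<le> f v'" if "v' \<le> v" for v v'
    unfolding f_def using True that by (intro antimonoD[OF \<psi>(1)] divide_right_mono) auto
  have [measurable]: "w \<in> borel_measurable borel" "w' \<in> borel_measurable borel"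
    unfolding w_def w'_def by measurable
  have mass: "(\<integral>\<^sup>+v. (if 0 < v then w v else 0) \<partial>lborel) = 1" "(\<integral>\<^sup>+v. (if 0 < v then w' v else 0) \<partial>lborel) = 1"
    and step: "gamma_step r a \<psi> X = (\<integral>\<^sup>+v. (if 0 < v then w v * f v else 0) \<partial>lborel)"
      "gamma_step r a' \<psi> X = (\<integral>\<^sup>+v. (if 0 < v then w' v * f v else 0) \<partial>lborel)"
  proof -
    have gen: "(\<integral>\<^sup>+v. (if 0 < v then ennreal (gamma_weight r b v / B) * h v else 0) \<partial>lborel)
      = (\<integral>\<^sup>+v. (if 0 < v then ennreal (gamma_weight r b v) * h v else 0) \<partial>lborel) / ennreal B"
      if "0 < B" and [measurable]: "h \<in> borel_measurable borel" for b B h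
    proof -
      have "(if 0 < v then ennreal (gamma_weight r b v / B) * h v else 0)
        = (if 0 < v then ennreal (gamma_weight r b v) * h v else 0) / ennreal B" for v
        using that(1) by (simp add: divide_ennreal[symmetric] ennreal_times_divide mult.commute)
      then show ?thesis by (simp add: nn_integral_divide)
    qed
    show "(\<integral>\<^sup>+v. (if 0 < v then w v else 0) \<partial>lborel) = 1" "(\<integral>\<^sup>+v. (if 0 < v then w' v else 0) \<partial>lborel) = 1"
      using gen[OF A(1), of "\<lambda>_. 1" a] gen[OF A(2), of "\<lambda>_. 1" a'] A
      unfolding w_def w'_def gamma_mass_def[symmetric] mult_1_right by simp_all
    show "gamma_step r a \<psi> X = (\<integral>\<^sup>+v. (if 0 < v then w v * f v else 0) \<partial>lborel)"
      "gamma_step r a' \<psi> X = (\<integral>\<^sup>+v. (if 0 < v then w' v * f v else 0) \<partial>lborel)"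
      using gen[OF A(1) fm, of a] gen[OF A(2) fm, of a'] True
      unfolding w_def w'_def gamma_step_def A f_def by (simp_all only: if_True)
  qed
  \<comment> \<open>Pointwise form of \<open>(w' v - w v) * (f v - f u) \<le> 0\<close>, with the
    negative terms moved across. Both densities have mass 1, so after integration the terms with
    \<open>f u\<close> agree and cancel, \<open>f u\<close> being finite.\<close>
  have pt: "(if 0 < v then w' v * f v else 0) + (if 0 < v then w v else 0) * f u
     \<le> (if 0 < v then w v * f v else 0) + (if 0 < v then w' v else 0) * f u" for v
  proof (cases "0 < v")
    case True
    show ?thesis
    proof (cases "u \<le> v")
      case True
      then show ?thesis using ennreal_rearrangement[OF hi[OF \<open>0 < v\<close> True] f[OF True]] \<open>0 < v\<close> by (simp add: add_ac)
    next
      case False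
      then have vu: "v \<le> u" by simp
      show ?thesis using ennreal_rearrangement[OF lo[OF \<open>0 < v\<close> vu] f[OF vu]] \<open>0 < v\<close> by (simp add: add_ac)
    qed
  qed simp
  have "gamma_step r a' \<psi> X + f u
    = (\<integral>\<^sup>+v. (if 0 < v then w' v * f v else 0) + (if 0 < v then w v else 0) * f u \<partial>lborel)"
    by (subst nn_integral_add) (measurable, simp add: nn_integral_multc mass step)
  also have "\<dots> \<le> (\<integral>\<^sup>+v. (if 0 < v then w v * f v else 0) + (if 0 < v then w' v else 0) * f u \<partial>lborel)"
    by (intro nn_integral_mono pt)
  also have "\<dots> = gamma_step r a \<psi> X + f u"
    by (subst nn_integral_add) (measurable, simp add: nn_integral_multc mass step)
  finally have "f u + gamma_step r a' \<psi> X \<le> f u + gamma_step r a \<psi> X" by (simp add: add.commute)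
  moreover have "f u < top" using \<psi>(2)[of "u / (1 - X)"] unfolding f_def by (meson ennreal_one_less_top le_less_trans)
  ultimately show ?thesis by (auto simp: ennreal_add_left_cancel_le)
next
  case False
  then show ?thesis using a by (cases "a = a'") (auto simp: gamma_step_def)
qed

section \<open>Survival probabilities of the chain\<close>

definition survival :: "real \<Rightarrow> real list \<Rightarrow> real \<Rightarrow> ennreal" where
  "survival r as = foldr (gamma_step r) as (\<lambda>_. 1)"

lemma survival_Nil: "survival r [] X = 1"
  by (simp add: survival_def)

lemma survival_Cons: "survival r (a # as) = gamma_step r a (survival r as)"
  by (simp add: survival_def)

lemma measurable_survival [measurable]: "survival r as \<in> borel_measurable borel"
  unfolding survival_def by measurable

lemma antimono_survival: "antimono (survival r as)"
  by (induction as) (auto simp: survival_Cons antimono_gamma_step survival_def[of _ "[]"] intro: antimonoI)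

lemma survival_le_1:
  assumes "0 < r" "\<forall>a\<in>set as. 0 < a"
  shows "survival r as X \<le> 1"
  using assms(2) by (induction as arbitrary: X) (auto simp: survival_Nil survival_Cons intro!: gamma_step_le assms(1))

text \<open>After any step from 0 the state is nonnegative, and survival decreases in the starting
  state. Starting afresh at 0 is therefore at least as good as having taken extra steps.\<close>

lemma survival_append_le:
  assumes "0 < r" "\<forall>a\<in>set cs. 0 < a"
  shows "survival r (cs @ as) 0 \<le> survival r as 0"
  using assms(2)
proof (induction cs)
  case (Cons c cs)
  have "survival r (cs @ as) (v / (1 - 0)) \<le> survival r (cs @ as) 0" if "0 < v" for v
    using that by (intro antimonoD[OF antimono_survival]) auto
  then have "gamma_step r c (survival r (cs @ as)) 0 \<le> gamma_step r c (\<lambda>_. survival r (cs @ as) 0) 0"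
    unfolding gamma_step_def by (auto intro!: divide_right_mono_ennreal nn_integral_mono mult_left_mono)
  also have "\<dots> \<le> survival r (cs @ as) 0"
    using Cons.prems assms(1) by (intro gamma_step_le) auto
  finally show ?case using Cons by (simp add: survival_Cons)
qed simp

text \<open>The shapes are exchanged one at a time: the first by the stochastic order of gamma
  variables, the others by the induction hypothesis under a monotone step.\<close>

lemma survival_mono:
  assumes "0 < r" "list_all2 (\<le>) bs as" "\<forall>b\<in>set bs. 0 < b"
  shows "survival r as X \<le> survival r bs X"
  using assms(2,3)
proof (induction arbitrary: X rule: list_all2_induct)
  case (Cons b bs a as)
  have pos: "\<forall>a\<in>set as. 0 < a"
    using Cons.hyps(2) Cons.prems by (metis in_set_conv_nth list_all2_conv_all_nth list.set_intros(2) less_le_trans nth_mem)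
  have "survival r (a # as) X \<le> gamma_step r b (survival r as) X"
    unfolding survival_Cons
    by (rule gamma_step_antimono_shape) (use Cons assms(1) pos in \<open>auto intro: antimono_survival survival_le_1\<close>)
  also have "\<dots> \<le> survival r (b # bs) X"
    unfolding survival_Cons using Cons by (intro gamma_step_mono) auto
  finally show ?case .
qed simp

text \<open>Needed for the normalising constant. The interval up to 1/2 traps the chain: a state at
  most 1/2 and a gamma variable at most 1/4 give a next state at most 1/2. For a large rate every
  variable is that small with probability close to 1.\<close>

lemma survival_tendsto_1:
  assumes "\<forall>a\<in>set as. 0 < a"
  shows "(\<lambda>n. survival (real (Suc n)) as 0) \<longlonglongrightarrow> 1"
proof -
  \<comment> \<open>The probability that a gamma variable of rate \<open>Suc n\<close> is at most
    1/4, written at rate 1 so that only the cut-off depends on \<open>n\<close>.\<close>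
  define p where "p n a = (\<integral>\<^sup>+v. (if 0 < v then ennreal (gamma_weight 1 a v) * indicator {..real (Suc n) / 4} v else 0) \<partial>lborel)
    / gamma_mass 1 a" for n :: nat and a
  have p: "(\<lambda>n. p n a) \<longlonglongrightarrow> 1" if "0 < a" for a
  proof -
    let ?f = "\<lambda>n v. if 0 < v then ennreal (gamma_weight 1 a v) * indicator {..real (Suc n) / 4} v else 0"
    have inc: "incseq ?f"
      by (intro incseq_SucI le_funI) (auto simp: indicator_def)
    have sup: "(SUP n. ?f n v) = (if 0 < v then ennreal (gamma_weight 1 a v) else 0)" for v
    proof (rule antisym)
      show "(SUP n. ?f n v) \<le> (if 0 < v then ennreal (gamma_weight 1 a v) else 0)"
        by (rule SUP_least) (auto simp: indicator_def)
      obtain n :: nat where "4 * v \<le> real n" using real_arch_simple by blast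
      then have "v \<le> real (Suc n) / 4" by simp
      then show "(if 0 < v then ennreal (gamma_weight 1 a v) else 0) \<le> (SUP n. ?f n v)"
        by (intro SUP_upper2[of n]) auto
    qed
    have "(\<lambda>n. \<integral>\<^sup>+v. ?f n v \<partial>lborel) \<longlonglongrightarrow> (SUP n. \<integral>\<^sup>+v. ?f n v \<partial>lborel)"
      using inc by (intro LIMSEQ_SUP) (auto simp: incseq_def le_fun_def intro!: nn_integral_mono)
    also have "(SUP n. \<integral>\<^sup>+v. ?f n v \<partial>lborel) = gamma_mass 1 a"
      unfolding gamma_mass_def sup[symmetric]
      by (rule nn_integral_monotone_convergence_SUP[symmetric, OF inc]) measurable
    finally have "(\<lambda>n. inverse (gamma_mass 1 a) * (\<integral>\<^sup>+v. ?f n v \<partial>lborel)) \<longlonglongrightarrow> inverse (gamma_mass 1 a) * gamma_mass 1 a"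
      using gamma_mass_pos_finite[OF that, of 1] by (intro ennreal_tendsto_cmult) (auto simp: less_top[symmetric])
    then have "(\<lambda>n. p n a) \<longlonglongrightarrow> gamma_mass 1 a / gamma_mass 1 a"
      unfolding p_def by (simp only: divide_ennreal_def mult.commute)
    then show ?thesis using gamma_mass_pos_finite[OF that, of 1] by (simp add: less_top[symmetric])
  qed
  \<comment> \<open>One step from 1/2: on the event counted by \<open>p n a\<close> the next state
    is at most 1/2, and \<psi> is decreasing.\<close>
  have step: "p n a * \<psi> (1/2) \<le> gamma_step (real (Suc n)) a \<psi> (1/2)"
    if "antimono \<psi>" "0 < a" and [measurable]: "\<psi> \<in> borel_measurable borel" for n a \<psi>
  proof -
    define r where "r = real (Suc n)"
    have r: "0 < r" by (simp add: r_def)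
    have "p n a = (\<integral>\<^sup>+v. (if 0 < v then ennreal (gamma_weight r a v) * indicator {..r / 4} (r * v) else 0) \<partial>lborel)
       / gamma_mass r a"
    proof -
      have t: "ennreal (r powr a) \<noteq> 0" "ennreal (r powr a) \<noteq> top" using r by auto
      have "x * y / (x * z) = y / z" if "x \<noteq> 0" "x \<noteq> top" for x y z :: ennreal
        using divide_mult_eq[of x y z] that by (simp add: mult.commute)
      then show ?thesis
        unfolding p_def r_def[symmetric]
        by (subst nn_integral_gamma_weight_scale[OF r], measurable, subst gamma_mass_scale[OF r]) (use t in \<open>simp cong: if_cong\<close>)
    qed
    then have "p n a * \<psi> (1/2) = (\<integral>\<^sup>+v. (if 0 < v then ennreal (gamma_weight r a v) * indicator {..r / 4} (r * v) else 0) * \<psi> (1/2) \<partial>lborel)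
       / gamma_mass r a"
      by (subst nn_integral_multc) (measurable, simp only: ennreal_divide_times ennreal_times_divide)
    also have "\<dots> \<le> (\<integral>\<^sup>+v. (if 0 < v then ennreal (gamma_weight r a v) * \<psi> (v * 2) else 0) \<partial>lborel) / gamma_mass r a"
    proof (intro divide_right_mono_ennreal nn_integral_mono)
      fix v :: real
      have "\<psi> (1/2) \<le> \<psi> (v * 2)" if "r * v \<le> r / 4"
        using that r by (intro antimonoD[OF \<open>antimono \<psi>\<close>]) auto
      then show "(if 0 < v then ennreal (gamma_weight r a v) * indicator {..r / 4} (r * v) else 0) * \<psi> (1/2)
        \<le> (if 0 < v then ennreal (gamma_weight r a v) * \<psi> (v * 2) else 0)"
        by (auto simp: indicator_def intro!: mult_left_mono)
    qed
    also have "\<dots> = gamma_step r a \<psi> (1/2)"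
    proof -
      have "v / (1 - 1/2) = v * 2" for v :: real by simp
      then show ?thesis unfolding gamma_step_def by (simp only:) simp
    qed
    finally show ?thesis by (simp add: r_def)
  qed
  have half: "(\<lambda>n. survival (real (Suc n)) as (1/2)) \<longlonglongrightarrow> 1"
    using assms
  proof (induction as)
    case (Cons a as)
    have "(\<lambda>n. p n a * survival (real (Suc n)) as (1/2)) \<longlonglongrightarrow> 1 * 1"
      using Cons p[of a] by (intro tendsto_mult_ennreal) auto
    then have lim: "(\<lambda>n. p n a * survival (real (Suc n)) as (1/2)) \<longlonglongrightarrow> 1" by simp
    show ?case
    proof (rule tendsto_sandwich[OF _ _ lim tendsto_const])
      show "\<forall>\<^sub>F n in sequentially. p n a * survival (real (Suc n)) as (1/2) \<le> survival (real (Suc n)) (a # as) (1/2)"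
        unfolding survival_Cons using Cons.prems
        by (intro always_eventually allI step antimono_survival measurable_survival) auto
      show "\<forall>\<^sub>F n in sequentially. survival (real (Suc n)) (a # as) (1/2) \<le> 1"
        using Cons.prems by (intro always_eventually allI survival_le_1) auto
    qed
  qed (simp add: survival_Nil)
  show ?thesis
  proof (rule tendsto_sandwich[OF _ _ half tendsto_const])
    show "\<forall>\<^sub>F n in sequentially. survival (real (Suc n)) as (1/2) \<le> survival (real (Suc n)) as 0"
      by (intro always_eventually allI antimonoD[OF antimono_survival]) simp
    show "\<forall>\<^sub>F n in sequentially. survival (real (Suc n)) as 0 \<le> 1"
      using assms by (intro always_eventually allI survival_le_1) auto
  qed
qed

section \<open>The Laguerre ensemble\<close>

text \<open>Growth at the end matches \<open>foldr\<close>, which applies the last shapes to \<phi>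
  first, just as the recursion removes the top level first.\<close>

primrec shape_list :: "(nat \<Rightarrow> real) \<Rightarrow> (nat \<Rightarrow> real) \<Rightarrow> nat \<Rightarrow> real list" where
  "shape_list a b 0 = []"
| "shape_list a b (Suc n) = shape_list a b n @ [a n, b n]"

lemma shape_list_add:
  "shape_list a b (d + n) = shape_list a b d @ shape_list (\<lambda>k. a (d + k)) (\<lambda>k. b (d + k)) n"
  by (induction n) auto

lemma shape_list_le:
  assumes "\<And>k. k < n \<Longrightarrow> a k \<le> a' k" "\<And>k. k < n \<Longrightarrow> b k \<le> b' k"
  shows "list_all2 (\<le>) (shape_list a b n) (shape_list a' b' n)"
  using assms by (induction n) (auto intro!: list_all2_appendI)

lemma set_shape_list_pos:
  assumes "\<And>k. k < n \<Longrightarrow> 0 < a k" "\<And>k. k < n \<Longrightarrow> 0 < b k"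
  shows "\<forall>x\<in>set (shape_list a b n). 0 < x"
  using assms by (induction n) auto

text \<open>For \<open>c = s * (\<kappa> - N + 1) - 1\<close> the last pair is
  \<open>s * \<kappa>\<close> and \<open>s * N\<close>. These products coincide for the two
  ensembles to be compared, so the lists are aligned at their ends.\<close>

definition laguerre_shapes :: "real \<Rightarrow> nat \<Rightarrow> real \<Rightarrow> real list" where
  "laguerre_shapes s N c = shape_list (\<lambda>k. c + 1 + real k * s) (\<lambda>k. real (Suc k) * s) N"

lemma laguerre_shapes_pos:
  "0 < s \<Longrightarrow> 0 < c + 1 \<Longrightarrow> \<forall>x\<in>set (laguerre_shapes s N c). 0 < x"
  unfolding laguerre_shapes_def by (intro set_shape_list_pos) (auto intro: add_pos_nonneg)

lemma resolvent_int_0: "resolvent_int s r c T 0 \<phi> = \<phi> 0"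
  unfolding resolvent_int_def nn_integral_lborel_pow_0
  by (simp add: chamber_def strict_dec_def point_weight_def)

text \<open>Each half step replaces \<phi> by its image under a kernel, so \<phi> must stay general
  in the induction. The chain starts at 0, the empty sum over no points.\<close>

lemma resolvent_int_eq_foldr:
  assumes "0 < T" "\<phi> \<in> borel_measurable borel"
  shows "resolvent_int s r c T N \<phi> = foldr (gamma_kernel r T) (laguerre_shapes s N c) \<phi> 0"
  using assms(2)
proof (induction N arbitrary: \<phi>)
  case (Suc N)
  then show ?case
    by (simp add: half_step half_step0 assms(1) laguerre_shapes_def)
qed (simp add: resolvent_int_0 laguerre_shapes_def)

lemma nn_integral_prod_gamma_weight:
  "(\<integral>\<^sup>+g. (if \<forall>j<k. 0 < g j then ennreal (\<Prod>j<k. gamma_weight r s (g j)) else 0) \<partial>lborel_pow k)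
    = gamma_mass r s ^ k"
proof (induction k)
  case 0
  show ?case unfolding nn_integral_lborel_pow_0 by simp
next
  case (Suc k)
  have eq: "(if \<forall>j<Suc k. 0 < (g(k := u)) j then ennreal (\<Prod>j<Suc k. gamma_weight r s ((g(k := u)) j)) else 0)
    = (if \<forall>j<k. 0 < g j then ennreal (\<Prod>j<k. gamma_weight r s (g j)) else 0)
      * (if 0 < u then ennreal (gamma_weight r s u) else 0)" for g u
  proof -
    have 1: "(\<forall>j<Suc k. 0 < (g(k := u)) j) \<longleftrightarrow> (\<forall>j<k. 0 < g j) \<and> 0 < u"
      by (auto simp: less_Suc_eq)
    have 2: "(\<Prod>j<Suc k. gamma_weight r s ((g(k := u)) j)) = (\<Prod>j<k. gamma_weight r s (g j)) * gamma_weight r s u"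
      by simp
    show ?thesis unfolding 1 2 by (auto simp: ennreal_mult prod_nonneg)
  qed
  have "(\<integral>\<^sup>+g. (if \<forall>j<Suc k. 0 < g j then ennreal (\<Prod>j<Suc k. gamma_weight r s (g j)) else 0) \<partial>lborel_pow (Suc k))
    = (\<integral>\<^sup>+g. \<integral>\<^sup>+u. (if \<forall>j<k. 0 < g j then ennreal (\<Prod>j<k. gamma_weight r s (g j)) else 0)
      * (if 0 < u then ennreal (gamma_weight r s u) else 0) \<partial>lborel \<partial>lborel_pow k)"
    unfolding eq[symmetric] by (rule nn_integral_lborel_pow_Suc) measurable
  also have "\<dots> = (\<integral>\<^sup>+g. (if \<forall>j<k. 0 < g j then ennreal (\<Prod>j<k. gamma_weight r s (g j)) else 0)
      * gamma_mass r s \<partial>lborel_pow k)"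
    unfolding gamma_mass_def by (intro nn_integral_cong nn_integral_cmult) measurable
  also have "\<dots> = gamma_mass r s ^ k * gamma_mass r s"
    by (subst nn_integral_multc) (measurable, simp only: Suc)
  finally show ?case by (simp add: mult.commute)
qed

text \<open>For constant \<phi> the auxiliary weights integrate out to
  \<open>gamma_mass r s ^ N\<close>, and what remains concerns the points alone.\<close>

lemma nn_integral_chamber:
  assumes "0 < T" "0 < r" "0 < s" "0 < c + 1"
  shows "(\<integral>\<^sup>+x. (if chamber T N x then ennreal (point_weight s r c N x) else 0) \<partial>lborel_pow N)
    = prod_list (map (gamma_mass r) (laguerre_shapes s N c)) / gamma_mass r s ^ N
      * survival (r * T) (laguerre_shapes s N c) 0" (is "?I = _")
proof -
  have [measurable]: "Measurable.pred (lborel_pow N) (chamber T N)" "point_weight s r c N \<in> borel_measurable (lborel_pow N)"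
    unfolding chamber_def strict_dec_def point_weight_def vandermonde_def by measurable
  have m: "gamma_mass r s ^ N \<noteq> 0" "gamma_mass r s ^ N \<noteq> top"
    using gamma_mass_pos_finite[of s r] assms by (auto simp: power_eq_top_ennreal)
  have "?I * gamma_mass r s ^ N = resolvent_int s r c T N (\<lambda>_. 1)"
    unfolding resolvent_int_def mult_1_right nn_integral_prod_gamma_weight
    by (subst nn_integral_multc[symmetric]) (measurable, auto intro!: nn_integral_cong)
  also have "\<dots> = prod_list (map (gamma_mass r) (laguerre_shapes s N c)) * survival (r * T) (laguerre_shapes s N c) 0"
    using assms laguerre_shapes_pos[of s c N]
    by (simp add: resolvent_int_eq_foldr foldr_gamma_kernel survival_def)
  finally have "?I = prod_list (map (gamma_mass r) (laguerre_shapes s N c)) * survival (r * T) (laguerre_shapes s N c) 0 / gamma_mass r s ^ N"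
    using ennreal_mult_divide_eq[OF m, of ?I] by simp
  then show ?thesis by (simp only: ennreal_divide_times ennreal_times_divide)
qed

lemma prod_ordered_pairs:
  fixes f :: "nat \<Rightarrow> nat \<Rightarrow> real"
  shows "(\<Prod>j<N. \<Prod>k<N. if j < k then f j k else 1) = (\<Prod>k<N. \<Prod>j<k. f j k)"
proof -
  have "(\<Prod>j<N. \<Prod>k<N. if j < k then f j k else 1) = (\<Prod>k<N. \<Prod>j<N. if j < k then f j k else 1)"
    by (rule prod.swap)
  also have "\<dots> = (\<Prod>k<N. \<Prod>j<k. f j k)"
  proof (rule prod.cong[OF refl])
    fix k assume "k \<in> {..<N}"
    then have "{..<N} \<inter> {j. j < k} = {..<k}" by auto
    then show "(\<Prod>j<N. if j < k then f j k else 1) = (\<Prod>j<k. f j k)"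
      by (simp add: prod.If_cases)
  qed
  finally show ?thesis .
qed

lemma prod_list_gamma_mass:
  assumes "0 < r" "\<forall>a\<in>set as. 0 < a"
  shows "prod_list (map (gamma_mass r) as) \<noteq> 0 \<and> prod_list (map (gamma_mass r) as) \<noteq> top"
  using assms(2)
proof (induction as)
  case (Cons a as)
  then show ?case using gamma_mass_pos_finite[of a r] assms(1) by (simp add: ennreal_mult_eq_top_iff)
qed simp

section \<open>The law of the largest point\<close>

locale laguerre =
  fixes \<beta> \<kappa> :: real and N :: nat
  assumes \<beta>: "0 < \<beta>" and N: "0 < N" and \<kappa>: "real N - 1 < \<kappa>"
begin

definition expo :: real where
  "expo = \<beta> / 2 * (\<kappa> - real N + 1) - 1"

lemma expo_pos: "0 < expo + 1"
  using \<beta> \<kappa> by (simp add: expo_def)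

abbreviation shapes :: "real list" where
  "shapes \<equiv> laguerre_shapes (\<beta> / 2) N expo"

lemma weight_chamber:
  assumes "chamber T N x"
  shows "laguerre_weight \<beta> N \<kappa> x = point_weight (\<beta> / 2) (\<beta> / 2) expo N x"
proof -
  have "(\<Prod>k<N. x k powr expo * exp (- \<beta> / 2 * x k)) = (\<Prod>i<N. x i) powr expo * exp (- (\<beta> / 2) * (\<Sum>i<N. x i))"
    unfolding prod.distrib sum_distrib_left exp_sum[OF finite_lessThan] prod_powr_distrib by simp
  moreover have "(\<Prod>j<N. \<Prod>k<N. if j < k then \<bar>x j - x k\<bar> powr \<beta> else 1) = vandermonde N x powr \<beta>"
    unfolding prod_ordered_pairs vandermonde_def prod_powr_distrib
  proof (intro prod.cong refl)
    fix k j assume "k \<in> {..<N}" "j \<in> {..<k}"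
    then have "x k < x j" using assms by (auto simp: chamber_def intro: strict_decD)
    then show "\<bar>x j - x k\<bar> powr \<beta> = (x j - x k) powr \<beta>" by simp
  qed
  ultimately show ?thesis by (simp add: laguerre_weight_def point_weight_def expo_def)
qed

text \<open>\<open>laguerre_region\<close> allows ties and \<open>chamber\<close> does not. Since
  the weight vanishes on ties, the two integrands agree pointwise.\<close>

lemma weight_tie:
  assumes "Suc i < N" "x (Suc i) = x i"
  shows "laguerre_weight \<beta> N \<kappa> x = 0"
proof -
  have tie: "(\<Prod>j<Suc i. \<bar>x j - x (Suc i)\<bar> powr \<beta>) = 0" using assms by simp
  have "(\<Prod>k<N. \<Prod>j<k. \<bar>x j - x k\<bar> powr \<beta>) = 0"
  proof (rule prod_zero[OF finite_lessThan])
    show "\<exists>k\<in>{..<N}. (\<Prod>j<k. \<bar>x j - x k\<bar> powr \<beta>) = 0"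
      by (rule bexI[of _ "Suc i"]) (use assms(1) tie in \<open>simp_all only: lessThan_iff\<close>)
  qed
  then show ?thesis unfolding laguerre_weight_def prod_ordered_pairs by simp
qed

lemma density_below:
  assumes "x \<in> space (lborel_pow N)"
  shows "indicator (laguerre_region N) x * ennreal (laguerre_weight \<beta> N \<kappa> x) * indicator {x. x 0 < T} x
    = (if chamber T N x then ennreal (point_weight (\<beta> / 2) (\<beta> / 2) expo N x) else 0)"
proof (cases "chamber T N x")
  case True
  then have "x \<in> laguerre_region N"
    using assms strict_decD[of N x] by (auto simp: laguerre_region_def chamber_def cfg_space_def less_imp_le)
  moreover have "x 0 < T" using True N by (simp add: chamber_def)
  ultimately show ?thesis using True by (simp add: weight_chamber)
next
  case False
  show ?thesis
  proof (cases "x \<in> laguerre_region N \<and> x 0 < T")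
    case in_region: True
    have "x i \<le> x 0" if "i < N" for i
      using in_region that by (cases i) (auto simp: laguerre_region_def)
    then have "\<forall>i<N. 0 < x i \<and> x i < T"
      using in_region by (force simp: laguerre_region_def)
    then obtain i where i: "Suc i < N" "\<not> x (Suc i) < x i"
      using False by (auto simp: chamber_def strict_dec_def)
    moreover have "x (Suc i) \<le> x i" using in_region i by (auto simp: laguerre_region_def)
    ultimately have "laguerre_weight \<beta> N \<kappa> x = 0" by (intro weight_tie) auto
    then show ?thesis using False by simp
  qed (use False in auto)
qed

lemma measurable_density [measurable]:
  "(\<lambda>x. indicator (laguerre_region N) x * ennreal (laguerre_weight \<beta> N \<kappa> x)) \<in> borel_measurable (lborel_pow N)"
proof -
  have "laguerre_region N = {x \<in> space (lborel_pow N). (\<forall>k<N. 0 < x k) \<and> (\<forall>k\<in>{..<N}. \<forall>j\<in>{..<k}. x k \<le> x j)}"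
    by (auto simp: laguerre_region_def cfg_space_def)
  also have "\<dots> \<in> sets (lborel_pow N)"
  proof -
    have "Measurable.pred (lborel_pow N) (\<lambda>x. x k \<le> x j)" if "k \<in> {..<N}" "j \<in> {..<k}" for j k
    proof -
      have "(\<lambda>x. x i) \<in> borel_measurable (lborel_pow N)" if "i < N" for i
        using measurable_component_singleton[of i "{..<N}" "\<lambda>_. lborel :: real measure"] that
        by (simp only: measurable_lborel1 lessThan_iff)
      then show ?thesis unfolding pred_def using that by (intro borel_measurable_le) auto
    qed
    then have [measurable]: "Measurable.pred (lborel_pow N) (\<lambda>x. \<forall>k\<in>{..<N}. \<forall>j\<in>{..<k}. x k \<le> x j)"
      by (intro pred_intros_finite(3) finite_lessThan)
    show ?thesis by measurable
  qed
  finally have [measurable]: "laguerre_region N \<in> sets (lborel_pow N)" .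
  show ?thesis unfolding laguerre_weight_def prod_ordered_pairs by measurable
qed

lemma measurable_first [measurable]: "(\<lambda>x. x 0) \<in> borel_measurable (lborel_pow N)"
proof -
  have "0 \<in> {..<N}" using N by simp
  from measurable_component_singleton[OF this, of "\<lambda>_. lborel :: real measure"]
  show ?thesis by (simp only: measurable_lborel1)
qed

text \<open>The closed form of \<open>laguerre_Z\<close>, a Selberg-type integral, that the
  recursion provides.\<close>

definition norm_const :: ennreal where
  "norm_const = prod_list (map (gamma_mass (\<beta> / 2)) shapes) / gamma_mass (\<beta> / 2) (\<beta> / 2) ^ N"

lemma norm_const_pos_finite: "norm_const \<noteq> 0" "norm_const \<noteq> top"
proof -
  have P: "prod_list (map (gamma_mass (\<beta> / 2)) shapes) \<noteq> 0" "prod_list (map (gamma_mass (\<beta> / 2)) shapes) \<noteq> top"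
  proof -
    have "0 < \<beta> / 2" using \<beta> by simp
    from prod_list_gamma_mass[OF this laguerre_shapes_pos[OF this expo_pos]]
    show "prod_list (map (gamma_mass (\<beta> / 2)) shapes) \<noteq> 0" "prod_list (map (gamma_mass (\<beta> / 2)) shapes) \<noteq> top"
      by blast+
  qed
  have G: "gamma_mass (\<beta> / 2) (\<beta> / 2) ^ N \<noteq> 0" "gamma_mass (\<beta> / 2) (\<beta> / 2) ^ N \<noteq> top"
    using gamma_mass_pos_finite[of "\<beta> / 2" "\<beta> / 2"] \<beta> by (simp_all add: power_eq_top_ennreal)
  show "norm_const \<noteq> 0" "norm_const \<noteq> top"
    unfolding norm_const_def ennreal_divide_eq_0_iff ennreal_divide_eq_top_iff using P G by blast+
qed

lemma nn_integral_below:
  assumes "0 < T"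
  shows "(\<integral>\<^sup>+x. indicator (laguerre_region N) x * ennreal (laguerre_weight \<beta> N \<kappa> x) * indicator {x. x 0 < T} x \<partial>lborel_pow N)
    = norm_const * survival (\<beta> / 2 * T) shapes 0"
proof -
  have "(\<integral>\<^sup>+x. indicator (laguerre_region N) x * ennreal (laguerre_weight \<beta> N \<kappa> x) * indicator {x. x 0 < T} x \<partial>lborel_pow N)
    = (\<integral>\<^sup>+x. (if chamber T N x then ennreal (point_weight (\<beta> / 2) (\<beta> / 2) expo N x) else 0) \<partial>lborel_pow N)"
    by (intro nn_integral_cong density_below)
  also have "\<dots> = norm_const * survival (\<beta> / 2 * T) shapes 0"
    unfolding norm_const_def using assms \<beta> expo_pos by (intro nn_integral_chamber) auto
  finally show ?thesis .
qed

text \<open>Lets the threshold tend to infinity: the restricted integrals increase to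
  \<open>laguerre_Z\<close>, while the survival probability tends to 1.\<close>

lemma laguerre_Z_eq: "laguerre_Z \<beta> N \<kappa> = norm_const"
proof -
  \<comment> \<open>The thresholds are chosen so that the rate \<open>\<beta> / 2 * T\<close> is
    exactly \<open>Suc n\<close>.\<close>
  define f where "f n x = indicator (laguerre_region N) x * ennreal (laguerre_weight \<beta> N \<kappa> x)
    * indicator {x. x 0 < real (Suc n) / (\<beta> / 2)} x" for n :: nat and x
  have sup: "(SUP n. f n x) = indicator (laguerre_region N) x * ennreal (laguerre_weight \<beta> N \<kappa> x)" for x
  proof (rule antisym)
    obtain n :: nat where n: "x 0 * (\<beta> / 2) < real n" using reals_Archimedean2 by blast
    then have "x 0 < real (Suc n) / (\<beta> / 2)" using \<beta> by (simp add: field_simps)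
    then show "indicator (laguerre_region N) x * ennreal (laguerre_weight \<beta> N \<kappa> x) \<le> (SUP n. f n x)"
      by (intro SUP_upper2[of n]) (auto simp: f_def)
  qed (auto intro!: SUP_least simp: f_def indicator_def)
  have inc: "incseq f"
  proof (intro incseq_SucI le_funI)
    fix n x
    have "real (Suc n) / (\<beta> / 2) \<le> real (Suc (Suc n)) / (\<beta> / 2)" using \<beta> by (intro divide_right_mono) auto
    then show "f n x \<le> f (Suc n) x"
      unfolding f_def by (auto simp: indicator_def)
  qed
  have [measurable]: "f n \<in> borel_measurable (lborel_pow N)" for n
  proof -
    have "f n = (\<lambda>x. if x 0 < real (Suc n) / (\<beta> / 2)
      then indicator (laguerre_region N) x * ennreal (laguerre_weight \<beta> N \<kappa> x) else 0)"
      by (auto simp: f_def fun_eq_iff)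
    then show ?thesis by simp
  qed
  have val: "(\<integral>\<^sup>+x. f n x \<partial>lborel_pow N) = norm_const * survival (real (Suc n)) shapes 0" for n
  proof -
    have "\<beta> / 2 * (real (Suc n) / (\<beta> / 2)) = real (Suc n)" "0 < real (Suc n) / (\<beta> / 2)" using \<beta> by auto
    then show ?thesis unfolding f_def by (simp only: nn_integral_below)
  qed
  have "(\<lambda>n. norm_const * survival (real (Suc n)) shapes 0) \<longlonglongrightarrow> norm_const * 1"
    using norm_const_pos_finite \<beta> expo_pos
    by (intro ennreal_tendsto_cmult survival_tendsto_1 laguerre_shapes_pos) (auto simp: less_top[symmetric])
  then have "(\<lambda>n. \<integral>\<^sup>+x. f n x \<partial>lborel_pow N) \<longlonglongrightarrow> norm_const" by (simp only: val mult_1_right)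
  moreover have "(\<lambda>n. \<integral>\<^sup>+x. f n x \<partial>lborel_pow N) \<longlonglongrightarrow> (SUP n. \<integral>\<^sup>+x. f n x \<partial>lborel_pow N)"
    using inc by (intro LIMSEQ_SUP) (auto simp: incseq_def le_fun_def intro!: nn_integral_mono)
  ultimately have "norm_const = (SUP n. \<integral>\<^sup>+x. f n x \<partial>lborel_pow N)" by (rule LIMSEQ_unique)
  also have "\<dots> = (\<integral>\<^sup>+x. (SUP n. f n x) \<partial>lborel_pow N)"
    by (rule nn_integral_monotone_convergence_SUP[symmetric, OF inc]) measurable
  finally show ?thesis unfolding sup laguerre_Z_def cfg_space_def by simp
qed

abbreviation M :: "(nat \<Rightarrow> real) measure" where
  "M \<equiv> laguerre_ensemble \<beta> N \<kappa>"

lemma space_M: "space M = space (lborel_pow N)" and sets_M: "sets M = sets (lborel_pow N)"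
  by (simp_all add: laguerre_ensemble_def cfg_space_def)

lemma emeasure_M:
  assumes [measurable]: "A \<in> sets (lborel_pow N)"
  shows "emeasure M A = (\<integral>\<^sup>+x. indicator (laguerre_region N) x * ennreal (laguerre_weight \<beta> N \<kappa> x) * indicator A x \<partial>lborel_pow N) / norm_const"
proof -
  have "a / norm_const * b = a * b / norm_const" for a b :: ennreal
    by (simp only: ennreal_divide_times ennreal_times_divide)
  then show ?thesis
    unfolding laguerre_ensemble_def cfg_space_def laguerre_Z_eq
    by (subst emeasure_density) (measurable, simp add: nn_integral_divide)
qed

lemma prob_space_M: "prob_space M"
proof
  have "(\<integral>\<^sup>+x. indicator (laguerre_region N) x * ennreal (laguerre_weight \<beta> N \<kappa> x) * indicator (space (lborel_pow N)) x \<partial>lborel_pow N) = norm_const"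
    unfolding laguerre_Z_eq[symmetric] laguerre_Z_def cfg_space_def by (intro nn_integral_cong) simp
  then show "emeasure M (space M) = 1"
    using norm_const_pos_finite by (simp add: space_M emeasure_M less_top[symmetric])
qed

lemma emeasure_below:
  "emeasure M {x \<in> space M. x 0 < T} = (if 0 < T then survival (\<beta> / 2 * T) shapes 0 else 0)"
proof -
  have "emeasure M {x \<in> space M. x 0 < T} = (\<integral>\<^sup>+x. indicator (laguerre_region N) x *
     ennreal (laguerre_weight \<beta> N \<kappa> x) * indicator {x. x 0 < T} x \<partial>lborel_pow N) / norm_const"
    unfolding space_M by (subst emeasure_M) (measurable, auto intro!: arg_cong[where f = "\<lambda>a. a / norm_const"] nn_integral_cong simp: indicator_def)
  also have "\<dots> = (if 0 < T then survival (\<beta> / 2 * T) shapes 0 else 0)"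
  proof (cases "0 < T")
    case True
    then show ?thesis using norm_const_pos_finite by (simp add: nn_integral_below mult.commute[of norm_const] ennreal_mult_divide_eq)
  next
    case False
    then have "\<not> chamber T N x" for x using N by (force simp: chamber_def)
    then show ?thesis using False by (simp add: density_below cong: nn_integral_cong)
  qed
  finally show ?thesis .
qed

text \<open>Bridges the strict event below \<open>T\<close>, which the recursion computes, and the
  strict tail event of the theorem: they are complementary up to this null set.\<close>

lemma AE_first_neq: "AE x in M. x 0 \<noteq> T"
proof (rule AE_I')
  interpret product_sigma_finite "\<lambda>_::nat. lborel :: real measure" ..
  define A where "A = (\<Pi>\<^sub>E i\<in>{..<N}. if i = 0 then {T} else UNIV)"
  have A [measurable]: "A \<in> sets (lborel_pow N)"
    unfolding A_def by (intro sets_PiM_I_finite) auto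
  have "emeasure (lborel_pow N) A = (\<Prod>i<N. emeasure lborel (if i = 0 then {T} else UNIV))"
    unfolding A_def by (intro emeasure_PiM) auto
  also have "\<dots> = 0" using N by (intro prod_zero) (auto intro!: bexI[of _ 0])
  finally have null: "emeasure (lborel_pow N) A = 0" .
  then have "AE x in lborel_pow N. x \<notin> A" by (intro AE_not_in) (auto simp: null_sets_def A)
  then have "(\<integral>\<^sup>+x. indicator (laguerre_region N) x * ennreal (laguerre_weight \<beta> N \<kappa> x) * indicator A x \<partial>lborel_pow N) = (\<integral>\<^sup>+x. 0 \<partial>lborel_pow N)"
    by (intro nn_integral_cong_AE) (auto simp: indicator_def)
  then have "emeasure M A = 0" by (simp add: emeasure_M A)
  then show "A \<in> null_sets M" by (simp add: null_sets_def sets_M A)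
  show "{x \<in> space M. \<not> x 0 \<noteq> T} \<subseteq> A"
    unfolding A_def space_M by (auto simp: space_PiM PiE_def Pi_def)
qed

lemma measure_above:
  "measure M {x \<in> space M. T < x 0} = 1 - enn2real (if 0 < T then survival (\<beta> / 2 * T) shapes 0 else 0)"
proof -
  interpret prob_space M by (rule prob_space_M)
  have sets: "{x \<in> space M. x 0 < T} \<in> sets M" "{x \<in> space M. T < x 0} \<in> sets M"
    unfolding sets_M space_M by measurable
  have "measure M {x \<in> space M. T < x 0} = measure M (space M - {x \<in> space M. x 0 < T})"
    using AE_first_neq[of T] sets by (intro finite_measure_eq_AE) auto
  also have "\<dots> = 1 - measure M {x \<in> space M. x 0 < T}"
    by (rule prob_compl) fact
  finally show ?thesis unfolding measure_def emeasure_below by simp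
qed

end

section \<open>Edge scaling and comparison of the two ensembles\<close>

lemma scaled_L_tail_eq:
  assumes "0 < c" "0 < \<kappa>" "0 < N"
  shows "scaled_L_tail c \<beta> N \<kappa> t = measure (laguerre_ensemble \<beta> N \<kappa>)
    {x \<in> space (laguerre_ensemble \<beta> N \<kappa>).
      (t / (c * (sqrt (\<kappa> * real N) powr (1/3) * (sqrt \<kappa> + sqrt (real N)) powr (2/3))) + 1) * (sqrt \<kappa> + sqrt (real N))^2 < x 0}"
proof -
  define A where "A = c * (sqrt (\<kappa> * real N) powr (1/3) * (sqrt \<kappa> + sqrt (real N)) powr (2/3))"
  define B where "B = (sqrt \<kappa> + sqrt (real N))^2"
  have b: "0 < sqrt \<kappa> + sqrt (real N)" using assms by (simp add: add_pos_pos)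
  have AB: "0 < A" "0 < B" using assms b by (auto simp: A_def B_def)
  have iff: "t < A * (y / B - 1) \<longleftrightarrow> (t / A + 1) * B < y" for y
    using AB by (simp add: field_simps)
  have L: "c * laguerre_L N \<kappa> x = A * (x 0 / B - 1)" for x
    by (simp add: laguerre_L_def A_def B_def mult_ac)
  show ?thesis unfolding scaled_L_tail_def L iff A_def[symmetric] B_def[symmetric] ..
qed

text \<open>At distance \<open>i = n - k - 1\<close> from the end the shapes are
  \<open>s * (\<kappa> - i)\<close> and \<open>s * (N - i)\<close>. The leading products agree, so
  the ensembles differ only in the subtracted \<open>s * i\<close>, and the smaller \<open>s\<close>
  leaves the larger shapes. Its additional \<open>m - n\<close> pairs stand in front and only lower
  survival.\<close>

lemma laguerre_shapes_dominated:
  assumes "0 < s1" "s1 \<le> s2" "0 < n" "n \<le> m" "s1 * real m = s2 * real n" "s1 * \<kappa>1 = s2 * \<kappa>2"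
    and "real m - 1 < \<kappa>1" "real n - 1 < \<kappa>2" "0 < r"
  shows "survival r (laguerre_shapes s1 m (s1 * (\<kappa>1 - real m + 1) - 1)) 0
    \<le> survival r (laguerre_shapes s2 n (s2 * (\<kappa>2 - real n + 1) - 1)) 0"
proof -
  define a1 where "a1 k = s1 * (\<kappa>1 - real m + 1) - 1 + 1 + real k * s1" for k
  define b1 where "b1 k = real (Suc k) * s1" for k
  define a2 where "a2 k = s2 * (\<kappa>2 - real n + 1) - 1 + 1 + real k * s2" for k
  define b2 where "b2 k = real (Suc k) * s2" for k
  define d where "d = m - n"
  have m: "m = d + n" using assms by (simp add: d_def)
  have "0 < s1 * (\<kappa>1 - real m + 1)" "0 < s2 * (\<kappa>2 - real n + 1)"
    using assms by (auto intro!: mult_pos_pos)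
  then have pos: "0 < a1 k" "0 < b1 k" "0 < a2 k" "0 < b2 k" for k
    using assms(1,2) unfolding a1_def b1_def a2_def b2_def
    by (auto intro!: add_pos_nonneg mult_pos_pos simp del: zero_less_mult_iff)
  have gap: "s1 * (real n - real k - 1) \<le> s2 * (real n - real k - 1)" if "k < n" for k
    using assms that by (intro mult_right_mono) auto
  have a: "a2 k \<le> a1 (d + k)" if "k < n" for k
    using gap[OF that] assms(6) by (simp add: a1_def a2_def m algebra_simps)
  have b: "b2 k \<le> b1 (d + k)" if "k < n" for k
    using gap[OF that] assms(5) by (simp add: b1_def b2_def m algebra_simps)
  have "survival r (shape_list a1 b1 m) 0 \<le> survival r (shape_list (\<lambda>k. a1 (d + k)) (\<lambda>k. b1 (d + k)) n) 0"
    unfolding m shape_list_add using assms pos by (intro survival_append_le set_shape_list_pos)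
  also have "\<dots> \<le> survival r (shape_list a2 b2 n) 0"
    using assms pos a b by (intro survival_mono shape_list_le set_shape_list_pos)
  finally show ?thesis
    unfolding laguerre_shapes_def a1_def b1_def a2_def b2_def .
qed

theorem theorem2:
  fixes \<beta>1 \<beta>2 \<kappa> :: real and m n :: nat
  assumes "0 < \<beta>1" and "\<beta>1 < \<beta>2"
    and "0 < m" and "0 < n"
    and "\<beta>2 / \<beta>1 = real m / real n"
    and "\<kappa> > real n - 1"
    and "real m * \<kappa> / real n > real m - 1"
  shows "\<forall>t::real. scaled_L_tail (\<beta>1 powr (2/3)) \<beta>1 m (real m * \<kappa> / real n) t
                   \<ge> scaled_L_tail (\<beta>2 powr (2/3)) \<beta>2 n \<kappa> t"
proof
  fix t :: real
  define \<rho> where "\<rho> = \<beta>2 / \<beta>1"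
  have \<rho>: "0 < \<rho>" "\<beta>2 = \<beta>1 * \<rho>" "real m = \<rho> * real n" "real m * \<kappa> / real n = \<rho> * \<kappa>"
  proof -
    show "0 < \<rho>" using assms(1,2) by (simp add: \<rho>_def)
    show "\<beta>2 = \<beta>1 * \<rho>" using assms(1) by (simp add: \<rho>_def)
    have "\<rho> = real m / real n" by (simp add: \<rho>_def assms(5))
    then show "real m = \<rho> * real n" "real m * \<kappa> / real n = \<rho> * \<kappa>" using assms(4) by simp_all
  qed
  have \<kappa>: "0 < \<kappa>" using assms(4,6) by linarith
  have mn: "n \<le> m"
  proof -
    have "1 < real m / real n" unfolding assms(5)[symmetric] using assms(1,2) by simp
    then show ?thesis using assms(4) by (simp add: field_simps)
  qed
  interpret L1: laguerre \<beta>1 "\<rho> * \<kappa>" m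
    using assms(1,3,7) unfolding \<rho>(4) by unfold_locales
  interpret L2: laguerre \<beta>2 \<kappa> n
    using assms(1,2,4,6) by unfold_locales auto
  define A where "A = sqrt (\<kappa> * real n) powr (1/3) * (sqrt \<kappa> + sqrt (real n)) powr (2/3)"
  define B where "B = (sqrt \<kappa> + sqrt (real n))^2"
  \<comment> \<open>The threshold for the largest point of the second ensemble that corresponds to
    \<open>t\<close>; for the first ensemble it will be \<open>\<rho> * \<theta>\<close>.\<close>
  define \<theta> where "\<theta> = (t / (\<beta>2 powr (2/3) * A) + 1) * B"
  have sum: "sqrt (\<rho> * \<kappa>) + sqrt (real m) = sqrt \<rho> * (sqrt \<kappa> + sqrt (real n))"
    by (simp add: \<rho>(3) real_sqrt_mult algebra_simps)
  have B1: "(sqrt (\<rho> * \<kappa>) + sqrt (real m))^2 = \<rho> * B"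
    unfolding sum B_def using \<rho>(1) by (simp add: power_mult_distrib)
  \<comment> \<open>Both powers contribute \<open>\<rho> powr (1/3)\<close>, and together they turn
    \<open>\<beta>1 powr (2/3)\<close> into \<open>\<beta>2 powr (2/3)\<close>. This is where the
    prefactors of the theorem come from.\<close>
  have A1: "\<beta>1 powr (2/3) * (sqrt (\<rho> * \<kappa> * real m) powr (1/3) * (sqrt (\<rho> * \<kappa>) + sqrt (real m)) powr (2/3))
    = \<beta>2 powr (2/3) * A"
  proof -
    have "sqrt (\<rho> * \<kappa> * real m) = \<rho> * sqrt (\<kappa> * real n)"
      using \<rho>(1) by (simp add: \<rho>(3) real_sqrt_mult)
    moreover have "sqrt \<rho> powr (2/3) = \<rho> powr (1/3)"
      using \<rho>(1) by (simp add: powr_half_sqrt[symmetric] powr_powr)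
    moreover have "\<rho> powr (2/3) = \<rho> powr (1/3) * \<rho> powr (1/3)"
      by (simp add: powr_add[symmetric])
    ultimately show ?thesis
      unfolding sum A_def \<rho>(2) using \<rho>(1) assms \<kappa> by (simp add: powr_mult)
  qed
  have tail2: "scaled_L_tail (\<beta>2 powr (2/3)) \<beta>2 n \<kappa> t = measure L2.M {x \<in> space L2.M. \<theta> < x 0}"
    using assms \<kappa> by (simp add: scaled_L_tail_eq \<theta>_def A_def B_def)
  have tail1: "scaled_L_tail (\<beta>1 powr (2/3)) \<beta>1 m (\<rho> * \<kappa>) t = measure L1.M {x \<in> space L1.M. \<rho> * \<theta> < x 0}"
  proof -
    have eq: "(t / (\<beta>2 powr (2/3) * A) + 1) * (\<rho> * B) = \<rho> * \<theta>" by (simp add: \<theta>_def mult_ac)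
    show ?thesis
      by (rule scaled_L_tail_eq[of "\<beta>1 powr (2/3)" "\<rho> * \<kappa>" m \<beta>1 t, unfolded A1 B1 eq])
        (use assms(1,3) \<kappa> \<rho>(1) in auto)
  qed
  have "survival (\<beta>1 / 2 * (\<rho> * \<theta>)) L1.shapes 0 \<le> survival (\<beta>2 / 2 * \<theta>) L2.shapes 0" if "0 < \<theta>"
  proof -
    \<comment> \<open>The thresholds are in the ratio \<rho> and the \<beta> in the inverse ratio,
      so both chains run at the same rate.\<close>
    have eq: "\<beta>1 / 2 * (\<rho> * \<theta>) = \<beta>2 / 2 * \<theta>" by (simp add: \<rho>(2))
    have "\<beta>1 / 2 * real m = \<beta>2 / 2 * real n" "\<beta>1 / 2 * (\<rho> * \<kappa>) = \<beta>2 / 2 * \<kappa>"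
      by (simp_all add: \<rho>(2,3))
    then show ?thesis
      unfolding L1.expo_def L2.expo_def eq
      by (rule laguerre_shapes_dominated[rotated 4])
        (use assms(1,2,4) mn L1.\<kappa> L2.\<kappa> L2.\<beta> that in simp_all)
  qed
  moreover have "survival (\<beta>2 / 2 * \<theta>) L2.shapes 0 \<noteq> top" if "0 < \<theta>"
    using survival_le_1[of "\<beta>2 / 2 * \<theta>" L2.shapes 0] laguerre_shapes_pos[of "\<beta>2 / 2" L2.expo n] L2.\<beta> L2.expo_pos that
    by (auto simp: top_unique)
  \<comment> \<open>For a nonpositive \<theta> both tails equal 1. Otherwise the survival
    probabilities compare in the reverse order, and finiteness allows the passage to reals.\<close>
  ultimately show "scaled_L_tail (\<beta>2 powr (2/3)) \<beta>2 n \<kappa> t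
      \<le> scaled_L_tail (\<beta>1 powr (2/3)) \<beta>1 m (real m * \<kappa> / real n) t"
    unfolding \<rho>(4) tail1 tail2 L1.measure_above L2.measure_above
    using \<rho>(1) by (auto simp: zero_less_mult_iff less_top intro!: enn2real_mono)
qed

end
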